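(* Let $k$ be an algebraically closed field with $\operatorname{char}(k) = 0$. Let $L\colon k^n \to k^{m\times m}$ be a linear map with $m \ge 2$, and let $f(x) := \det_m(L(x))$. Then $\operatorname{codim}(\operatorname{Sing}(f)) \le \min(4,n)$, and equality holds if $L$ is a general linear map. In particular, letting $\mathbf{V}(f)\subseteq \mathbb{P}^{n-1}$ be the projective hypersurface defined by $f$: (1) if $n \le 4$, then $\mathbf{V}(f)$ is nonsingular for a general linear map $L$; (2) if $n > 4$, then $\mathbf{V}(f)$ is singular for every linear map $L$.
   Context: $\det_m$ denotes the determinant polynomial of an $m\times m$ matrix of indeterminates. $\operatorname{Sing}(f)$ denotes the singular locus of the affine hypersurface $\mathrm{V}(f)\subseteq k^n$ (the common zero locus of $f$ and all partial derivatives $\partial f/\partial x_i$), and its codimension is taken in $k^n$. "General" means: for all $L$ in a nonempty Zariski-open subset of the space of linear maps $k^n\to k^{m\times m}$. *)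

theory Defs
  imports "HOL-Analysis.Determinants" "HOL-Library.Poly_Mapping" "HOL-Library.Extended_Real"
    "HOL-Computational_Algebra.Polynomial"
begin

section \<open>Polynomials in finitely many variables\<close>

text \<open>The polynomial ring \<open>k[x\<^sub>v : v \<in> 'v]\<close>: the exponent vectors are the
  maps from \<open>'v\<close> to the naturals.\<close>

type_synonym ('v, 'k) mpoly = "('v \<Rightarrow>\<^sub>0 nat) \<Rightarrow>\<^sub>0 'k"

definition mvar :: "'v \<Rightarrow> ('v, 'k::comm_ring_1) mpoly" where
  "mvar i = Poly_Mapping.single (Poly_Mapping.single i 1) 1"

definition mconst :: "'k \<Rightarrow> ('v, 'k::comm_ring_1) mpoly" where
  "mconst c = Poly_Mapping.single 0 c"

definition mono_eval :: "'k::comm_ring_1 ^ 'v \<Rightarrow> ('v::finite \<Rightarrow>\<^sub>0 nat) \<Rightarrow> 'k" where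
  "mono_eval x a = (\<Prod>i\<in>UNIV. (x $ i) ^ Poly_Mapping.lookup a i)"

definition meval :: "'k::comm_ring_1 ^ 'v \<Rightarrow> ('v::finite, 'k) mpoly \<Rightarrow> 'k" where
  "meval x p = (\<Sum>a\<in>Poly_Mapping.keys p. Poly_Mapping.lookup p a * mono_eval x a)"

text \<open>The formal partial derivative. Where the subtraction of exponents truncates, the
  coefficient is \<open>0\<close>.\<close>

definition pdiff :: "'v \<Rightarrow> ('v, 'k::comm_ring_1) mpoly \<Rightarrow> ('v, 'k) mpoly" where
  "pdiff i p = (\<Sum>a\<in>Poly_Mapping.keys p.
     Poly_Mapping.single (a - Poly_Mapping.single i 1)
       (of_nat (Poly_Mapping.lookup a i) * Poly_Mapping.lookup p a))"


section \<open>Zariski topology, dimension and codimension\<close>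

definition zero_locus :: "('v::finite, 'k::comm_ring_1) mpoly set \<Rightarrow> ('k ^ 'v) set" where
  "zero_locus S = {x. \<forall>p\<in>S. meval x p = 0}"

definition zariski_closed :: "('k::comm_ring_1 ^ 'v::finite) set \<Rightarrow> bool" where
  "zariski_closed Z \<longleftrightarrow> (\<exists>S. Z = zero_locus S)"

definition zariski_open :: "('k::comm_ring_1 ^ 'v::finite) set \<Rightarrow> bool" where
  "zariski_open U \<longleftrightarrow> zariski_closed (- U)"

definition irreducible_closed :: "('k::comm_ring_1 ^ 'v::finite) set \<Rightarrow> bool" where
  "irreducible_closed Z \<longleftrightarrow> zariski_closed Z \<and> Z \<noteq> {} \<and>
     (\<forall>A B. zariski_closed A \<longrightarrow> zariski_closed B \<longrightarrow> Z = A \<union> B \<longrightarrow> Z = A \<or> Z = B)"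

text \<open>The Krull dimension of a Zariski closed set: the supremum of the lengths \<open>d\<close> of the
  chains \<open>Z\<^sub>0 \<subset> \<dots> \<subset> Z\<^sub>d\<close> of irreducible closed subsets. The empty set has
  dimension \<open>-\<infinity>\<close>, hence codimension \<open>\<infinity>\<close>.\<close>

definition zariski_dim :: "('k::comm_ring_1 ^ 'v::finite) set \<Rightarrow> ereal" where
  "zariski_dim X = Sup {ereal (real d) | d. \<exists>Z :: nat \<Rightarrow> ('k ^ 'v) set.
     (\<forall>i\<le>d. irreducible_closed (Z i) \<and> Z i \<subseteq> X) \<and> (\<forall>i<d. Z i \<subset> Z (Suc i))}"

definition codim :: "('k::comm_ring_1 ^ 'v::finite) set \<Rightarrow> ereal" where
  "codim X = ereal (real CARD('v)) - zariski_dim X"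


section \<open>Singular loci\<close>

definition Sing :: "('n::finite, 'k::comm_ring_1) mpoly \<Rightarrow> ('k ^ 'n) set" where
  "Sing f = zero_locus (insert f (range (\<lambda>i. pdiff i f)))"

text \<open>The points of \<open>\<^bold>P\<^sup>n\<^sup>-\<^sup>1\<close> are the lines through the origin of \<open>k\<^sup>n\<close>.\<close>

definition proj_space :: "('k::field ^ 'n::finite) set set" where
  "proj_space = {vec.span {x} | x. x \<noteq> 0}"

text \<open>The set of singular points of the projective hypersurface \<open>V(f)\<close> of a homogeneous
  polynomial \<open>f\<close>, by the Jacobian criterion: \<open>f\<close> and all its partial derivatives
  vanish at the homogeneous coordinates of the point.\<close>

definition proj_Sing :: "('n::finite, 'k::field) mpoly \<Rightarrow> ('k ^ 'n) set set" where
  "proj_Sing f = {P \<in> proj_space. \<forall>x\<in>P - {0}. meval x f = 0 \<and> (\<forall>i. meval x (pdiff i f) = 0)}"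

definition proj_nonsingular :: "('n::finite, 'k::field) mpoly \<Rightarrow> bool" where
  "proj_nonsingular f \<longleftrightarrow> proj_Sing f = {}"


section \<open>Linear maps into a space of matrices\<close>

definition matrix_scale :: "'k::field \<Rightarrow> 'k ^ 'm ^ 'm \<Rightarrow> 'k ^ 'm ^ 'm" where
  "matrix_scale c A = (\<chi> i j. c * A $ i $ j)"

lemma vector_space_matrix_scale: "vector_space matrix_scale"
  by unfold_locales (auto simp: matrix_scale_def vec_eq_iff algebra_simps)

definition linear_maps :: "('k::field ^ 'n::finite \<Rightarrow> 'k ^ 'm::finite ^ 'm) set" where
  "linear_maps = {L. Vector_Spaces.linear (*s) matrix_scale L}"

text \<open>\<open>det_poly L\<close> is the polynomial \<open>f(x) = det (L(x))\<close>, the determinant of the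
  matrix of linear forms that represents \<open>L\<close>; see \<open>meval_det_poly\<close> below.\<close>

definition det_poly ::
  "('k::field ^ 'n::finite \<Rightarrow> 'k ^ 'm::finite ^ 'm) \<Rightarrow> ('n, 'k) mpoly" where
  "det_poly L = det (\<chi> i j. \<Sum>l\<in>UNIV. mconst (L (axis l 1) $ i $ j) * mvar l)"

text \<open>The space of linear maps is an affine space via the matrix entries of the images of
  the standard basis vectors.\<close>

definition map_coords :: "('k::field ^ 'n::finite \<Rightarrow> 'k ^ 'm::finite ^ 'm) \<Rightarrow> 'k ^ ('m \<times> 'm \<times> 'n)"
  where "map_coords L = (\<chi> t. case t of (i, j, l) \<Rightarrow> L (axis l 1) $ i $ j)"

definition for_general_linear_map ::
  "(('k::field ^ 'n::finite \<Rightarrow> 'k ^ 'm::finite ^ 'm) \<Rightarrow> bool) \<Rightarrow> bool" where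
  "for_general_linear_map P \<longleftrightarrow> (\<exists>U \<subseteq> linear_maps.
     U \<noteq> {} \<and> zariski_open (map_coords ` U) \<and> (\<forall>L\<in>U. P L))"


section \<open>The polynomial \<open>det_poly L\<close> takes the values \<open>det (L x)\<close>\<close>

lemma meval_superset:
  assumes "finite A" "Poly_Mapping.keys p \<subseteq> A"
  shows "meval x p = (\<Sum>a\<in>A. Poly_Mapping.lookup p a * mono_eval x a)"
  unfolding meval_def
  by (rule sum.mono_neutral_left) (use assms in \<open>auto simp: in_keys_iff\<close>)

lemma meval_0 [simp]: "meval x 0 = 0"
  by (simp add: meval_def)

lemma meval_single [simp]: "meval x (Poly_Mapping.single a c) = c * mono_eval x a"
  by (subst meval_superset[of "{a}"]) auto

lemma mono_eval_0 [simp]: "mono_eval x 0 = 1"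
  by (simp add: mono_eval_def)

lemma mono_eval_add: "mono_eval x (a + b) = mono_eval x a * mono_eval x b"
  by (simp add: mono_eval_def lookup_add power_add prod.distrib)

lemma meval_1 [simp]: "meval x 1 = 1"
  using meval_single[of x 0 1] by simp

lemma meval_mconst [simp]: "meval x (mconst c) = c"
  by (simp add: mconst_def)

lemma mono_eval_single: "mono_eval x (Poly_Mapping.single i 1) = x $ i"
proof -
  have "mono_eval x (Poly_Mapping.single i 1) = (\<Prod>j\<in>UNIV. if j = i then x $ j else 1)"
    unfolding mono_eval_def by (rule prod.cong) (auto simp: lookup_single when_def)
  then show ?thesis
    by simp
qed

lemma meval_mvar [simp]: "meval x (mvar i) = x $ i"
  by (simp add: mvar_def mono_eval_single del: One_nat_def)

lemma meval_add: "meval x (p + q) = meval x p + meval x q"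
proof -
  let ?A = "Poly_Mapping.keys p \<union> Poly_Mapping.keys q"
  have "Poly_Mapping.keys (p + q) \<subseteq> ?A"
    by (rule Poly_Mapping.keys_add)
  then show ?thesis
    by (simp add: meval_superset[of ?A] lookup_add distrib_right sum.distrib)
qed

lemma meval_sum: "meval x (\<Sum>i\<in>A. f i) = (\<Sum>i\<in>A. meval x (f i))"
  by (induction A rule: infinite_finite_induct) (auto simp: meval_add)

lemma poly_mapping_sum_single:
  "p = (\<Sum>a\<in>Poly_Mapping.keys p. Poly_Mapping.single a (Poly_Mapping.lookup p a))"
proof (rule poly_mapping_eqI)
  fix b
  show "Poly_Mapping.lookup p b = Poly_Mapping.lookup
    (\<Sum>a\<in>Poly_Mapping.keys p. Poly_Mapping.single a (Poly_Mapping.lookup p a)) b"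
    by (auto simp: lookup_sum lookup_single when_def in_keys_iff)
qed

lemma meval_mult: "meval x (p * q) = meval x p * meval x q"
proof -
  have "p * q = (\<Sum>a\<in>Poly_Mapping.keys p. \<Sum>b\<in>Poly_Mapping.keys q.
      Poly_Mapping.single (a + b) (Poly_Mapping.lookup p a * Poly_Mapping.lookup q b))"
    by (subst poly_mapping_sum_single[of p], subst poly_mapping_sum_single[of q])
      (simp add: sum_product mult_single)
  then have "meval x (p * q) = (\<Sum>a\<in>Poly_Mapping.keys p. \<Sum>b\<in>Poly_Mapping.keys q.
      (Poly_Mapping.lookup p a * Poly_Mapping.lookup q b) * mono_eval x (a + b))"
    by (simp add: meval_sum)
  also have "\<dots> = meval x p * meval x q"
    by (simp add: meval_def sum_product mono_eval_add mult_ac)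
  finally show ?thesis .
qed

lemma meval_prod: "meval x (\<Prod>i\<in>A. f i) = (\<Prod>i\<in>A. meval x (f i))"
  by (induction A rule: infinite_finite_induct) (auto simp: meval_mult)

lemma meval_of_int: "meval x (of_int c) = of_int c"
proof -
  have nat: "meval x (of_nat n) = of_nat n" for n
    by (induction n) (auto simp: meval_add)
  have "meval x (- p) = - meval x p" for p
    using meval_add[of x p "- p"] by (simp add: eq_neg_iff_add_eq_0 add.commute)
  then show ?thesis
    by (cases c rule: int_cases2) (auto simp: nat)
qed

lemma meval_det: "meval x (det A) = det (\<chi> i j. meval x (A $ i $ j))"
  by (simp add: det_def meval_sum meval_mult meval_prod meval_of_int)

lemma linear_maps_apply:
  assumes "L \<in> linear_maps"
  shows "L x $ i $ j = (\<Sum>l\<in>UNIV. L (axis l 1) $ i $ j * x $ l)"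
proof -
  interpret Vector_Spaces.linear "(*s)" matrix_scale L
    using assms by (simp add: linear_maps_def)
  have "L x = L (\<Sum>l\<in>UNIV. x $ l *s axis l 1)"
    by (simp add: basis_expansion)
  also have "\<dots> = (\<Sum>l\<in>UNIV. matrix_scale (x $ l) (L (axis l 1)))"
    by (simp add: sum scale)
  finally show ?thesis
    by (simp add: matrix_scale_def mult.commute)
qed

lemma meval_det_poly:
  assumes "L \<in> linear_maps"
  shows "meval x (det_poly L) = det (L x)"
proof -
  have "meval x (det_poly L) = det (\<chi> i j. L x $ i $ j)"
    by (simp add: det_poly_def meval_det meval_sum meval_mult linear_maps_apply[OF assms, of x])
  then show ?thesis
    by simp
qed

end

(* For the bound on the codimension, let D be the singular locus of the generic determinant in the
   space of m x m matrices. It contains every matrix with two rows in the span of the other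
   rows, so m^2 - 4 of the matrix entries are algebraically independent on D. If a linear space of
   dimension w meets a closed cone only in 0, then the Nullstellensatz makes the coordinate ring
   of the cone finite over the ring generated by the linear forms that cut out the space, and
   counting monomials bounds the number of independent functions by the number of these forms.
   Hence w <= 4 for a space that meets D only in 0, so every linear space that meets Sing f, which
   contains the preimage of D, only in 0 has dimension at most 4. Choosing such a space as
   large as possible gives n - 4 linear forms that are independent on Sing f, and slicing turns
   independent functions into chains of irreducible closed sets.

   For equality at a general L, choose min 4 n of the variables. At a suitable L the polynomial f
   is a sum of nonzero multiples of the m-th powers of these variables, so modulo the other
   variables its partial derivatives generate all monomials of some degree N. This is the
   invertibility of a square matrix whose entries are polynomials in L, an open condition. So
   for general L the coordinate ring of Sing f is finite over n - min 4 n variables. *)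

theory Submission
  imports Defs
begin

section \<open>Prime ideals and extension of homomorphisms\<close>

text \<open>Independence modulo an ideal, \<open>alg_indep\<close>, stands between chains and
  counting: a chain of irreducible closed sets yields as many independent functions as it has steps,
  so an upper bound on their number bounds \<open>zariski_dim\<close>. The slicing step needs points
  of an irreducible closed set at which independent functions take prescribed values. Both these
  points and the Nullstellensatz come from one extension theorem for homomorphisms into the field,
  which keeps a chosen element away from 0. The counting needs control of degrees: relations for
  \<open>x $ i ^ N\<close> whose cofactors have degree below \<open>N\<close> let the degree drop
  whenever a linear form is split off. On a cone they arise by comparing homogeneous parts. The
  number 4 has two sources. Two rows that depend on the others determine a 2 by 2 block of entries.
  And a binary form \<open>x ^ m - y ^ m\<close> is a product of \<open>m\<close> linear forms, so
  two such forms, one along the diagonal and one along a cycle, put four variables into one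
  determinant.\<close>

definition ring_ideal :: "'r::comm_ring_1 set \<Rightarrow> bool" where
  "ring_ideal P \<longleftrightarrow> 0 \<in> P \<and> (\<forall>a\<in>P. \<forall>b\<in>P. a + b \<in> P) \<and> (\<forall>a\<in>P. \<forall>r. r * a \<in> P)"

definition prime_ring_ideal :: "'r::comm_ring_1 set \<Rightarrow> bool" where
  "prime_ring_ideal P \<longleftrightarrow> ring_ideal P \<and> 1 \<notin> P \<and> (\<forall>a b. a * b \<in> P \<longrightarrow> a \<in> P \<or> b \<in> P)"

definition is_subring :: "'r::comm_ring_1 set \<Rightarrow> bool" where
  "is_subring A \<longleftrightarrow> 0 \<in> A \<and> 1 \<in> A \<and> (\<forall>a\<in>A. \<forall>b\<in>A. a + b \<in> A) \<and>
     (\<forall>a\<in>A. \<forall>b\<in>A. a * b \<in> A) \<and> (\<forall>a\<in>A. - a \<in> A)"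

text \<open>A ring homomorphism to \<open>'k\<close> from the image of the subring \<open>A\<close>
  in the quotient by \<open>P\<close>, without forming the quotient. Values outside \<open>A\<close>
  are arbitrary.\<close>

definition hom_mod :: "'r::comm_ring_1 set \<Rightarrow> 'r set \<Rightarrow> ('r \<Rightarrow> 'k::comm_ring_1) \<Rightarrow> bool" where
  "hom_mod P A f \<longleftrightarrow> f 1 = 1 \<and> (\<forall>a\<in>A. \<forall>b\<in>A. f (a + b) = f a + f b) \<and>
     (\<forall>a\<in>A. \<forall>b\<in>A. f (a * b) = f a * f b) \<and> (\<forall>a\<in>A \<inter> P. f a = 0)"

definition polys_over :: "'r::comm_ring_1 set \<Rightarrow> 'r poly set" where
  "polys_over A = {p. \<forall>i. coeff p i \<in> A}"

definition adjoin :: "'r::comm_ring_1 set \<Rightarrow> 'r \<Rightarrow> 'r set" where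
  "adjoin A x = (\<lambda>p. poly p x) ` polys_over A"

lemma ring_ideal_0: "ring_ideal P \<Longrightarrow> 0 \<in> P"
  and ring_ideal_add: "ring_ideal P \<Longrightarrow> a \<in> P \<Longrightarrow> b \<in> P \<Longrightarrow> a + b \<in> P"
  and ring_ideal_mult: "ring_ideal P \<Longrightarrow> a \<in> P \<Longrightarrow> r * a \<in> P"
  by (auto simp: ring_ideal_def)

lemma ring_ideal_mult_right: "ring_ideal P \<Longrightarrow> a \<in> P \<Longrightarrow> a * r \<in> P"
  by (metis mult.commute ring_ideal_mult)

lemma ring_ideal_uminus: "ring_ideal P \<Longrightarrow> a \<in> P \<Longrightarrow> - a \<in> P"
  using ring_ideal_mult[of P a "-1"] by simp

lemma ring_ideal_diff: "ring_ideal P \<Longrightarrow> a \<in> P \<Longrightarrow> b \<in> P \<Longrightarrow> a - b \<in> P"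
  using ring_ideal_add[of P a "-b"] ring_ideal_uminus[of P b] by simp

lemma ring_ideal_sum:
  "ring_ideal P \<Longrightarrow> (\<And>i. i \<in> S \<Longrightarrow> f i \<in> P) \<Longrightarrow> sum f S \<in> P"
  by (induction S rule: infinite_finite_induct) (auto intro: ring_ideal_0 ring_ideal_add)

lemma prime_ring_idealD:
  assumes "prime_ring_ideal P"
  shows "ring_ideal P" "1 \<notin> P" "a * b \<in> P \<Longrightarrow> a \<in> P \<or> b \<in> P"
  using assms by (auto simp: prime_ring_ideal_def)

lemma prime_ring_ideal_power: "prime_ring_ideal P \<Longrightarrow> a \<notin> P \<Longrightarrow> a ^ k \<notin> P"
  by (induction k) (auto dest: prime_ring_idealD)

lemma is_subringD:
  assumes "is_subring A"
  shows "0 \<in> A" "1 \<in> A" "a \<in> A \<Longrightarrow> b \<in> A \<Longrightarrow> a + b \<in> A" "a \<in> A \<Longrightarrow> b \<in> A \<Longrightarrow> a * b \<in> A"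
    "a \<in> A \<Longrightarrow> - a \<in> A"
  using assms by (auto simp: is_subring_def)

lemma is_subring_diff: "is_subring A \<Longrightarrow> a \<in> A \<Longrightarrow> b \<in> A \<Longrightarrow> a - b \<in> A"
  using is_subringD(3)[of A a "-b"] is_subringD(5)[of A b] by simp

lemma is_subring_sum: "is_subring A \<Longrightarrow> (\<And>i. i \<in> S \<Longrightarrow> f i \<in> A) \<Longrightarrow> sum f S \<in> A"
  by (induction S rule: infinite_finite_induct) (auto intro: is_subringD)

lemma is_subring_power: "is_subring A \<Longrightarrow> a \<in> A \<Longrightarrow> a ^ k \<in> A"
  by (induction k) (auto intro: is_subringD)

section \<open>Polynomials with coefficients in a subring\<close>

lemma polys_over_coeff: "p \<in> polys_over A \<Longrightarrow> coeff p i \<in> A"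
  by (simp add: polys_over_def)

lemma polys_over_subring:
  assumes "is_subring A"
  shows "is_subring (polys_over A)"
  unfolding is_subring_def polys_over_def
  using assms
  by (auto simp: coeff_mult coeff_1 intro!: is_subring_sum is_subringD)

lemma polys_over_monom:
  assumes "is_subring A" "c \<in> A"
  shows "monom c n \<in> polys_over A"
  using assms by (auto simp: polys_over_def is_subringD)

lemma polys_over_smult:
  assumes "is_subring A" "c \<in> A" "p \<in> polys_over A"
  shows "smult c p \<in> polys_over A"
  using assms by (auto simp: polys_over_def is_subringD)

lemma adjoin_subring:
  assumes "is_subring A"
  shows "is_subring (adjoin A x)"
proof -
  note R = polys_over_subring[OF assms]
  have "poly 0 x \<in> adjoin A x" "poly 1 x \<in> adjoin A x"
    unfolding adjoin_def using is_subringD(1,2)[OF R] by blast+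
  moreover have "poly p x + poly q x \<in> adjoin A x" "poly p x * poly q x \<in> adjoin A x"
      "- poly p x \<in> adjoin A x"
    if "p \<in> polys_over A" "q \<in> polys_over A" for p q
    unfolding adjoin_def poly_add[symmetric] poly_mult[symmetric] poly_minus[symmetric]
    using is_subringD(3-5)[OF R] that by blast+
  ultimately show ?thesis
    unfolding is_subring_def by (auto simp: adjoin_def)
qed

lemma adjoin_mono:
  assumes "is_subring A"
  shows "A \<subseteq> adjoin A x"
proof
  fix a assume "a \<in> A"
  then have "monom a 0 \<in> polys_over A"
    using polys_over_monom[OF assms] by blast
  then show "a \<in> adjoin A x"
    unfolding adjoin_def by (force simp: poly_monom image_iff)
qed

lemma adjoin_mem:
  assumes "is_subring A"
  shows "x \<in> adjoin A x"
proof -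
  have "monom 1 1 \<in> polys_over A"
    using polys_over_monom[OF assms] is_subringD[OF assms] by blast
  then show ?thesis
    unfolding adjoin_def by (force simp: poly_monom image_iff)
qed

text \<open>\<open>lead_coeff H\<close> need not be a unit, so \<open>p\<close> is multiplied by it
  before each cancellation of a leading term. The bound on \<open>degree Q\<close> later pushes a
  quotient of \<open>F\<close> below the minimal degree.\<close>

lemma pseudo_division_over:
  assumes A: "is_subring A" and H: "H \<in> polys_over A" "degree H > 0" and p: "p \<in> polys_over A"
  shows "\<exists>k Q R. Q \<in> polys_over A \<and> R \<in> polys_over A \<and>
    smult (lead_coeff H ^ k) p = Q * H + R \<and> degree R < degree H \<and>
    (Q = 0 \<or> degree Q + degree H \<le> degree p)"
  using p
proof (induction "degree p" arbitrary: p rule: less_induct)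
  case less
  note R = polys_over_subring[OF A]
  show ?case
  proof (cases "degree p < degree H")
    case True
    then show ?thesis
      using less.prems is_subringD(1)[OF R]
      by (intro exI[of _ 0] exI[of _ 0] exI[of _ p]) auto
  next
    case False
    define M where "M = monom (lead_coeff p) (degree p - degree H)"
    define p' where "p' = smult (lead_coeff H) p - M * H"
    have M: "M \<in> polys_over A"
      unfolding M_def using A less.prems polys_over_coeff by (blast intro: polys_over_monom)
    have p': "p' \<in> polys_over A"
      unfolding p'_def
      by (intro is_subring_diff[OF R] is_subringD[OF R] polys_over_smult[OF A] M H less.prems
        polys_over_coeff)
    have dM: "degree M + degree H \<le> degree p"
      unfolding M_def using False degree_monom_le[of "lead_coeff p" "degree p - degree H"]
      by linarith
    have "coeff p' (degree p) = 0"
      using False by (simp add: p'_def M_def coeff_monom_mult)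
    moreover have "degree p' \<le> degree p"
      unfolding p'_def
      by (intro degree_diff_le order.trans[OF degree_smult_le] order.trans[OF degree_mult_le] dM)
        simp
    ultimately have "degree p' < degree p"
      using False H(2) by (metis degree_0 leading_coeff_0_iff le_neq_implies_less not_less
          bot_nat_0.not_eq_extremum)
    from less.hyps[OF this p'] obtain k Q S where
      IH: "Q \<in> polys_over A" "S \<in> polys_over A" "smult (lead_coeff H ^ k) p' = Q * H + S"
        "degree S < degree H" "Q = 0 \<or> degree Q + degree H \<le> degree p'"
      by blast
    define Q' where "Q' = smult (lead_coeff H ^ k) M + Q"
    have "Q' \<in> polys_over A"
      unfolding Q'_def
      by (intro is_subringD[OF R] polys_over_smult[OF A] is_subring_power[OF A] M IH
        polys_over_coeff H)
    moreover have "smult (lead_coeff H ^ Suc k) p = Q' * H + S"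
      using IH(3) unfolding Q'_def p'_def
      by (simp add: smult_diff_right algebra_simps)
    moreover have "degree Q' + degree H \<le> degree p"
    proof -
      have "degree Q \<le> degree p - degree H"
        using IH(5) \<open>degree p' < degree p\<close> by auto
      moreover have "degree (smult (lead_coeff H ^ k) M) \<le> degree p - degree H"
        using dM degree_smult_le[of "lead_coeff H ^ k" M] by linarith
      ultimately have "degree Q' \<le> degree p - degree H"
        unfolding Q'_def by (rule degree_add_le[rotated])
      then show ?thesis
        using False by linarith
    qed
    ultimately show ?thesis
      using IH(2,4) by blast
  qed
qed

section \<open>Extending a homomorphism by one element\<close>

lemma hom_mod_sum:
  assumes "is_subring A" "hom_mod P A f" "0 \<in> P" "\<And>i. i \<in> S \<Longrightarrow> g i \<in> A"
  shows "f (sum g S) = (\<Sum>i\<in>S. f (g i))"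
  using assms(4)
proof (induction S rule: infinite_finite_induct)
  case (insert i S)
  then show ?case
    using assms(1,2) by (simp add: hom_mod_def is_subring_sum)
qed (use assms is_subringD[OF assms(1)] in \<open>auto simp: hom_mod_def\<close>)

context
  fixes P A :: "'r::comm_ring_1 set" and f :: "'r \<Rightarrow> 'k::comm_ring_1"
  assumes A: "is_subring A" and f: "hom_mod P A f" and P: "ring_ideal P"
begin

lemma hom_mod_zero: "f 0 = 0"
  using f is_subringD(1)[OF A] ring_ideal_0[OF P] by (simp add: hom_mod_def)

lemma hom_mod_map_poly_add:
  assumes "p \<in> polys_over A" "q \<in> polys_over A"
  shows "map_poly f (p + q) = map_poly f p + map_poly f q"
  using assms f by (intro poly_eqI) (simp add: coeff_map_poly hom_mod_zero hom_mod_def polys_over_def)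

lemma hom_mod_map_poly_mult:
  assumes "p \<in> polys_over A" "q \<in> polys_over A"
  shows "map_poly f (p * q) = map_poly f p * map_poly f q"
proof (intro poly_eqI)
  fix n
  have "f (\<Sum>i\<le>n. coeff p i * coeff q (n - i)) = (\<Sum>i\<le>n. f (coeff p i * coeff q (n - i)))"
    using assms is_subringD(4)[OF A]
    by (intro hom_mod_sum[OF A f ring_ideal_0[OF P]]) (auto simp: polys_over_def)
  then show "coeff (map_poly f (p * q)) n = coeff (map_poly f p * map_poly f q) n"
    using assms f by (simp add: coeff_map_poly hom_mod_zero coeff_mult hom_mod_def polys_over_def)
qed

lemma hom_mod_map_poly_1: "map_poly f 1 = 1"
  using f by (intro poly_eqI) (simp add: coeff_map_poly hom_mod_zero coeff_1 hom_mod_def)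

lemma hom_mod_map_poly_eq_0:
  assumes "p \<in> polys_over A" "p \<in> polys_over P"
  shows "map_poly f p = 0"
  using assms f by (intro poly_eqI) (simp add: coeff_map_poly hom_mod_zero hom_mod_def polys_over_def)

text \<open>Two representations \<open>poly p x\<close> of an element differ by a polynomial whose
  value at \<open>x\<close> is 0, hence in \<open>P\<close>. So the hypothesis on \<open>t\<close>
  makes the extension well defined, and it also makes it vanish on \<open>P\<close>.\<close>

lemma hom_mod_extend:
  assumes t: "\<And>p. p \<in> polys_over A \<Longrightarrow> poly p x \<in> P \<Longrightarrow> poly (map_poly f p) t = 0"
  shows "\<exists>f'. hom_mod P (adjoin A x) f' \<and> (\<forall>a\<in>A. f' a = f a) \<and>
    (\<forall>p\<in>polys_over A. f' (poly p x) = poly (map_poly f p) t)"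
proof -
  note R = polys_over_subring[OF A]
  define f' where "f' r = poly (map_poly f (SOME p. p \<in> polys_over A \<and> poly p x = r)) t" for r
  have f': "f' (poly p x) = poly (map_poly f p) t" if p: "p \<in> polys_over A" for p
  proof -
    define q where "q = (SOME q. q \<in> polys_over A \<and> poly q x = poly p x)"
    have q: "q \<in> polys_over A \<and> poly q x = poly p x"
      unfolding q_def by (rule someI[of _ p]) (use p in simp)
    have d: "q - p \<in> polys_over A"
      using q p by (intro is_subring_diff[OF R]) auto
    have "poly (map_poly f (q - p)) t = 0"
      using q d ring_ideal_0[OF P] by (intro t) auto
    moreover have "map_poly f q = map_poly f (q - p) + map_poly f p"
      using hom_mod_map_poly_add[OF d p] by simp
    ultimately show ?thesis
      unfolding f'_def q_def[symmetric] by simp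
  qed
  have "f' a = f a" if a: "a \<in> A" for a
  proof -
    have "map_poly f (monom a 0) = monom (f a) 0"
      by (simp add: map_poly_monom hom_mod_zero)
    then show ?thesis
      using f'[OF polys_over_monom[OF A a, of 0]] by (simp add: poly_monom)
  qed
  moreover have "hom_mod P (adjoin A x) f'"
    unfolding hom_mod_def adjoin_def
  proof (intro conjI ballI; (elim imageE IntE)?; hypsubst?)
    show "f' 1 = 1"
      using f'[OF is_subringD(2)[OF R]] hom_mod_map_poly_1 by simp
  next
    fix p q assume "p \<in> polys_over A" "q \<in> polys_over A"
    then show "f' (poly p x + poly q x) = f' (poly p x) + f' (poly q x)"
      using f'[OF is_subringD(3)[OF R]] by (simp add: f' hom_mod_map_poly_add)
  next
    fix p q assume "p \<in> polys_over A" "q \<in> polys_over A"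
    then show "f' (poly p x * poly q x) = f' (poly p x) * f' (poly q x)"
      using f'[OF is_subringD(4)[OF R]] by (simp add: f' hom_mod_map_poly_mult)
  next
    fix p assume "p \<in> polys_over A" "poly p x \<in> P"
    then show "f' (poly p x) = 0"
      by (simp add: f' t)
  qed
  ultimately show ?thesis
    using f' by blast
qed

end

lemma polys_over_leading_not_mem:
  assumes A: "is_subring A" and P: "ring_ideal P" and p: "p \<in> polys_over A" "p \<notin> polys_over P"
    and lc: "lead_coeff p \<in> P"
  defines "q \<equiv> p - monom (lead_coeff p) (degree p)"
  shows "q \<in> polys_over A" "q \<notin> polys_over P" "degree q < degree p" "poly p x - poly q x \<in> P"
proof -
  have p_eq: "p = q + monom (lead_coeff p) (degree p)"
    by (simp add: q_def)
  show "q \<in> polys_over A"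
    unfolding q_def
    by (intro is_subring_diff[OF polys_over_subring[OF A]] polys_over_monom[OF A]
      polys_over_coeff[OF p(1)] p(1))
  show qP: "q \<notin> polys_over P"
  proof
    assume q: "q \<in> polys_over P"
    have "coeff p i \<in> P" for i
      using ring_ideal_add[OF P, of "coeff q i" "coeff (monom (lead_coeff p) (degree p)) i"] lc
        ring_ideal_0[OF P] polys_over_coeff[OF q, of i]
      by (subst p_eq) (auto simp: coeff_monom split: if_splits)
    then show False
      using p(2) by (simp add: polys_over_def)
  qed
  have "degree q \<le> degree p"
    unfolding q_def by (intro degree_diff_le degree_monom_le) simp
  moreover have "degree q \<noteq> degree p"
  proof
    assume eq: "degree q = degree p"
    have "coeff q (degree p) = 0"
      by (simp add: q_def)
    then have "q = 0"
      using eq by (metis leading_coeff_0_iff)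
    then show False
      using qP ring_ideal_0[OF P] by (simp add: polys_over_def)
  qed
  ultimately show "degree q < degree p"
    by linarith
  show "poly p x - poly q x \<in> P"
    unfolding q_def by (simp add: poly_monom ring_ideal_mult_right[OF P lc])
qed

lemma poly_in_ideal:
  assumes "ring_ideal P" "p \<in> polys_over P"
  shows "poly p x \<in> P"
  unfolding poly_altdef
  by (intro ring_ideal_sum[OF assms(1)] ring_ideal_mult_right[OF assms(1)] polys_over_coeff[OF assms(2)])

text \<open>Let \<open>F\<close> have minimal degree among the polynomials over \<open>A\<close> that vanish at \<open>x\<close> modulo
  \<open>P\<close> without being zero modulo \<open>P\<close>; if there is none, \<open>x\<close> is transcendental modulo \<open>P\<close> and
  \<open>t\<close> may be almost anything. Otherwise \<open>t\<close> must be a root of the image of \<open>F\<close>, and a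
  Bezout identity between \<open>F\<close> and \<open>G\<close> keeps it away from the roots of \<open>G\<close>.\<close>

lemma hom_mod_extend_point:
  fixes P A :: "'r::comm_ring_1 set"
  assumes A: "is_subring A" and P: "prime_ring_ideal P"
    and G: "G \<in> polys_over A" "poly G x \<notin> P"
  shows "\<exists>h\<in>A - P. \<forall>f :: 'r \<Rightarrow> 'k::{alg_closed_field, field_char_0}.
    hom_mod P A f \<longrightarrow> f h \<noteq> 0 \<longrightarrow>
    (\<exists>t. (\<forall>p\<in>polys_over A. poly p x \<in> P \<longrightarrow> poly (map_poly f p) t = 0) \<and>
      poly (map_poly f G) t \<noteq> 0)"
proof -
  note I = prime_ring_idealD(1)[OF P]
  note R = polys_over_subring[OF A]
  define J where "J = {p \<in> polys_over A. poly p x \<in> P}"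
  note add = hom_mod_map_poly_add[OF A _ I] and mult = hom_mod_map_poly_mult[OF A _ I]
    and zero = hom_mod_zero[OF A _ I]
  have smult: "map_poly f (smult c p) = smult (f c) (map_poly f p)"
    if "hom_mod P A f" "c \<in> A" "p \<in> polys_over A" for f :: "'r \<Rightarrow> 'k" and c p
    using that zero[OF that(1)] by (intro poly_eqI) (simp add: coeff_map_poly hom_mod_def polys_over_def)
  show ?thesis
  proof (cases "J \<subseteq> polys_over P")
    case True
    \<comment> \<open>Such a coefficient serves as \<open>h\<close>: if its image is nonzero, the
      image of \<open>G\<close> is nonzero and has a non-root.\<close>
    have "\<exists>i. coeff G i \<notin> P"
      using G(2) poly_in_ideal[OF I] by (auto simp: polys_over_def)
    then obtain i where i: "coeff G i \<notin> P" by blast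
    have "\<exists>t. (\<forall>p\<in>polys_over A. poly p x \<in> P \<longrightarrow> poly (map_poly f p) t = 0) \<and>
        poly (map_poly f G) t \<noteq> 0"
      if f: "hom_mod P A f" "f (coeff G i) \<noteq> 0" for f :: "'r \<Rightarrow> 'k"
    proof -
      have "coeff (map_poly f G) i \<noteq> 0"
        using f zero[OF f(1)] by (simp add: coeff_map_poly)
      then have "map_poly f G \<noteq> 0"
        by auto
      then obtain t where "poly (map_poly f G) t \<noteq> 0"
        using poly_all_0_iff_0 by blast
      moreover have "map_poly f p = 0" if "p \<in> polys_over A" "poly p x \<in> P" for p
        using True that by (intro hom_mod_map_poly_eq_0[OF A f(1) I]) (auto simp: J_def)
      ultimately show ?thesis
        by auto
    qed
    then show ?thesis
      using i polys_over_coeff[OF G(1)] by blast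
  next
    case False
    then obtain F where F: "F \<in> J - polys_over P"
      and min: "\<And>p. p \<in> J - polys_over P \<Longrightarrow> degree F \<le> degree p"
      using arg_min_natI[of "\<lambda>p. p \<in> J - polys_over P" _ degree]
        arg_min_nat_le[of "\<lambda>p. p \<in> J - polys_over P" _ degree] by (metis DiffI subsetI)
    have FA: "F \<in> polys_over A" and FP: "poly F x \<in> P"
      using F by (auto simp: J_def)
    define c where "c = lead_coeff F"
    have cA: "c \<in> A"
      unfolding c_def by (rule polys_over_coeff[OF FA])
    have c: "c \<notin> P"
    proof
      assume "c \<in> P"
      have "F \<notin> polys_over P"
        using F by blast
      note q = polys_over_leading_not_mem[OF A I FA this \<open>c \<in> P\<close>[unfolded c_def], folded c_def]
      let ?q = "F - monom c (degree F)"
      have "poly F x - (poly F x - poly ?q x) \<in> P"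
        by (rule ring_ideal_diff[OF I FP q(4)])
      then have "?q \<in> J - polys_over P"
        using q(1,2) by (auto simp: J_def)
      then show False
        using min q(3) by fastforce
    qed
    have degF: "degree F > 0"
    proof (rule ccontr)
      assume "\<not> degree F > 0"
      then have "F = [:c:]"
        unfolding c_def by (metis degree_0_id not_gr_zero of_nat_eq_0_iff degree_eq_zeroE lead_coeff_pCons(2) leading_coeff_0_iff pCons_eq_0_iff)
      then have "poly F x = c" by simp
      then show False
        using c FP by simp
    qed
    \<comment> \<open>Division by \<open>F\<close> leaves a remainder in \<open>J\<close> of smaller
      degree, which minimality makes zero modulo \<open>P\<close>. So up to a power of
      \<open>f c\<close> the image of \<open>p\<close> is a multiple of the image of
      \<open>F\<close>.\<close>
    have JF: "poly (map_poly f p) t = 0"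
      if f: "hom_mod P A f" "f c \<noteq> 0" and p: "p \<in> polys_over A" "poly p x \<in> P"
        and t: "poly (map_poly f F) t = 0" for f :: "'r \<Rightarrow> 'k" and p t
    proof -
      obtain k Q S where d: "Q \<in> polys_over A" "S \<in> polys_over A"
          "smult (c ^ k) p = Q * F + S" "degree S < degree F"
        using pseudo_division_over[OF A FA degF p(1)] unfolding c_def by blast
      have "poly S x = c ^ k * poly p x - poly Q x * poly F x"
        using arg_cong[OF d(3), of "\<lambda>p. poly p x"] by simp
      also have "\<dots> \<in> P"
        by (intro ring_ideal_diff[OF I] ring_ideal_mult[OF I] p FP)
      finally have "S \<in> J"
        using d by (simp add: J_def)
      then have "S \<in> polys_over P"
        using min d(4) by force
      then have S0: "map_poly f S = 0"
        using d by (intro hom_mod_map_poly_eq_0[OF A f(1) I])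
      have ck: "f (c ^ k) = f c ^ k" for k
        using f(1) cA is_subring_power[OF A cA] by (induction k) (auto simp: hom_mod_def)
      have "smult (f c ^ k) (map_poly f p) = map_poly f (smult (c ^ k) p)"
        using smult[OF f(1) is_subring_power[OF A cA] p(1)] by (simp add: ck)
      also have "\<dots> = map_poly f (Q * F) + map_poly f S"
        unfolding d(3) by (rule add[OF f(1) is_subringD(4)[OF R d(1) FA] d(2)])
      also have "\<dots> = map_poly f Q * map_poly f F"
        by (simp add: S0 mult[OF f(1) d(1) FA])
      finally have "smult (f c ^ k) (map_poly f p) = map_poly f Q * map_poly f F" .
      then have "f c ^ k * poly (map_poly f p) t = 0"
        using t by (metis mult_zero_right poly_mult poly_smult)
      then show ?thesis
        using f(2) by simp
    qed
    \<comment> \<open>The multiples of \<open>G\<close> modulo \<open>J\<close> that lie outside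
      \<open>J\<close>. An element of least degree will be a constant \<open>e\<close>, which gives
      the Bezout identity \<open>e = B * G\<close> modulo \<open>J\<close>.\<close>
    define M where "M = {p \<in> polys_over A - J. \<exists>B\<in>polys_over A. p - B * G \<in> J}"
    have Jdiff: "p - q \<in> J" if "p \<in> J" "q \<in> J" for p q
      using that is_subring_diff[OF R] ring_ideal_diff[OF I] by (auto simp: J_def)
    have Jadd: "p + q \<in> J" if "p \<in> J" "q \<in> J" for p q
      using that is_subringD(3)[OF R] ring_ideal_add[OF I] by (auto simp: J_def)
    have Jmult: "p * q \<in> J" if "p \<in> polys_over A" "q \<in> J" for p q
      using that is_subringD(4)[OF R] ring_ideal_mult[OF I] by (auto simp: J_def)
    have GM: "G \<in> M"
      unfolding M_def using G is_subringD(2)[OF R] is_subringD(1)[OF R] ring_ideal_0[OF I]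
      by (auto simp: J_def intro!: bexI[of _ 1])
    then obtain H where H: "H \<in> M" and minH: "\<And>p. p \<in> M \<Longrightarrow> degree H \<le> degree p"
      using arg_min_natI[of "\<lambda>p. p \<in> M" _ degree] arg_min_nat_le[of "\<lambda>p. p \<in> M" _ degree]
      by metis
    then obtain B where HA: "H \<in> polys_over A" "H \<notin> J" and B: "B \<in> polys_over A" "H - B * G \<in> J"
      unfolding M_def by blast
    have HP: "poly H x \<notin> P"
      using HA by (simp add: J_def)
    \<comment> \<open>If not, divide \<open>F\<close> by \<open>H\<close>. The remainder is in
      \<open>J\<close> by minimality of \<open>H\<close>, hence so is \<open>Q * H\<close>, and so
      is \<open>Q\<close> because \<open>poly H x\<close> is not in \<open>P\<close>. Both
      \<open>Q\<close> and the remainder have degree below that of \<open>F\<close>, so their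
      coefficients lie in \<open>P\<close>. Then \<open>lead_coeff H ^ k * c\<close> lies in the
      prime \<open>P\<close>, although neither factor does.\<close>
    have "degree H = 0"
    proof (rule ccontr)
      assume "degree H \<noteq> 0"
      then have H0: "degree H > 0" by simp
      have lcH: "lead_coeff H \<notin> P"
      proof
        assume l: "lead_coeff H \<in> P"
        let ?q = "H - monom (lead_coeff H) (degree H)"
        have "H \<notin> polys_over P"
          using HP poly_in_ideal[OF I] by blast
        note q = polys_over_leading_not_mem[OF A I HA(1) this l]
        have d: "H - ?q \<in> J"
          using q(4)[of x] is_subring_diff[OF R HA(1) q(1)] by (simp add: J_def)
        have "?q \<notin> J"
          using Jadd[OF d, of ?q] HA(2) by auto
        moreover have "?q - B * G \<in> J"
          using Jdiff[OF B(2) d] by (simp add: algebra_simps)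
        ultimately have "?q \<in> M"
          unfolding M_def using q(1) B by blast
        then show False
          using minH q(3) by force
      qed
      have less: "degree H < degree F"
      proof -
        obtain k Q S where d: "Q \<in> polys_over A" "S \<in> polys_over A"
          "smult (c ^ k) G = Q * F + S" "degree S < degree F"
          using pseudo_division_over[OF A FA degF G(1)] unfolding c_def by blast
        have QF: "Q * F \<in> J"
          using Jmult d FA FP by (auto simp: J_def)
        have "poly (smult (c ^ k) G) x \<notin> P"
          using prime_ring_idealD(3)[OF P] prime_ring_idealD(1)[OF P] G prime_ring_ideal_power[OF P c]
          by auto
        then have "S \<notin> J"
          using d(3) Jadd[OF QF, of S] by (auto simp: J_def)
        moreover have "S - [:c ^ k:] * G \<in> J"
          using Jdiff[OF _ QF, of 0] d(3) ring_ideal_0[OF I] is_subringD(1)[OF R]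
          by (simp add: J_def)
        moreover have "[:c ^ k:] \<in> polys_over A"
          using polys_over_monom[OF A is_subring_power[OF A cA], of k 0] by (simp add: monom_0)
        ultimately have "S \<in> M"
          unfolding M_def using d(2) by blast
        then show ?thesis
          using minH d(4) by force
      qed
      let ?e = "lead_coeff H"
      obtain k Q S where d: "Q \<in> polys_over A" "S \<in> polys_over A"
          "smult (?e ^ k) F = Q * H + S" "degree S < degree H" "Q = 0 \<or> degree Q + degree H \<le> degree F"
        using pseudo_division_over[OF A HA(1) H0 FA] by blast
      have eF: "smult (?e ^ k) F \<in> J"
        using polys_over_smult[OF A is_subring_power[OF A polys_over_coeff[OF HA(1)]] FA]
          ring_ideal_mult[OF I FP] by (simp add: J_def)
      have "S - (- Q * B) * G = Q * (B * G - H) + smult (?e ^ k) F"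
        using d(3) by (simp add: algebra_simps)
      also have "\<dots> \<in> J"
        using Jdiff[OF _ B(2), of 0] ring_ideal_0[OF I] is_subringD(1)[OF R]
        by (intro Jadd Jmult d eF) (simp add: J_def)
      finally have "S \<in> J"
        using minH[of S] d(2,4) is_subringD(4,5)[OF R] d(1) B(1) unfolding M_def
        by (metis (no_types, lifting) DiffI mem_Collect_eq not_le)
      then have QH: "Q * H \<in> J"
        using Jdiff[OF eF, of S] d(3) by simp
      then have QJ: "Q \<in> J"
        using HP prime_ring_idealD(3)[OF P] d(1) by (auto simp: J_def)
      have "degree Q < degree F"
        using d(5) H0 degF by auto
      then have QP: "Q \<in> polys_over P"
        using min QJ by force
      have SP: "S \<in> polys_over P"
        using min \<open>S \<in> J\<close> d(4) less by force
      have "coeff (Q * H + S) (degree F) \<in> P"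
        unfolding coeff_add coeff_mult
        by (intro ring_ideal_add[OF I] ring_ideal_sum[OF I] ring_ideal_mult_right[OF I]
          polys_over_coeff[OF QP] polys_over_coeff[OF SP])
      then have "?e ^ k * c \<in> P"
        using d(3) by (metis c_def coeff_smult)
      then show False
        using c prime_ring_ideal_power[OF P lcH] prime_ring_idealD(3)[OF P] by blast
    qed
    then obtain e where e: "H = [:e:]"
      by (metis degree_eq_zeroE)
    have eA: "e \<in> A" "e \<notin> P"
      using polys_over_coeff[OF HA(1), of 0] HP by (auto simp: e)
    show ?thesis
    \<comment> \<open>\<open>f c\<close> nonzero keeps the image of \<open>F\<close> nonconstant, so
      it has a root \<open>t\<close>; \<open>f e\<close> nonzero keeps the image of \<open>G\<close>
      from vanishing there, since the image of \<open>B * G\<close> takes the value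
      \<open>f e\<close> at \<open>t\<close>.\<close>
    proof (intro bexI[of _ "c * e"] allI impI)
      show "c * e \<in> A - P"
        using eA c cA is_subringD(4)[OF A] prime_ring_idealD(3)[OF P] by blast
      fix f :: "'r \<Rightarrow> 'k"
      assume f: "hom_mod P A f" "f (c * e) \<noteq> 0"
      then have fc: "f c \<noteq> 0" "f e \<noteq> 0"
        using eA(1) cA by (auto simp: hom_mod_def)
      have "coeff (map_poly f F) (degree F) \<noteq> 0"
        using fc zero[OF f(1)] by (simp add: coeff_map_poly c_def)
      then have "degree (map_poly f F) > 0"
        using degF le_degree by fastforce
      then obtain t where t: "poly (map_poly f F) t = 0"
        using alg_closed_imp_poly_has_root by blast
      have BG: "B * G \<in> polys_over A"
        by (intro is_subringD(4)[OF R] B G)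
      have "poly (map_poly f (H - B * G)) t = 0"
        using B(2) by (intro JF[OF f(1) fc(1) _ _ t]) (auto simp: J_def)
      moreover have "map_poly f H = map_poly f (H - B * G) + map_poly f (B * G)"
        using add[OF f(1) is_subring_diff[OF R HA(1) BG] BG] by simp
      ultimately have "poly (map_poly f (B * G)) t = poly (map_poly f H) t"
        by simp
      then have "poly (map_poly f (B * G)) t = f e"
        using zero[OF f(1)] by (simp add: e map_poly_pCons)
      then have "poly (map_poly f G) t \<noteq> 0"
        using fc by (auto simp: mult[OF f(1) B(1) G(1)])
      then show "\<exists>t. (\<forall>p\<in>polys_over A. poly p x \<in> P \<longrightarrow> poly (map_poly f p) t = 0) \<and>
          poly (map_poly f G) t \<noteq> 0"
        using JF[OF f(1) fc(1) _ _ t] by blast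
    qed
  qed
qed

section \<open>Extension to finitely generated rings, and primes avoiding a multiplicative
  set\<close>

fun adjoin_list :: "'r::comm_ring_1 set \<Rightarrow> 'r list \<Rightarrow> 'r set" where
  "adjoin_list A [] = A"
| "adjoin_list A (x # xs) = adjoin_list (adjoin A x) xs"

lemma adjoin_list_subring: "is_subring A \<Longrightarrow> is_subring (adjoin_list A xs)"
  by (induction xs arbitrary: A) (auto intro: adjoin_subring)

lemma adjoin_list_mono: "is_subring A \<Longrightarrow> A \<subseteq> adjoin_list A xs"
  by (induction xs arbitrary: A) (auto dest: adjoin_mono adjoin_subring)

lemma adjoin_list_mem: "is_subring A \<Longrightarrow> x \<in> set xs \<Longrightarrow> x \<in> adjoin_list A xs"
proof (induction xs arbitrary: A)
  case (Cons y xs)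
  then show ?case
    using adjoin_list_mono[OF adjoin_subring[OF Cons.prems(1), of y], of xs]
      adjoin_mem[OF Cons.prems(1), of y] adjoin_subring[OF Cons.prems(1), of y]
    by auto
qed auto

text \<open>The condition that \<open>g\<close> not be sent to 0 is pulled back one generator at a
  time: the element found for the larger ring is the one to be kept nonzero over the next smaller
  ring.\<close>

lemma hom_mod_extend_list:
  fixes P A :: "'r::comm_ring_1 set"
  assumes A: "is_subring A" and P: "prime_ring_ideal P" and g: "g \<in> adjoin_list A xs" "g \<notin> P"
  shows "\<exists>h\<in>A - P. \<forall>f :: 'r \<Rightarrow> 'k::{alg_closed_field, field_char_0}.
    hom_mod P A f \<longrightarrow> f h \<noteq> 0 \<longrightarrow>
    (\<exists>f'. hom_mod P (adjoin_list A xs) f' \<and> (\<forall>a\<in>A. f' a = f a) \<and> f' g \<noteq> 0)"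
  using A g
proof (induction xs arbitrary: A g)
  case Nil
  then show ?case
    by (intro bexI[of _ g]) auto
next
  case (Cons x xs)
  note A' = adjoin_subring[OF Cons.prems(1), of x]
  have "g \<in> adjoin_list (adjoin A x) xs"
    using Cons.prems by simp
  from Cons.IH[OF A' this Cons.prems(3)] obtain g' where g': "g' \<in> adjoin A x - P"
    and ext: "\<And>f :: 'r \<Rightarrow> 'k. hom_mod P (adjoin A x) f \<Longrightarrow> f g' \<noteq> 0 \<Longrightarrow>
      \<exists>f'. hom_mod P (adjoin_list (adjoin A x) xs) f' \<and> (\<forall>a\<in>adjoin A x. f' a = f a) \<and> f' g \<noteq> 0"
    by blast
  then obtain G where G: "G \<in> polys_over A" "g' = poly G x"
    unfolding adjoin_def by blast
  then have "poly G x \<notin> P"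
    using g' by simp
  from hom_mod_extend_point[OF Cons.prems(1) P G(1) this] obtain h where h: "h \<in> A - P"
    and pt: "\<And>f :: 'r \<Rightarrow> 'k. hom_mod P A f \<Longrightarrow> f h \<noteq> 0 \<Longrightarrow>
      \<exists>t. (\<forall>p\<in>polys_over A. poly p x \<in> P \<longrightarrow> poly (map_poly f p) t = 0) \<and>
        poly (map_poly f G) t \<noteq> 0"
    by blast
  show ?case
  proof (intro bexI[OF _ h] allI impI)
    fix f :: "'r \<Rightarrow> 'k"
    assume f: "hom_mod P A f" "f h \<noteq> 0"
    from pt[OF this] obtain t where
      t: "\<And>p. p \<in> polys_over A \<Longrightarrow> poly p x \<in> P \<Longrightarrow> poly (map_poly f p) t = 0"
        "poly (map_poly f G) t \<noteq> 0"
      by blast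
    from hom_mod_extend[OF Cons.prems(1) f(1) prime_ring_idealD(1)[OF P] t(1)] obtain f1 where
      f1: "hom_mod P (adjoin A x) f1" "\<And>a. a \<in> A \<Longrightarrow> f1 a = f a"
        "\<And>p. p \<in> polys_over A \<Longrightarrow> f1 (poly p x) = poly (map_poly f p) t"
      by blast
    have "f1 g' \<noteq> 0"
      using f1(3)[OF G(1)] t(2) G(2) by simp
    from ext[OF f1(1) this] show "\<exists>f'. hom_mod P (adjoin_list A (x # xs)) f' \<and>
        (\<forall>a\<in>A. f' a = f a) \<and> f' g \<noteq> 0"
      using f1(2) adjoin_mono[OF Cons.prems(1)] by (metis adjoin_list.simps(2) subsetD)
  qed
qed

text \<open>An ideal maximal among those containing \<open>I\<close> and missing \<open>S\<close> is
  prime: if \<open>a\<close> and \<open>b\<close> are outside it, enlarging it by \<open>a\<close>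
  and by \<open>b\<close> brings in elements \<open>s\<close> and \<open>t\<close> of
  \<open>S\<close>, and \<open>s * t\<close> would lie in the ideal if \<open>a * b\<close>
  did.\<close>

lemma exists_prime_avoiding:
  fixes I S :: "'r::comm_ring_1 set"
  assumes I: "ring_ideal I" and S: "1 \<in> S" "\<And>a b. a \<in> S \<Longrightarrow> b \<in> S \<Longrightarrow> a * b \<in> S"
    and disj: "I \<inter> S = {}"
  shows "\<exists>P. prime_ring_ideal P \<and> I \<subseteq> P \<and> P \<inter> S = {}"
proof -
  define F where "F = {P. ring_ideal P \<and> I \<subseteq> P \<and> P \<inter> S = {}}"
  have "F \<noteq> {}"
    using I disj by (auto simp: F_def)
  moreover have "\<Union>\<C> \<in> F" if C: "\<C> \<noteq> {}" "subset.chain F \<C>" for \<C>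
  proof -
    have sub: "\<C> \<subseteq> F" and lin: "\<And>X Y. X \<in> \<C> \<Longrightarrow> Y \<in> \<C> \<Longrightarrow> X \<subseteq> Y \<or> Y \<subseteq> X"
      using C(2) by (auto simp: subset_chain_def)
    have "ring_ideal (\<Union>\<C>)"
      unfolding ring_ideal_def
    proof (intro conjI ballI allI)
      show "0 \<in> \<Union>\<C>"
        using C(1) sub by (auto simp: F_def ring_ideal_def)
    next
      fix a b assume "a \<in> \<Union>\<C>" "b \<in> \<Union>\<C>"
      then obtain X Y where XY: "X \<in> \<C>" "Y \<in> \<C>" "a \<in> X" "b \<in> Y" by blast
      then obtain Z where "Z \<in> \<C>" "a \<in> Z" "b \<in> Z"
        using lin[OF XY(1,2)] by blast
      then show "a + b \<in> \<Union>\<C>"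
        using sub ring_ideal_add[of Z a b] by (auto simp: F_def)
    next
      fix a r assume "a \<in> \<Union>\<C>"
      then show "r * a \<in> \<Union>\<C>"
        using sub ring_ideal_mult[of _ a r] by (fastforce simp: F_def)
    qed
    then show ?thesis
      using sub C(1) by (auto simp: F_def)
  qed
  ultimately obtain P where "P \<in> F" and max: "\<And>X. X \<in> F \<Longrightarrow> P \<subseteq> X \<Longrightarrow> X = P"
    using subset_Zorn_nonempty[of F] by metis
  then have P: "ring_ideal P" "I \<subseteq> P" "P \<inter> S = {}"
    by (auto simp: F_def)
  define Q where "Q a = {p + r * a | p r. p \<in> P}" for a
  have Q: "Q a \<inter> S \<noteq> {}" if a: "a \<notin> P" for a
  proof -
    have "P \<subseteq> Q a"
    proof
      fix p assume "p \<in> P"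
      moreover have "p = p + 0 * a" by simp
      ultimately show "p \<in> Q a" unfolding Q_def by blast
    qed
    have "a \<in> Q a"
      unfolding Q_def using ring_ideal_0[OF P(1)] by (intro CollectI exI[of _ 0] exI[of _ 1]) simp
    have "ring_ideal (Q a)"
      unfolding ring_ideal_def
    proof (intro conjI ballI allI)
      show "0 \<in> Q a"
        using \<open>P \<subseteq> Q a\<close> ring_ideal_0[OF P(1)] by blast
    next
      fix x y assume "x \<in> Q a" "y \<in> Q a"
      then obtain p r p' r' where "x = p + r * a" "y = p' + r' * a" "p \<in> P" "p' \<in> P"
        unfolding Q_def by blast
      then have "x + y = (p + p') + (r + r') * a" "p + p' \<in> P"
        using ring_ideal_add[OF P(1)] by (auto simp: algebra_simps)
      then show "x + y \<in> Q a"
        unfolding Q_def by blast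
    next
      fix x s assume "x \<in> Q a"
      then obtain p r where "x = p + r * a" "p \<in> P"
        unfolding Q_def by blast
      then have "s * x = s * p + (s * r) * a" "s * p \<in> P"
        using ring_ideal_mult[OF P(1)] by (auto simp: algebra_simps)
      then show "s * x \<in> Q a"
        unfolding Q_def by blast
    qed
    then have "Q a \<in> F" if "Q a \<inter> S = {}"
      using that P(2) \<open>P \<subseteq> Q a\<close> unfolding F_def by blast
    then show ?thesis
      using max \<open>P \<subseteq> Q a\<close> \<open>a \<in> Q a\<close> a by blast
  qed
  have "a \<in> P \<or> b \<in> P" if ab: "a * b \<in> P" for a b
  proof (rule ccontr)
    assume "\<not> (a \<in> P \<or> b \<in> P)"
    then obtain s t where "s \<in> Q a" "s \<in> S" "t \<in> Q b" "t \<in> S"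
      using Q by blast
    then obtain p r p' r' where st: "s = p + r * a" "t = p' + r' * b" "p \<in> P" "p' \<in> P"
      unfolding Q_def by blast
    have "s * t = p * t + (r * a) * p' + r * r' * (a * b)"
      using st by (simp add: algebra_simps)
    also have "\<dots> \<in> P"
      by (intro ring_ideal_add[OF P(1)] ring_ideal_mult[OF P(1)] ring_ideal_mult_right[OF P(1) st(3)]
        st ab)
    finally show False
      using S(2)[OF \<open>s \<in> S\<close> \<open>t \<in> S\<close>] P(3) by blast
  qed
  moreover have "1 \<notin> P"
    using P(3) S(1) by blast
  ultimately show ?thesis
    using P unfolding prime_ring_ideal_def by blast
qed

section \<open>Polynomial functions and algebraic independence\<close>

lemma sum_PiE_insert:
  assumes "i \<notin> I"
  shows "(\<Sum>a\<in>PiE (insert i I) B. f a) = (\<Sum>j\<in>B i. \<Sum>a\<in>PiE I B. f (a(i := j)))"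
proof -
  have "(\<Sum>a\<in>PiE (insert i I) B. f a) = (\<Sum>(j, a)\<in>B i \<times> PiE I B. f (a(i := j)))"
    unfolding PiE_insert_eq
    by (subst sum.reindex[OF inj_combinator[OF assms]]) (simp add: case_prod_unfold comp_def)
  then show ?thesis
    by (simp add: sum.cartesian_product)
qed

text \<open>With the other variables fixed, the sum is a one-variable polynomial in
  \<open>b i\<close> that vanishes on an infinite field. Its coefficients are sums of the same kind
  in fewer variables.\<close>

lemma monomial_functions_independent:
  fixes c :: "('i \<Rightarrow> nat) \<Rightarrow> 'k::field_char_0"
  assumes "finite I" "a \<in> PiE I (\<lambda>_. {..T})"
    and "\<And>b :: 'i \<Rightarrow> 'k. (\<Sum>a\<in>PiE I (\<lambda>_. {..T}). c a * (\<Prod>i\<in>I. b i ^ a i)) = 0"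
  shows "c a = 0"
  using assms
proof (induction I arbitrary: c a rule: finite_induct)
  case empty
  then show ?case by simp
next
  case (insert i I)
  let ?S = "\<lambda>b j. \<Sum>a\<in>PiE I (\<lambda>_. {..T}). c (a(i := j)) * (\<Prod>i\<in>I. b i ^ a i)"
  have S: "?S b j = 0" if "j \<le> T" for b :: "'i \<Rightarrow> 'k" and j
  proof -
    define p where "p = (\<Sum>j\<le>T. monom (?S b j) j)"
    have "poly p t = 0" for t
    proof -
      let ?b = "b(i := t)"
      have b: "(\<Prod>l\<in>insert i I. ?b l ^ (a(i := j)) l) = t ^ j * (\<Prod>l\<in>I. b l ^ a l)" for a j
      proof -
        have "(\<Prod>l\<in>I. ?b l ^ (a(i := j)) l) = (\<Prod>l\<in>I. b l ^ a l)"
          using insert.hyps(2) by (intro prod.cong) auto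
        then show ?thesis
          using insert.hyps by simp
      qed
      have "poly p t = (\<Sum>j\<le>T. \<Sum>a\<in>PiE I (\<lambda>_. {..T}).
          c (a(i := j)) * (\<Prod>l\<in>insert i I. ?b l ^ (a(i := j)) l))"
        unfolding b by (simp add: p_def poly_sum poly_monom sum_distrib_left mult_ac)
      also have "\<dots> = 0"
        using insert.prems(2)[of ?b] sum_PiE_insert[OF insert.hyps(2), of "\<lambda>a. c a * (\<Prod>l\<in>insert i I. ?b l ^ a l)" "\<lambda>_. {..T}"]
        by simp
      finally show ?thesis .
    qed
    then have "p = 0"
      using poly_all_0_iff_0 by blast
    then have "coeff p j = 0" by simp
    then show ?thesis
      using that by (simp add: p_def coeff_sum sum.delta)
  qed
  obtain j a' where a: "j \<le> T" "a' \<in> PiE I (\<lambda>_. {..T})" "a = a'(i := j)"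
    using insert.prems(1) unfolding PiE_insert_eq by auto
  from insert.IH[OF a(2), of "\<lambda>a. c (a(i := j))", OF S[OF a(1)]] show ?case
    unfolding a(3) .
qed

lemma lookup_Abs_finite [simp]:
  "Poly_Mapping.lookup (Abs_poly_mapping (f :: 'v::finite \<Rightarrow> 'b::zero)) = f"
  by (simp add: Abs_poly_mapping_inverse)

lemma meval_eq_0_imp:
  fixes p :: "('v::finite, 'k::field_char_0) mpoly"
  assumes "\<And>x. meval x p = 0"
  shows "p = 0"
proof -
  \<comment> \<open>The sum of all exponents bounds each of them, so all monomials fit in the box
    \<open>?E\<close>.\<close>
  define T where "T = (\<Sum>a\<in>Poly_Mapping.keys p. \<Sum>i\<in>UNIV. Poly_Mapping.lookup a i)"
  let ?E = "PiE (UNIV :: 'v set) (\<lambda>_. {..T})"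
  have T: "Poly_Mapping.lookup a i \<le> T" if "a \<in> Poly_Mapping.keys p" for a i
    unfolding T_def
    by (intro order.trans[OF _ member_le_sum[OF that]] member_le_sum) auto
  have "a \<in> Abs_poly_mapping ` ?E" if "a \<in> Poly_Mapping.keys p" for a
    using T[OF that] by (intro image_eqI[of _ _ "Poly_Mapping.lookup a"]) auto
  moreover have "finite (Abs_poly_mapping ` ?E)"
    by (intro finite_imageI finite_PiE) auto
  moreover have "inj_on Abs_poly_mapping ?E"
    by (rule inj_onI) (metis lookup_Abs_finite)
  ultimately have "meval x p = (\<Sum>f\<in>?E. Poly_Mapping.lookup p (Abs_poly_mapping f) *
      (\<Prod>i\<in>UNIV. (x $ i) ^ f i))" for x
    by (subst meval_superset[of "Abs_poly_mapping ` ?E"])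
      (auto simp: sum.reindex comp_def mono_eval_def)
  from this[of "\<chi> i. b i" for b] have
    "(\<Sum>f\<in>?E. Poly_Mapping.lookup p (Abs_poly_mapping f) * (\<Prod>i\<in>UNIV. b i ^ f i)) = 0" for b
    using assms by (metis (no_types, lifting) prod.cong sum.cong vec_lambda_beta)
  note z = monomial_functions_independent[OF _ _ this]
  show "p = 0"
  proof (rule poly_mapping_eqI)
    fix a
    show "Poly_Mapping.lookup p a = Poly_Mapping.lookup 0 a"
    proof (cases "a \<in> Poly_Mapping.keys p")
      case True
      then have "Poly_Mapping.lookup a \<in> ?E"
        using T by auto
      from z[OF _ this] show ?thesis
        by simp
    qed (simp add: in_keys_iff)
  qed
qed

text \<open>From here on identities of formal polynomials can be checked by evaluation.\<close>

lemma meval_inject: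
  fixes p q :: "('v::finite, 'k::field_char_0) mpoly"
  assumes "\<And>x. meval x p = meval x q"
  shows "p = q"
proof -
  have "meval x (p - q) = 0" for x
    using meval_add[of x "p - q" q] assms by simp
  then show ?thesis
    using meval_eq_0_imp[of "p - q"] by simp
qed

lemma meval_uminus: "meval x (- p) = - meval x p"
  using meval_add[of x p "- p"] by (simp add: eq_neg_iff_add_eq_0 add.commute)

lemma meval_diff: "meval x (p - q) = meval x p - meval x q"
  using meval_add[of x p "- q"] by (simp add: meval_uminus)

lemma meval_power: "meval x (p ^ n) = meval x p ^ n"
  by (induction n) (auto simp: meval_mult)

lemma single_eq_prod:
  fixes a :: "'v::finite \<Rightarrow>\<^sub>0 nat" and c :: "'k::field_char_0"
  shows "Poly_Mapping.single a c = mconst c * (\<Prod>i\<in>UNIV. mvar i ^ Poly_Mapping.lookup a i)"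
  by (rule meval_inject) (simp add: meval_mult meval_prod meval_power mono_eval_def)

lemma mpoly_generated:
  fixes p :: "('v::finite, 'k::field_char_0) mpoly"
  assumes A: "is_subring A" and c: "\<And>c. mconst c \<in> A" and v: "\<And>i. mvar i \<in> A"
  shows "p \<in> A"
proof -
  have "(\<Prod>i\<in>S. mvar i ^ Poly_Mapping.lookup a i) \<in> A" for S and a :: "'v \<Rightarrow>\<^sub>0 nat"
    by (induction S rule: infinite_finite_induct)
      (auto intro!: is_subringD[OF A] is_subring_power[OF A] v)
  then show ?thesis
    by (subst poly_mapping_sum_single, unfold single_eq_prod)
      (intro is_subring_sum[OF A] is_subringD[OF A] c)
qed

section \<open>Substitution and algebraic independence modulo an ideal\<close>

text \<open>\<open>subst_rel I y F r\<close> says that \<open>r\<close> results from substituting \<open>y\<close> for the variables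
  indexed by \<open>I\<close> in a formal polynomial whose polynomial function is \<open>F\<close>.\<close>

inductive subst_rel :: "'i set \<Rightarrow> ('i \<Rightarrow> ('v, 'k::comm_ring_1) mpoly) \<Rightarrow>
    (('i \<Rightarrow> 'k) \<Rightarrow> 'k) \<Rightarrow> ('v, 'k) mpoly \<Rightarrow> bool"
  for I y where
  const: "subst_rel I y (\<lambda>b. c) (mconst c)"
| var: "i \<in> I \<Longrightarrow> subst_rel I y (\<lambda>b. b i) (y i)"
| add: "subst_rel I y F r \<Longrightarrow> subst_rel I y G s \<Longrightarrow> subst_rel I y (\<lambda>b. F b + G b) (r + s)"
| mult: "subst_rel I y F r \<Longrightarrow> subst_rel I y G s \<Longrightarrow> subst_rel I y (\<lambda>b. F b * G b) (r * s)"

definition alg_indep :: "'i set \<Rightarrow> ('i \<Rightarrow> ('v, 'k::comm_ring_1) mpoly) \<Rightarrow> ('v, 'k) mpoly set \<Rightarrow> bool"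
  where "alg_indep I y P \<longleftrightarrow> (\<forall>F r. subst_rel I y F r \<longrightarrow> r \<in> P \<longrightarrow> (\<forall>b. F b = 0))"

lemma alg_indepD: "alg_indep I y P \<Longrightarrow> subst_rel I y F r \<Longrightarrow> r \<in> P \<Longrightarrow> F b = 0"
  by (auto simp: alg_indep_def)

lemma mconst_uminus: "mconst (- c) = - mconst c"
  and mconst_add: "mconst (c + d) = mconst c + mconst d"
  and mconst_mult: "mconst (c * d) = mconst c * mconst d"
  and mconst_0: "mconst 0 = 0"
  and mconst_1: "mconst 1 = 1"
  by (auto simp: mconst_def single_add[symmetric] mult_single single_uminus)

lemma subst_rel_uminus: "subst_rel I y F r \<Longrightarrow> subst_rel I y (\<lambda>b. - F b) (- r)"
  using subst_rel.mult[OF subst_rel.const[of I y "-1"], of F r]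
  by (simp add: mconst_uminus mconst_1)

lemma subst_rel_diff:
  "subst_rel I y F r \<Longrightarrow> subst_rel I y G s \<Longrightarrow> subst_rel I y (\<lambda>b. F b - G b) (r - s)"
  using subst_rel.add[OF _ subst_rel_uminus, of I y F r G s] by simp

lemma subst_rel_sum:
  assumes "\<And>j. j \<in> S \<Longrightarrow> subst_rel I y (F j) (r j)"
  shows "subst_rel I y (\<lambda>b. \<Sum>j\<in>S. F j b) (\<Sum>j\<in>S. r j)"
  using assms
  by (induction S rule: infinite_finite_induct)
    (use subst_rel.const[of I y 0] in \<open>auto simp: mconst_0 intro: subst_rel.add\<close>)

lemma subst_rel_prod:
  assumes "\<And>j. j \<in> S \<Longrightarrow> subst_rel I y (F j) (r j)"
  shows "subst_rel I y (\<lambda>b. \<Prod>j\<in>S. F j b) (\<Prod>j\<in>S. r j)"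
  using assms
  by (induction S rule: infinite_finite_induct)
    (use subst_rel.const[of I y 1] in \<open>auto simp: mconst_1 intro: subst_rel.mult\<close>)

lemma subst_rel_power: "subst_rel I y F r \<Longrightarrow> subst_rel I y (\<lambda>b. F b ^ n) (r ^ n)"
  using subst_rel_prod[of "{..<n}" I y "\<lambda>_. F" "\<lambda>_. r"] by simp

lemma subst_rel_meval: "subst_rel I y F r \<Longrightarrow> meval x r = F (\<lambda>i. meval x (y i))"
  by (induction rule: subst_rel.induct) (auto simp: meval_add meval_mult)

lemma subst_rel_cong: "subst_rel I y F r \<Longrightarrow> (\<And>i. i \<in> I \<Longrightarrow> b i = b' i) \<Longrightarrow> F b = F b'"
  by (induction rule: subst_rel.induct) auto

lemma subst_rel_line:
  "subst_rel I y F r \<Longrightarrow> \<exists>p. \<forall>t. F (\<lambda>i. b i + t * d i) = poly p t"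
proof (induction rule: subst_rel.induct)
  case (const c)
  show ?case by (intro exI[of _ "[:c:]"]) simp
next
  case (var i)
  show ?case by (intro exI[of _ "[:b i, d i:]"]) simp
next
  case (add F r G s)
  then show ?case by (metis poly_add)
next
  case (mult F r G s)
  then show ?case by (metis poly_mult)
qed

text \<open>On the line from \<open>b\<close> to \<open>c\<close> both functions are one-variable
  polynomials, nonzero at \<open>t = 0\<close> and at \<open>t = 1\<close> respectively, so their
  product has a non-root. This is the irreducibility of affine space.\<close>

lemma subst_rel_common_nonzero:
  fixes F G :: "('i \<Rightarrow> 'k::field_char_0) \<Rightarrow> 'k"
  assumes F: "subst_rel I y F r" "F b \<noteq> 0" and G: "subst_rel J z G s" "G c \<noteq> 0"
  shows "\<exists>d. F d \<noteq> 0 \<and> G d \<noteq> 0"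
proof -
  obtain p q where
    p: "\<And>t. F (\<lambda>i. b i + t * (c i - b i)) = poly p t" and
    q: "\<And>t. G (\<lambda>i. b i + t * (c i - b i)) = poly q t"
    using subst_rel_line[OF F(1), of b "\<lambda>i. c i - b i"] subst_rel_line[OF G(1), of b "\<lambda>i. c i - b i"]
    by blast
  have "p \<noteq> 0" "q \<noteq> 0"
    using p[of 0] q[of 1] F(2) G(2) by auto
  then have "p * q \<noteq> 0" by simp
  then obtain t where "poly (p * q) t \<noteq> 0"
    using poly_all_0_iff_0 by blast
  then have "poly p t \<noteq> 0" "poly q t \<noteq> 0"
    by auto
  then show ?thesis
    unfolding p[symmetric] q[symmetric] by blast
qed

text \<open>The image under \<open>y\<close> of the part of \<open>zero_locus P\<close> where
  \<open>g\<close> does not vanish contains a nonempty open set of tuples. A tuple \<open>b\<close>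
  defines a homomorphism on the ring generated by the \<open>y i\<close>; extending it to all
  polynomials with \<open>g\<close> kept nonzero gives a point, whose coordinates are the images of
  the variables.\<close>

theorem dominant_on_prime:
  fixes P :: "('v::finite, 'k::{alg_closed_field, field_char_0}) mpoly set"
  assumes P: "prime_ring_ideal P" and ind: "alg_indep I y P" and g: "g \<notin> P"
  shows "\<exists>H h b0. subst_rel I y H h \<and> H b0 \<noteq> 0 \<and>
    (\<forall>b. H b \<noteq> 0 \<longrightarrow> (\<exists>x\<in>zero_locus P. meval x g \<noteq> 0 \<and> (\<forall>i\<in>I. meval x (y i) = b i)))"
proof -
  define A where "A = {r. \<exists>F. subst_rel I y F r}"
  have cA: "mconst c \<in> A" for c
    unfolding A_def using subst_rel.const by blast
  have A: "is_subring A"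
    unfolding is_subring_def
  proof (intro conjI ballI)
    show "0 \<in> A" "1 \<in> A"
      using cA[of 0] cA[of 1] by (simp_all add: mconst_0 mconst_1)
  qed (auto simp: A_def intro: subst_rel.intros subst_rel_uminus)
  obtain xs :: "'v list" where xs: "set xs = UNIV"
    using finite_list[OF finite] by blast
  note all = mpoly_generated[OF adjoin_list_subring[OF A, of "map mvar xs"]]
  have UN: "p \<in> adjoin_list A (map mvar xs)" for p
    by (rule all) (use adjoin_list_mono[OF A] cA adjoin_list_mem[OF A] in \<open>auto simp: xs\<close>)
  obtain h where h: "h \<in> A - P" and ext: "\<And>f :: _ \<Rightarrow> 'k. hom_mod P A f \<Longrightarrow> f h \<noteq> 0 \<Longrightarrow>
      \<exists>f'. hom_mod P (adjoin_list A (map mvar xs)) f' \<and> (\<forall>a\<in>A. f' a = f a) \<and> f' g \<noteq> 0"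
    using hom_mod_extend_list[OF A P UN g] by blast
  obtain H where H: "subst_rel I y H h"
    using h by (auto simp: A_def)
  have "\<exists>b0. H b0 \<noteq> 0"
  proof (rule ccontr)
    assume "\<nexists>b0. H b0 \<noteq> 0"
    then have "meval x h = 0" for x
      using subst_rel_meval[OF H] by simp
    then have "h = 0"
      by (rule meval_eq_0_imp)
    then show False
      using h ring_ideal_0[OF prime_ring_idealD(1)[OF P]] by simp
  qed
  then obtain b0 where "H b0 \<noteq> 0" by blast
  moreover have "\<exists>x\<in>zero_locus P. meval x g \<noteq> 0 \<and> (\<forall>i\<in>I. meval x (y i) = b i)" if b: "H b \<noteq> 0" for b
  proof -
    \<comment> \<open>Several \<open>F\<close> can represent the same \<open>r\<close>; their
      difference represents 0, which is in \<open>P\<close>, so independence makes the value at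
      \<open>b\<close> unique.\<close>
    define f where "f r = (SOME F. subst_rel I y F r) b" for r
    have f: "f r = F b" if F: "subst_rel I y F r" for F r
    proof -
      have "subst_rel I y (SOME F. subst_rel I y F r) r"
        using someI_ex[of "\<lambda>F. subst_rel I y F r"] F by blast
      from alg_indepD[OF ind subst_rel_diff[OF this F], of b] show ?thesis
        using ring_ideal_0[OF prime_ring_idealD(1)[OF P]] by (simp add: f_def)
    qed
    have "hom_mod P A f"
      unfolding hom_mod_def
    proof (intro conjI ballI)
      show "f 1 = 1"
        using f[OF subst_rel.const, of 1] by (simp add: mconst_1)
    next
      fix r s assume "r \<in> A" "s \<in> A"
      then obtain F G where FG: "subst_rel I y F r" "subst_rel I y G s"
        by (auto simp: A_def)
      show "f (r + s) = f r + f s" "f (r * s) = f r * f s"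
        unfolding f[OF FG(1)] f[OF FG(2)] f[OF subst_rel.add[OF FG]] f[OF subst_rel.mult[OF FG]]
        by (rule refl)+
    next
      fix r assume "r \<in> A \<inter> P"
      then obtain F where F: "subst_rel I y F r" "r \<in> P"
        by (auto simp: A_def)
      show "f r = 0"
        unfolding f[OF F(1)] by (rule alg_indepD[OF ind F])
    qed
    moreover have "f h \<noteq> 0"
      using f[OF H] b by simp
    ultimately obtain f' where f': "hom_mod P (adjoin_list A (map mvar xs)) f'"
        "\<And>a. a \<in> A \<Longrightarrow> f' a = f a" "f' g \<noteq> 0"
      using ext by blast
    define x where "x = (\<chi> i. f' (mvar i))"
    have add: "f' (p + q) = f' p + f' q" and mult: "f' (p * q) = f' p * f' q"
      and P0: "p \<in> P \<Longrightarrow> f' p = 0" for p q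
      using f'(1) UN by (auto simp: hom_mod_def)
    have const: "f' (mconst c) = c" for c
      using f'(2)[OF cA] f[OF subst_rel.const] by simp
    have minus: "f' (- p) = - f' p" for p
      using add[of p "-p"] const[of 0] by (simp add: mconst_0 eq_neg_iff_add_eq_0 add.commute)
    have S: "is_subring {p. f' p = meval x p}"
      using const[of 0] const[of 1]
      by (auto simp: is_subring_def add mult minus meval_add meval_mult meval_uminus mconst_0 mconst_1)
    have "f' (mvar i) = meval x (mvar i)" for i
      by (simp add: x_def)
    then have eval: "f' p = meval x p" for p
      using mpoly_generated[OF S, of p] const by auto
    have "x \<in> zero_locus P"
      using P0 by (auto simp: zero_locus_def eval)
    moreover have "meval x (y i) = b i" if "i \<in> I" for i
      using f[OF subst_rel.var[OF that]] f'(2)[of "y i"] subst_rel.var[OF that]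
      by (auto simp: A_def eval)
    ultimately show ?thesis
      using f'(3) by (auto simp: eval)
  qed
  ultimately have "subst_rel I y H h \<and> H b0 \<noteq> 0 \<and>
    (\<forall>b. H b \<noteq> 0 \<longrightarrow> (\<exists>x\<in>zero_locus P. meval x g \<noteq> 0 \<and> (\<forall>i\<in>I. meval x (y i) = b i)))"
    using H by simp
  then show ?thesis
    by (intro exI)
qed

lemma alg_indep_empty:
  assumes P: "ring_ideal P" and "1 \<notin> (P :: ('v, 'k::field) mpoly set)"
  shows "alg_indep {} y P"
proof -
  have "\<exists>c. F = (\<lambda>b. c) \<and> r = mconst c" if "subst_rel {} y F r" for F r
    using that
  proof (induction rule: subst_rel.induct)
    case (add F r G s)
    then show ?case by (auto simp: mconst_add)
  next
    case (mult F r G s)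
    then show ?case by (auto simp: mconst_mult)
  qed auto
  moreover have "c = 0" if "mconst c \<in> P" for c
    using ring_ideal_mult[OF P that, of "mconst (inverse c)"] assms(2)
    by (cases "c = 0") (auto simp: mconst_mult[symmetric] mconst_1)
  ultimately show ?thesis
    unfolding alg_indep_def by blast
qed

text \<open>\<open>dominant_on_prime\<close> with no prescribed values: on the empty index set
  independence only says that \<open>P\<close> contains no nonzero constant.\<close>

corollary nullstellensatz_prime:
  fixes P :: "('v::finite, 'k::{alg_closed_field, field_char_0}) mpoly set"
  assumes P: "prime_ring_ideal P" and g: "g \<notin> P"
  shows "\<exists>x\<in>zero_locus P. meval x g \<noteq> 0"
proof -
  define y :: "unit \<Rightarrow> ('v, 'k) mpoly" where "y = undefined"
  from dominant_on_prime[OF P alg_indep_empty[OF prime_ring_idealD(1,2)[OF P], of y] g]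
  obtain H h b0 where H: "subst_rel {} y H h \<and> H b0 \<noteq> 0 \<and>
      (\<forall>b. H b \<noteq> 0 \<longrightarrow> (\<exists>x\<in>zero_locus P. meval x g \<noteq> 0 \<and> (\<forall>i\<in>{}. meval x (y i) = b i)))"
    by (elim exE)
  then have "\<exists>x\<in>zero_locus P. meval x g \<noteq> 0 \<and> (\<forall>i\<in>{}. meval x (y i) = b0 i)"
    by (elim conjE allE[of _ b0] impE)
  then show ?thesis
    by blast
qed

section \<open>Dimension and algebraic independence\<close>

definition vanishing :: "('k::comm_ring_1 ^ 'v::finite) set \<Rightarrow> ('v, 'k) mpoly set" where
  "vanishing X = {p. \<forall>x\<in>X. meval x p = 0}"

lemma vanishing_ideal: "ring_ideal (vanishing X)"
  by (simp add: ring_ideal_def vanishing_def meval_add meval_mult)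

lemma vanishing_antimono: "X \<subseteq> Y \<Longrightarrow> vanishing Y \<subseteq> vanishing X"
  by (auto simp: vanishing_def)

lemma zero_locus_antimono: "S \<subseteq> T \<Longrightarrow> zero_locus T \<subseteq> zero_locus S"
  by (auto simp: zero_locus_def)

lemma closed_zero_locus [simp]: "zariski_closed (zero_locus S)"
  by (auto simp: zariski_closed_def)

lemma zero_locus_vanishing: "zariski_closed X \<Longrightarrow> zero_locus (vanishing X) = X"
  by (auto simp: zariski_closed_def zero_locus_def vanishing_def)

lemma zero_locus_Un: "zero_locus (S \<union> T) = zero_locus S \<inter> zero_locus T"
  by (auto simp: zero_locus_def)

lemma zariski_closed_Int: "zariski_closed X \<Longrightarrow> zariski_closed Y \<Longrightarrow> zariski_closed (X \<inter> Y)"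
  unfolding zariski_closed_def by (metis zero_locus_Un)

lemma exists_separating_poly:
  assumes "zariski_closed A" "\<not> X \<subseteq> A"
  shows "\<exists>p\<in>vanishing A. p \<notin> vanishing X"
  using assms zero_locus_vanishing[OF assms(1)] by (auto simp: zero_locus_def vanishing_def)

lemma irreducible_closed_vanishing_prime:
  fixes Z :: "('k::field ^ 'v::finite) set"
  assumes Z: "irreducible_closed Z"
  shows "prime_ring_ideal (vanishing Z)"
  unfolding prime_ring_ideal_def
proof (intro conjI allI impI vanishing_ideal)
  show "1 \<notin> vanishing Z"
    using Z by (auto simp: irreducible_closed_def vanishing_def)
next
  fix p q assume pq: "p * q \<in> vanishing Z"
  have "Z = (Z \<inter> zero_locus {p}) \<union> (Z \<inter> zero_locus {q})"
    using pq by (auto simp: vanishing_def zero_locus_def meval_mult)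
  moreover have "zariski_closed (Z \<inter> zero_locus {p})" "zariski_closed (Z \<inter> zero_locus {q})"
    using Z by (auto simp: irreducible_closed_def intro!: zariski_closed_Int)
  ultimately have "Z = Z \<inter> zero_locus {p} \<or> Z = Z \<inter> zero_locus {q}"
    using Z unfolding irreducible_closed_def by blast
  then show "p \<in> vanishing Z \<or> q \<in> vanishing Z"
    by (auto simp: vanishing_def zero_locus_def)
qed

lemma vanishing_zero_locus_prime:
  fixes P :: "('v::finite, 'k::{alg_closed_field, field_char_0}) mpoly set"
  assumes "prime_ring_ideal P"
  shows "vanishing (zero_locus P) = P"
proof
  show "vanishing (zero_locus P) \<subseteq> P"
    using nullstellensatz_prime[OF assms] by (auto simp: vanishing_def)
qed (auto simp: vanishing_def zero_locus_def)

lemma irreducible_closed_zero_locus_prime: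
  fixes P :: "('v::finite, 'k::{alg_closed_field, field_char_0}) mpoly set"
  assumes P: "prime_ring_ideal P"
  shows "irreducible_closed (zero_locus P)"
  unfolding irreducible_closed_def
proof (intro conjI allI impI closed_zero_locus)
  show "zero_locus P \<noteq> {}"
    using nullstellensatz_prime[OF P prime_ring_idealD(2)[OF P]] by blast
next
  fix A B assume AB: "zariski_closed A" "zariski_closed B" and Un: "zero_locus P = A \<union> B"
  show "zero_locus P = A \<or> zero_locus P = B"
  proof (rule ccontr)
    assume "\<not> (zero_locus P = A \<or> zero_locus P = B)"
    then have "\<not> zero_locus P \<subseteq> A" "\<not> zero_locus P \<subseteq> B"
      using Un by auto
    then obtain p q where pq: "p \<in> vanishing A" "p \<notin> P" "q \<in> vanishing B" "q \<notin> P"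
      using exists_separating_poly AB vanishing_zero_locus_prime[OF P] by metis
    then have "p * q \<in> vanishing (zero_locus P)"
      unfolding Un by (auto simp: vanishing_def meval_mult)
    then show False
      using pq prime_ring_idealD(3)[OF P] vanishing_zero_locus_prime[OF P] by blast
  qed
qed

section \<open>From independent functions to chains\<close>

lemma alg_indep_antimono: "alg_indep I y P \<Longrightarrow> Q \<subseteq> P \<Longrightarrow> alg_indep I y Q"
  by (auto simp: alg_indep_def)

text \<open>Independence modulo \<open>J\<close> says that \<open>J\<close> misses the set
  \<open>S\<close> of results of substituting into nonzero polynomials. This set is closed under
  products, so \<open>J\<close> can be enlarged to a prime that still misses it, as
  \<open>dominant_on_prime\<close> requires.\<close>

lemma exists_prime_alg_indep:
  fixes J :: "('v::finite, 'k::field_char_0) mpoly set"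
  assumes J: "ring_ideal J" and ind: "alg_indep I y J"
  shows "\<exists>P. prime_ring_ideal P \<and> J \<subseteq> P \<and> alg_indep I y P"
proof -
  define S where "S = {r. \<exists>F b. subst_rel I y F r \<and> F b \<noteq> 0}"
  have "1 \<in> S"
    unfolding S_def using subst_rel.const[of I y 1] by (auto simp: mconst_1)
  moreover have "r * s \<in> S" if rs: "r \<in> S" "s \<in> S" for r s
  proof -
    obtain F b where F: "subst_rel I y F r" "F b \<noteq> 0"
      using rs(1) unfolding S_def by (elim CollectE exE conjE)
    obtain G c where G: "subst_rel I y G s" "G c \<noteq> 0"
      using rs(2) unfolding S_def by (elim CollectE exE conjE)
    obtain d where "F d * G d \<noteq> 0"
      using subst_rel_common_nonzero[OF F G] by auto
    with subst_rel.mult[OF F(1) G(1)] show ?thesis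
      unfolding S_def by (intro CollectI exI conjI)
  qed
  moreover have "J \<inter> S = {}"
    using alg_indepD[OF ind] by (auto simp: S_def)
  ultimately obtain P where P: "prime_ring_ideal P" "J \<subseteq> P" "P \<inter> S = {}"
    using exists_prime_avoiding[OF J] by metis
  have "alg_indep I y P"
    unfolding alg_indep_def using P(3) by (auto simp: S_def)
  then show ?thesis
    using P by blast
qed

lemma subst_rel_specialize:
  assumes "subst_rel (insert i I) y F r"
  shows "\<exists>s. subst_rel I y (\<lambda>b. F (b(i := c))) s"
  using assms
proof (induction rule: subst_rel.induct)
  case (var j)
  then show ?case
    using subst_rel.const[of I y c] subst_rel.var[of j I y] by (cases "j = i") auto
next
  case (add F r G s)
  then obtain u v where "subst_rel I y (\<lambda>b. F (b(i := c))) u" "subst_rel I y (\<lambda>b. G (b(i := c))) v"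
    by (elim exE)
  from subst_rel.add[OF this] show ?case by (rule exI)
next
  case (mult F r G s)
  then obtain u v where "subst_rel I y (\<lambda>b. F (b(i := c))) u" "subst_rel I y (\<lambda>b. G (b(i := c))) v"
    by (elim exE)
  from subst_rel.mult[OF this] show ?case by (rule exI)
qed (auto intro: subst_rel.const)

text \<open>Slicing an irreducible closed set by \<open>y\<^sub>i = c\<close> for suitable \<open>c\<close> preserves the independence
  of the other functions, because the image of the set under \<open>y\<close> contains a nonempty open set.\<close>

lemma alg_indep_imp_chain:
  fixes X :: "('k::{alg_closed_field, field_char_0} ^ 'v::finite) set"
  assumes "finite I" "zariski_closed X" "alg_indep I y (vanishing X)"
  shows "\<exists>Z. (\<forall>i\<le>card I. irreducible_closed (Z i) \<and> Z i \<subseteq> X) \<and> (\<forall>i<card I. Z i \<subset> Z (Suc i))"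
  using assms
proof (induction I arbitrary: X rule: finite_induct)
  case empty
  then obtain P where P: "prime_ring_ideal P" "vanishing X \<subseteq> P"
    using exists_prime_alg_indep[OF vanishing_ideal] by blast
  then show ?case
    using irreducible_closed_zero_locus_prime[OF P(1)] zero_locus_antimono[OF P(2)]
      zero_locus_vanishing[OF empty.prems(1)]
    by (intro exI[of _ "\<lambda>_. zero_locus P"]) auto
next
  case (insert i I)
  obtain P where P: "prime_ring_ideal P" "vanishing X \<subseteq> P" and ind: "alg_indep (insert i I) y P"
    using exists_prime_alg_indep[OF vanishing_ideal insert.prems(2)] by blast
  let ?Z = "zero_locus P"
  have ZX: "?Z \<subseteq> X"
    using zero_locus_antimono[OF P(2)] zero_locus_vanishing[OF insert.prems(1)] by simp
  obtain H h b0 where H: "subst_rel (insert i I) y H h" "H b0 \<noteq> 0"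
    and pt: "\<forall>b. H b \<noteq> 0 \<longrightarrow> (\<exists>x\<in>?Z. meval x 1 \<noteq> 0 \<and> (\<forall>j\<in>insert i I. meval x (y j) = b j))"
    using dominant_on_prime[OF P(1) ind prime_ring_idealD(2)[OF P(1)]] by (elim exE conjE)
  \<comment> \<open>With this value the restriction \<open>Hc\<close> of \<open>H\<close> to the
    slice is nonzero at \<open>b0\<close>, so all values of the other functions where
    \<open>Hc\<close> is nonzero are attained on \<open>X'\<close>.\<close>
  define c where "c = b0 i"
  define X' where "X' = ?Z \<inter> zero_locus {y i - mconst c}"
  define Hc where "Hc = (\<lambda>b. H (b(i := c)))"
  obtain h' where Hc: "subst_rel I y Hc h'"
    using subst_rel_specialize[OF H(1), of c] unfolding Hc_def by (elim exE)
  have Hc0: "Hc b0 \<noteq> 0"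
    using H(2) by (simp add: c_def Hc_def)
  have indep: "alg_indep I y (vanishing X')"
    unfolding alg_indep_def
  proof (intro allI impI, rule ccontr)
    fix F r b assume F: "subst_rel I y F r" "r \<in> vanishing X'" "F b \<noteq> 0"
    obtain d where d: "F d \<noteq> 0" "Hc d \<noteq> 0"
      using subst_rel_common_nonzero[OF F(1,3) Hc Hc0] by (elim exE conjE)
    then have Hd: "H (d(i := c)) \<noteq> 0"
      by (simp add: Hc_def)
    obtain x where x: "x \<in> ?Z" "\<forall>j\<in>insert i I. meval x (y j) = (d(i := c)) j"
      using pt[rule_format, OF Hd] by (elim bexE conjE)
    then have "x \<in> X'"
      by (auto simp: X'_def zero_locus_def meval_diff)
    then have "meval x r = 0"
      using F(2) by (simp add: vanishing_def)
    moreover have "meval x r = F d"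
      unfolding subst_rel_meval[OF F(1)] using x(2) insert.hyps(2)
      by (intro subst_rel_cong[OF F(1)]) auto
    ultimately show False
      using d(1) by simp
  qed
  have "zariski_closed X'"
    unfolding X'_def by (intro zariski_closed_Int closed_zero_locus)
  from insert.IH[OF this indep]
  obtain Z where Z: "\<forall>i\<le>card I. irreducible_closed (Z i) \<and> Z i \<subseteq> X'"
      "\<forall>i<card I. Z i \<subset> Z (Suc i)"
    by (elim exE conjE)
  have "\<exists>x\<in>?Z. x \<notin> X'"
  proof -
    have D: "subst_rel (insert i I) y (\<lambda>b. b i - c) (y i - mconst c)"
      by (intro subst_rel_diff subst_rel.var subst_rel.const) simp
    have "\<exists>d. H d \<noteq> 0 \<and> d i - c \<noteq> 0"
      by (rule subst_rel_common_nonzero[OF H D, where c = "\<lambda>_. c + 1"]) simp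
    then obtain d where d: "H d \<noteq> 0" "d i - c \<noteq> 0"
      by (elim exE conjE)
    obtain x where "x \<in> ?Z" "\<forall>j\<in>insert i I. meval x (y j) = d j"
      using pt[rule_format, OF d(1)] by (elim bexE conjE)
    then show ?thesis
      using d(2) by (intro bexI[of _ x]) (auto simp: X'_def zero_locus_def meval_diff)
  qed
  then have sub: "X' \<subset> ?Z"
    by (auto simp: X'_def)
  \<comment> \<open>\<open>X'\<close> need not be irreducible. The chain found inside it is extended
    by \<open>?Z\<close>, which contains \<open>X'\<close> properly because it has a point at which
    \<open>y i\<close> differs from \<open>c\<close>.\<close>
  let ?Y = "\<lambda>j. if j \<le> card I then Z j else ?Z"
  have card: "card (insert i I) = Suc (card I)"
    using insert.hyps by simp
  have "irreducible_closed (?Y j) \<and> ?Y j \<subseteq> X" for j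
    using Z(1) irreducible_closed_zero_locus_prime[OF P(1)] ZX sub by auto
  moreover have "?Y j \<subset> ?Y (Suc j)" if "j < Suc (card I)" for j
  proof (cases "j = card I")
    case True
    then show ?thesis
      using Z(1) sub by auto
  qed (use that Z(2) in auto)
  ultimately show ?case
    unfolding card by (intro exI[of _ ?Y]) blast
qed

corollary zariski_dim_ge:
  fixes X :: "('k::{alg_closed_field, field_char_0} ^ 'v::finite) set"
  assumes "finite I" "zariski_closed X" "alg_indep I y (vanishing X)"
  shows "ereal (real (card I)) \<le> zariski_dim X"
  unfolding zariski_dim_def using alg_indep_imp_chain[OF assms] by (intro Sup_upper) blast

section \<open>From chains to independent functions\<close>

lemma subst_rel_insert:
  assumes "subst_rel (insert i I) y F r"
  shows "\<exists>Q R. (\<forall>b. F b = poly (Q b) (b i)) \<and> r = poly R (y i) \<and>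
    (\<forall>j. subst_rel I y (\<lambda>b. coeff (Q b) j) (coeff R j))"
  using assms
proof (induction rule: subst_rel.induct)
  case (const c)
  have "subst_rel I y (\<lambda>b. coeff [:c:] j) (coeff [:mconst c:] j)" for j
    using subst_rel.const[of I y c] subst_rel.const[of I y 0]
    by (cases j) (simp_all add: mconst_0)
  then show ?case
    by (intro exI[of _ "\<lambda>_. [:c:]"] exI[of _ "[:mconst c:]"]) simp
next
  case (var l)
  have 0: "subst_rel I y (\<lambda>b. 0) 0" and 1: "subst_rel I y (\<lambda>b. 1) 1"
    using subst_rel.const[of I y 0] subst_rel.const[of I y 1] by (simp_all add: mconst_0 mconst_1)
  show ?case
  proof (cases "l = i")
    case True
    have "subst_rel I y (\<lambda>b. coeff [:0, 1:] j) (coeff [:0, 1:] j)" for j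
      using 0 1 by (auto simp: coeff_pCons split: nat.splits)
    then show ?thesis
      by (intro exI[of _ "\<lambda>_. [:0, 1:]"] exI[of _ "[:0, 1:]"]) (simp add: True)
  next
    case False
    then have "subst_rel I y (\<lambda>b. coeff [:b l:] j) (coeff [:y l:] j)" for j
      using 0 subst_rel.var[of l I y] var by (cases j) auto
    then show ?thesis
      by (intro exI[of _ "\<lambda>b. [:b l:]"] exI[of _ "[:y l:]"]) simp
  qed
next
  case (add F r G s)
  then obtain Q R Q' R' where *: "\<forall>b. F b = poly (Q b) (b i)" "r = poly R (y i)"
    "\<forall>j. subst_rel I y (\<lambda>b. coeff (Q b) j) (coeff R j)"
    "\<forall>b. G b = poly (Q' b) (b i)" "s = poly R' (y i)"
    "\<forall>j. subst_rel I y (\<lambda>b. coeff (Q' b) j) (coeff R' j)"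
    by blast
  then show ?case
    by (intro exI[of _ "\<lambda>b. Q b + Q' b"] exI[of _ "R + R'"]) (auto intro: subst_rel.add)
next
  case (mult F r G s)
  then obtain Q R Q' R' where *: "\<forall>b. F b = poly (Q b) (b i)" "r = poly R (y i)"
    "\<forall>j. subst_rel I y (\<lambda>b. coeff (Q b) j) (coeff R j)"
    "\<forall>b. G b = poly (Q' b) (b i)" "s = poly R' (y i)"
    "\<forall>j. subst_rel I y (\<lambda>b. coeff (Q' b) j) (coeff R' j)"
    by blast
  then show ?case
    by (intro exI[of _ "\<lambda>b. Q b * Q' b"] exI[of _ "R * R'"])
      (auto simp: coeff_mult intro!: subst_rel_sum subst_rel.mult)
qed

text \<open>In a relation \<open>poly R (y i)\<close> in \<open>P'\<close> all terms but the
  constant one lie in \<open>P\<close>, so the constant coefficient lies in \<open>P\<close> as well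
  and vanishes by independence. Then \<open>y i\<close> can be cancelled modulo the prime
  \<open>P'\<close>, and induction on \<open>R\<close> removes the remaining coefficients.\<close>

lemma alg_indep_step:
  fixes P P' :: "('v::finite, 'k::field_char_0) mpoly set"
  assumes ind: "alg_indep I y P" and P: "ring_ideal P" and P': "prime_ring_ideal P'" "P' \<subseteq> P"
    and yi: "y i \<in> P" "y i \<notin> P'"
  shows "alg_indep (insert i I) y P'"
proof -
  have "coeff (Q b) j = 0"
    if "\<forall>j. subst_rel I y (\<lambda>b. coeff (Q b) j) (coeff R j)" "poly R (y i) \<in> P'" for Q R b j
    using that
  proof (induction R arbitrary: Q j rule: pCons_induct)
    case 0
    show ?case
      using alg_indepD[OF ind, of "\<lambda>b. coeff (Q b) j" 0 b] 0 ring_ideal_0[OF P] by simp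
  next
    case (pCons a R)
    have a: "subst_rel I y (\<lambda>b. coeff (Q b) 0) a"
      using pCons.prems(1) by (metis coeff_pCons_0)
    have "poly (pCons a R) (y i) - poly R (y i) * y i \<in> P"
      using pCons.prems(2) P'(2) yi(1) by (intro ring_ideal_diff[OF P] ring_ideal_mult[OF P]) auto
    then have "a \<in> P"
      by (simp add: algebra_simps)
    then have Q0: "coeff (Q b) 0 = 0" for b
      using alg_indepD[OF ind a] by simp
    then have "meval x a = 0" for x
      using subst_rel_meval[OF a] by simp
    then have "a = 0"
      by (rule meval_eq_0_imp)
    then have "y i * poly R (y i) \<in> P'"
      using pCons.prems(2) by simp
    then have R: "poly R (y i) \<in> P'"
      using prime_ring_idealD(3)[OF P'(1)] yi(2) by blast
    have shift: "subst_rel I y (\<lambda>b. coeff (poly_shift 1 (Q b)) l) (coeff R l)" for l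
      using pCons.prems(1)[rule_format, of "Suc l"] by (simp add: coeff_poly_shift)
    show ?case
    proof (cases j)
      case (Suc l)
      then show ?thesis
        using pCons.IH[of "\<lambda>b. poly_shift 1 (Q b)" l] shift R by (simp add: coeff_poly_shift)
    qed (simp add: Q0)
  qed
  note coeff_0 = this
  show ?thesis
    unfolding alg_indep_def
  proof (intro allI impI)
    fix F r b assume F: "subst_rel (insert i I) y F r" "r \<in> P'"
    from subst_rel_insert[OF F(1)] obtain Q R where Q: "\<forall>b. F b = poly (Q b) (b i)"
      and R: "r = poly R (y i)" "\<forall>j. subst_rel I y (\<lambda>b. coeff (Q b) j) (coeff R j)"
      by (elim exE conjE)
    have "Q b = 0"
      using coeff_0[OF R(2) F(2)[unfolded R(1)]] by (intro poly_eqI) simp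
    then show "F b = 0"
      using Q by simp
  qed
qed

text \<open>Each strict inclusion contributes a function that vanishes on the smaller set but not on
  the larger one; climbing the chain, \<open>alg_indep_step\<close> adds it to the family.\<close>

lemma chain_imp_alg_indep:
  fixes Z :: "nat \<Rightarrow> ('k::field_char_0 ^ 'v::finite) set"
  assumes irr: "\<And>i. i \<le> d \<Longrightarrow> irreducible_closed (Z i)" and less: "\<And>i. i < d \<Longrightarrow> Z i \<subset> Z (Suc i)"
  shows "\<exists>g. alg_indep {..<d} g (vanishing (Z d))"
proof -
  have "\<exists>g\<in>vanishing (Z i). g \<notin> vanishing (Z (Suc i))" if "i < d" for i
    using irr[of i] less[OF that] that
    by (intro exists_separating_poly) (auto simp: irreducible_closed_def)
  then obtain g where g: "\<And>i. i < d \<Longrightarrow> g i \<in> vanishing (Z i)"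
      "\<And>i. i < d \<Longrightarrow> g i \<notin> vanishing (Z (Suc i))"
    by metis
  have "alg_indep {..<e} g (vanishing (Z e))" if "e \<le> d" for e
    using that
  proof (induction e)
    case 0
    show ?case
      using prime_ring_idealD(2)[OF irreducible_closed_vanishing_prime[OF irr[OF 0]]]
      by (auto intro: alg_indep_empty[OF vanishing_ideal])
  next
    case (Suc e)
    have "{..<Suc e} = insert e {..<e}" by auto
    moreover have "vanishing (Z (Suc e)) \<subseteq> vanishing (Z e)"
      using Suc less[of e] by (intro vanishing_antimono) auto
    ultimately show ?case
      using alg_indep_step[OF Suc.IH vanishing_ideal irreducible_closed_vanishing_prime[OF irr]]
        Suc.prems g[of e] by simp
  qed
  then show ?thesis by blast
qed

lemma zariski_dim_le:
  fixes X :: "('k::field_char_0 ^ 'v::finite) set"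
  assumes "\<And>d (g :: nat \<Rightarrow> ('v, 'k) mpoly). alg_indep {..<d} g (vanishing X) \<Longrightarrow> d \<le> c"
  shows "zariski_dim X \<le> ereal (real c)"
  unfolding zariski_dim_def
proof (rule Sup_least, elim CollectE exE conjE)
  fix e d and Z :: "nat \<Rightarrow> ('k ^ 'v) set"
  assume e: "e = ereal (real d)" and Z: "\<forall>i\<le>d. irreducible_closed (Z i) \<and> Z i \<subseteq> X"
    "\<forall>i<d. Z i \<subset> Z (Suc i)"
  then obtain g where "alg_indep {..<d} g (vanishing (Z d))"
    using chain_imp_alg_indep[of d Z] by blast
  then have "alg_indep {..<d} g (vanishing X)"
    by (rule alg_indep_antimono) (use Z(1) vanishing_antimono[of "Z d" X] in blast)
  then show "e \<le> ereal (real c)"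
    using assms e by simp
qed

section \<open>Bounding the number of independent functions\<close>

lemma homogeneous_system_nontrivial:
  fixes M :: "'e \<Rightarrow> 'b \<Rightarrow> 'k::field"
  assumes "finite B" "finite E" "card B < card E"
  shows "\<exists>c. (\<exists>e\<in>E. c e \<noteq> 0) \<and> (\<forall>b\<in>B. (\<Sum>e\<in>E. c e * M e b) = 0)"
  using assms
proof (induction B arbitrary: E M rule: finite_induct)
  case empty
  then obtain e where "e \<in> E" by fastforce
  then show ?case
    by (intro exI[of _ "\<lambda>_. 1"]) auto
next
  case (insert b B)
  show ?case
  proof (cases "\<exists>e\<in>E. M e b \<noteq> 0")
    case False
    have "card B < card E"
      using insert.prems(2) insert.hyps by simp
    from insert.IH[OF insert.prems(1) this, of M] show ?thesis
      using False by auto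
  next
    case True
    then obtain e0 where e0: "e0 \<in> E" "M e0 b \<noteq> 0" by blast
    define E' where "E' = E - {e0}"
    have E: "E = insert e0 E'" "e0 \<notin> E'" "finite E'"
      using e0(1) insert.prems(1) by (auto simp: E'_def)
    have "card B < card E'"
      using insert.prems(2) insert.hyps E by simp
    from insert.IH[OF E(3) this, of "\<lambda>e b'. M e b' - M e b / M e0 b * M e0 b'"]
    obtain c where c: "\<exists>e\<in>E'. c e \<noteq> 0"
      "\<forall>b'\<in>B. (\<Sum>e\<in>E'. c e * (M e b' - M e b / M e0 b * M e0 b')) = 0"
      by blast
    \<comment> \<open>\<open>- s\<close> is the value of the pivot unknown \<open>c e0\<close> that
      solves equation \<open>b\<close>.\<close>
    define s where "s = (\<Sum>e\<in>E'. c e * M e b) / M e0 b"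
    let ?c = "c(e0 := - s)"
    have sum: "(\<Sum>e\<in>E. ?c e * M e b') = - s * M e0 b' + (\<Sum>e\<in>E'. c e * M e b')" for b'
    proof -
      have "(\<Sum>e\<in>E'. ?c e * M e b') = (\<Sum>e\<in>E'. c e * M e b')"
        using E(2) by (intro sum.cong) auto
      then show ?thesis
        using E by simp
    qed
    have "(\<Sum>e\<in>E. ?c e * M e b') = 0" if "b' \<in> insert b B" for b'
    proof (cases "b' = b")
      case True
      then show ?thesis
        unfolding sum using e0(2) by (simp add: s_def)
    next
      case False
      have "s * M e0 b' = (\<Sum>e\<in>E'. c e * (M e b / M e0 b * M e0 b'))"
        by (simp add: s_def sum_distrib_left sum_divide_distrib mult_ac)
      moreover have "(\<Sum>e\<in>E'. c e * M e b') - (\<Sum>e\<in>E'. c e * (M e b / M e0 b * M e0 b')) = 0"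
        using c(2) that False by (simp add: right_diff_distrib sum_subtractf)
      ultimately show ?thesis
        unfolding sum by simp
    qed
    moreover have "\<exists>e\<in>E. ?c e \<noteq> 0"
      using c(1) E by auto
    ultimately show ?thesis
      by blast
  qed
qed

definition spanned_on :: "'x set \<Rightarrow> 'b set \<Rightarrow> ('b \<Rightarrow> 'x \<Rightarrow> 'k::comm_ring_1) \<Rightarrow> ('x \<Rightarrow> 'k) \<Rightarrow> bool" where
  "spanned_on X B \<beta> f \<longleftrightarrow> (\<exists>u. \<forall>x\<in>X. f x = (\<Sum>b\<in>B. u b * \<beta> b x))"

lemma spanned_on_scale:
  assumes "spanned_on X B \<beta> f"
  shows "spanned_on X B \<beta> (\<lambda>x. c * f x)"
proof -
  obtain u where "\<forall>x\<in>X. f x = (\<Sum>b\<in>B. u b * \<beta> b x)"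
    using assms unfolding spanned_on_def by blast
  then show ?thesis
    unfolding spanned_on_def
    by (intro exI[of _ "\<lambda>b. c * u b"]) (simp add: sum_distrib_left mult.assoc)
qed

lemma spanned_on_sum:
  assumes "\<And>i. i \<in> S \<Longrightarrow> spanned_on X B \<beta> (f i)"
  shows "spanned_on X B \<beta> (\<lambda>x. \<Sum>i\<in>S. f i x)"
proof -
  obtain u where "\<And>i x. i \<in> S \<Longrightarrow> x \<in> X \<Longrightarrow> f i x = (\<Sum>b\<in>B. u i b * \<beta> b x)"
    using assms unfolding spanned_on_def by metis
  then have "(\<Sum>i\<in>S. f i x) = (\<Sum>b\<in>B. (\<Sum>i\<in>S. u i b) * \<beta> b x)" if "x \<in> X" for x
    using that by (simp add: sum_distrib_right sum.swap[of _ B S])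
  then show ?thesis
    unfolding spanned_on_def by (intro exI[of _ "\<lambda>b. \<Sum>i\<in>S. u i b"]) simp
qed

lemma spanned_on_base:
  assumes "finite B" "b \<in> B" "\<And>x. x \<in> X \<Longrightarrow> f x = \<beta> b x"
  shows "spanned_on X B \<beta> f"
  unfolding spanned_on_def
proof (intro exI ballI)
  fix x assume "x \<in> X"
  have "(\<Sum>b'\<in>B. (if b' = b then 1 else 0) * \<beta> b' x) = (\<Sum>b'\<in>B. if b' = b then \<beta> b' x else 0)"
    by (intro sum.cong) auto
  then show "f x = (\<Sum>b'\<in>B. (if b' = b then 1 else 0) * \<beta> b' x)"
    using assms \<open>x \<in> X\<close> by simp
qed

lemma spanned_on_cong:
  "spanned_on X B \<beta> f \<Longrightarrow> (\<And>x. x \<in> X \<Longrightarrow> f x = g x) \<Longrightarrow> spanned_on X B \<beta> g"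
  unfolding spanned_on_def by simp

section \<open>Degrees, and functions spanned by products of bounded degree\<close>

lemma mono_eval_single_power: "mono_eval x (Poly_Mapping.single i n) = x $ i ^ n"
proof -
  have "mono_eval x (Poly_Mapping.single i n) = (\<Prod>j\<in>UNIV. if j = i then x $ j ^ n else 1)"
    unfolding mono_eval_def by (rule prod.cong) (auto simp: lookup_single when_def)
  then show ?thesis by simp
qed

definition mdeg :: "('v::finite \<Rightarrow>\<^sub>0 nat) \<Rightarrow> nat" where
  "mdeg a = (\<Sum>i\<in>UNIV. Poly_Mapping.lookup a i)"

lemma mdeg_0 [simp]: "mdeg 0 = 0"
  by (simp add: mdeg_def)

lemma mdeg_add [simp]: "mdeg (a + b) = mdeg a + mdeg b"
  by (simp add: mdeg_def lookup_add sum.distrib)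

lemma mdeg_single [simp]: "mdeg (Poly_Mapping.single i n) = n"
  by (simp add: mdeg_def lookup_single when_def)

definition deg_le :: "nat \<Rightarrow> ('v::finite, 'k::comm_ring_1) mpoly \<Rightarrow> bool" where
  "deg_le d p \<longleftrightarrow> (\<forall>a\<in>Poly_Mapping.keys p. mdeg a \<le> d)"

lemma deg_le_mono: "deg_le d p \<Longrightarrow> d \<le> e \<Longrightarrow> deg_le e p"
  unfolding deg_le_def by force

lemma deg_le_1: "deg_le 0 1"
  unfolding deg_le_def by (metis keys_one mdeg_0 order_refl singletonD)

lemma deg_le_mult: "deg_le d p \<Longrightarrow> deg_le e q \<Longrightarrow> deg_le (d + e) (p * q)"
  unfolding deg_le_def using keys_mult[of p q] by (fastforce intro: add_mono)

lemma deg_le_power: "deg_le d p \<Longrightarrow> deg_le (n * d) (p ^ n)"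
  by (induction n) (auto simp: deg_le_1 intro: deg_le_mult)

lemma deg_le_prod:
  "(\<And>i. i \<in> S \<Longrightarrow> deg_le (d i) (p i)) \<Longrightarrow> deg_le (\<Sum>i\<in>S. d i) (\<Prod>i\<in>S. p i)"
  by (induction S rule: infinite_finite_induct) (auto simp: deg_le_1 intro: deg_le_mult)

lemma deg_le_bound: "\<exists>d. deg_le d p"
  unfolding deg_le_def by (meson finite_keys finite_imageI finite_nat_set_iff_bounded_le imageI)

text \<open>The relations \<open>x\<^sub>i\<^sup>N = \<Sum>\<^sub>j l\<^sub>j g\<^sub>i\<^sub>j\<close> with \<open>deg g\<^sub>i\<^sub>j < N\<close> make the ring of functions on \<open>X\<close>
  a finite module over the ring generated by the \<open>l\<^sub>j\<close>, compatibly with degrees. So the functions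
  of degree at most \<open>T\<close> span a space of dimension \<open>O(T\<^sup>c)\<close> with \<open>c\<close> the number of the \<open>l\<^sub>j\<close>, too
  small for the monomials in more than \<open>c\<close> independent functions.\<close>

context
  fixes X :: "('k::field_char_0 ^ 'v::finite) set" and J :: "'j set"
    and l :: "'j \<Rightarrow> 'k ^ 'v \<Rightarrow> 'k" and N :: nat and g :: "'v \<Rightarrow> 'j \<Rightarrow> ('v, 'k) mpoly"
  assumes J: "finite J" and N: "N \<ge> 1"
    and deg: "\<And>i j. j \<in> J \<Longrightarrow> deg_le (N - 1) (g i j)"
    and rel: "\<And>i x. x \<in> X \<Longrightarrow> (x $ i) ^ N = (\<Sum>j\<in>J. l j x * meval x (g i j))"
begin

definition module_index :: "nat \<Rightarrow> (('j \<Rightarrow> nat) \<times> ('v \<Rightarrow> nat)) set" where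
  "module_index T = PiE J (\<lambda>_. {..T}) \<times> PiE UNIV (\<lambda>_. {..<N})"

definition module_elem :: "('j \<Rightarrow> nat) \<times> ('v \<Rightarrow> nat) \<Rightarrow> 'k ^ 'v \<Rightarrow> 'k" where
  "module_elem b x = (\<Prod>j\<in>J. l j x ^ fst b j) * (\<Prod>i\<in>UNIV. (x $ i) ^ snd b i)"

lemma finite_module_index: "finite (module_index T)"
  unfolding module_index_def by (intro finite_cartesian_product finite_PiE J) auto

lemma card_module_index: "card (module_index T) = (T + 1) ^ card J * N ^ CARD('v)"
  unfolding module_index_def by (simp add: card_cartesian_product card_PiE J)

lemma spanned_on_mult_l:
  assumes j: "j \<in> J" and f: "spanned_on X (module_index T) module_elem f"
  shows "spanned_on X (module_index (Suc T)) module_elem (\<lambda>x. l j x * f x)"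
proof -
  obtain u where u: "\<forall>x\<in>X. f x = (\<Sum>b\<in>module_index T. u b * module_elem b x)"
    using f unfolding spanned_on_def by blast
  have "spanned_on X (module_index (Suc T)) module_elem
      (\<lambda>x. \<Sum>b\<in>module_index T. u b * (l j x * module_elem b x))"
  proof (intro spanned_on_sum spanned_on_scale)
    fix b assume b: "b \<in> module_index T"
    let ?b = "((fst b)(j := Suc (fst b j)), snd b)"
    have "?b \<in> module_index (Suc T)"
      using b j by (auto simp: module_index_def PiE_def Pi_def extensional_def le_Suc_eq)
    moreover have "l j x * module_elem b x = module_elem ?b x" for x
    proof -
      have "(\<Prod>j'\<in>J. l j' x ^ fst ?b j') = l j x ^ Suc (fst b j) * (\<Prod>j'\<in>J - {j}. l j' x ^ fst ?b j')"
        by (subst prod.remove[OF J j]) simp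
      also have "(\<Prod>j'\<in>J - {j}. l j' x ^ fst ?b j') = (\<Prod>j'\<in>J - {j}. l j' x ^ fst b j')"
        by (intro prod.cong) auto
      finally have "(\<Prod>j'\<in>J. l j' x ^ fst ?b j') = l j x * (\<Prod>j'\<in>J. l j' x ^ fst b j')"
        using prod.remove[OF J j, of "\<lambda>j'. l j' x ^ fst b j'"] by simp
      then show ?thesis
        by (simp add: module_elem_def)
    qed
    ultimately show "spanned_on X (module_index (Suc T)) module_elem (\<lambda>x. l j x * module_elem b x)"
      by (rule spanned_on_base[OF finite_module_index])
  qed
  then show ?thesis
    by (rule spanned_on_cong) (simp add: u sum_distrib_left mult_ac)
qed

text \<open>While some exponent is at least \<open>N\<close>, the relation replaces
  \<open>x $ i ^ N\<close> by a factor \<open>l j x\<close> times monomials of degree at most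
  \<open>N - 1\<close>. The remaining degree drops by at least one for each factor gained, so at
  most \<open>T\<close> factors appear.\<close>

lemma spanned_on_mono_eval:
  "mdeg a \<le> T \<Longrightarrow> spanned_on X (module_index T) module_elem (\<lambda>x. mono_eval x a)"
proof (induction T arbitrary: a)
  case 0
  then have "Poly_Mapping.lookup a i = 0" for i
    by (simp add: mdeg_def)
  then show ?case
    using N by (intro spanned_on_base[OF finite_module_index, of "(restrict (\<lambda>_. 0) J, \<lambda>_. 0)"])
      (auto simp: module_index_def module_elem_def mono_eval_def)
next
  case (Suc T)
  show ?case
  proof (cases "\<forall>i. Poly_Mapping.lookup a i < N")
    case True
    then show ?thesis
      by (intro spanned_on_base[OF finite_module_index, of "(restrict (\<lambda>_. 0) J, Poly_Mapping.lookup a)"])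
        (auto simp: module_index_def module_elem_def mono_eval_def)
  next
    case False
    then obtain i where i: "N \<le> Poly_Mapping.lookup a i"
      by (auto simp: not_less)
    define a' where "a' = a - Poly_Mapping.single i N"
    have a: "a = Poly_Mapping.single i N + a'"
      using i by (intro poly_mapping_eqI)
        (auto simp: a'_def lookup_add lookup_minus lookup_single when_def)
    have eq: "mono_eval x a = (\<Sum>j\<in>J. \<Sum>b\<in>Poly_Mapping.keys (g i j).
        Poly_Mapping.lookup (g i j) b * (l j x * mono_eval x (b + a')))" if "x \<in> X" for x
      using rel[OF that, of i] that
      by (simp add: a mono_eval_add mono_eval_single_power sum_distrib_right sum_distrib_left meval_def mult_ac)
    have "spanned_on X (module_index (Suc T)) module_elem (\<lambda>x. \<Sum>j\<in>J. \<Sum>b\<in>Poly_Mapping.keys (g i j).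
        Poly_Mapping.lookup (g i j) b * (l j x * mono_eval x (b + a')))"
    proof (intro spanned_on_sum spanned_on_scale spanned_on_mult_l Suc.IH)
      fix j b assume "j \<in> J" "b \<in> Poly_Mapping.keys (g i j)"
      then have "mdeg b \<le> N - 1"
        using deg unfolding deg_le_def by blast
      then show "mdeg (b + a') \<le> T"
        using Suc.prems N by (simp add: a)
    qed
    then show ?thesis
      by (rule spanned_on_cong) (simp add: eq)
  qed
qed

lemma spanned_on_meval:
  assumes "deg_le T p"
  shows "spanned_on X (module_index T) module_elem (\<lambda>x. meval x p)"
  unfolding meval_def
  by (intro spanned_on_sum spanned_on_scale spanned_on_mono_eval) (use assms in \<open>auto simp: deg_le_def\<close>)

theorem alg_indep_card_le:
  assumes I: "finite I" and ind: "alg_indep I y (vanishing X)"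
  shows "card I \<le> card J"
proof (rule ccontr)
  assume "\<not> card I \<le> card J"
  then have less: "Suc (card J) \<le> card I" by simp
  define D where "D i = (SOME d. deg_le d (y i))" for i
  have D: "deg_le (D i) (y i)" for i
    unfolding D_def by (rule someI_ex[OF deg_le_bound])
  define K where "K = (\<Sum>i\<in>I. D i)"
  \<comment> \<open>With this \<open>T\<close> the products that span the functions of degree at
    most \<open>K * T\<close> number at most \<open>T * (T + 1) ^ card J\<close>, fewer than the
    \<open>(T + 1) ^ card I\<close> exponent vectors in \<open>E\<close>.\<close>
  define T where "T = (K + 1) ^ card J * N ^ CARD('v)"
  define E where "E = PiE I (\<lambda>_. {..T})"
  have E: "finite E"
    unfolding E_def by (intro finite_PiE I) auto
  define m where "m e = (\<Prod>i\<in>I. y i ^ e i)" for e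
  have "deg_le (K * T) (m e)" if "e \<in> E" for e
  proof -
    have "deg_le (\<Sum>i\<in>I. e i * D i) (m e)"
      unfolding m_def by (intro deg_le_prod deg_le_power D)
    moreover have "(\<Sum>i\<in>I. e i * D i) \<le> (\<Sum>i\<in>I. T * D i)"
      using that by (intro sum_mono mult_right_mono) (auto simp: E_def)
    ultimately show ?thesis
      unfolding K_def sum_distrib_left[symmetric] by (auto intro: deg_le_mono simp: mult.commute)
  qed
  then have "\<forall>e\<in>E. \<exists>u. \<forall>x\<in>X. meval x (m e) = (\<Sum>b\<in>module_index (K * T). u b * module_elem b x)"
    using spanned_on_meval[unfolded spanned_on_def] by simp
  from bchoice[OF this] obtain u where u: "\<forall>e\<in>E. \<forall>x\<in>X.
      meval x (m e) = (\<Sum>b\<in>module_index (K * T). u e b * module_elem b x)"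
    by (elim exE)
  have "card (module_index (K * T)) \<le> ((K + 1) * (T + 1)) ^ card J * N ^ CARD('v)"
    unfolding card_module_index by (intro mult_right_mono power_mono) (auto simp: algebra_simps)
  also have "\<dots> = ((K + 1) ^ card J * N ^ CARD('v)) * (T + 1) ^ card J"
    by (simp only: power_mult_distrib mult_ac)
  also have "\<dots> = T * (T + 1) ^ card J"
    by (simp only: T_def)
  also have "\<dots> < (T + 1) ^ Suc (card J)"
    by simp
  also have "\<dots> \<le> (T + 1) ^ card I"
    using less by (intro power_increasing) auto
  also have "\<dots> = card E"
    by (simp add: E_def card_PiE I)
  finally have "card (module_index (K * T)) < card E" .
  from homogeneous_system_nontrivial[OF finite_module_index E this, of u]
  obtain c where c: "\<exists>e\<in>E. c e \<noteq> 0" "\<forall>b\<in>module_index (K * T). (\<Sum>e\<in>E. c e * u e b) = 0"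
    by (elim exE conjE)
  have pow: "subst_rel I y (\<lambda>b. b i ^ e i) (y i ^ e i)" if "i \<in> I" for i and e :: "_ \<Rightarrow> nat"
    using subst_rel_power[OF subst_rel.var[OF that]] .
  have prod: "subst_rel I y (\<lambda>b. \<Prod>i\<in>I. b i ^ e i) (m e)" for e
    unfolding m_def using pow by (rule subst_rel_prod[where F = "\<lambda>i b. b i ^ e i"])
  have summand: "subst_rel I y (\<lambda>b. c e * (\<Prod>i\<in>I. b i ^ e i)) (mconst (c e) * m e)" for e
    by (rule subst_rel.mult[where F = "\<lambda>b. c e" and G = "\<lambda>b. \<Prod>i\<in>I. b i ^ e i",
      OF subst_rel.const prod])
  have rel: "subst_rel I y (\<lambda>b. \<Sum>e\<in>E. c e * (\<Prod>i\<in>I. b i ^ e i)) (\<Sum>e\<in>E. mconst (c e) * m e)"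
    by (rule subst_rel_sum[where F = "\<lambda>e b. c e * (\<Prod>i\<in>I. b i ^ e i)" and
      r = "\<lambda>e. mconst (c e) * m e", OF summand])
  have "(\<Sum>e\<in>E. mconst (c e) * m e) \<in> vanishing X"
    unfolding vanishing_def
  proof (intro CollectI ballI)
    fix x assume x: "x \<in> X"
    have "meval x (\<Sum>e\<in>E. mconst (c e) * m e) = (\<Sum>e\<in>E. c e * meval x (m e))"
      by (simp add: meval_sum meval_mult)
    also have "\<dots> = (\<Sum>e\<in>E. \<Sum>b\<in>module_index (K * T). c e * u e b * module_elem b x)"
      using u x by (intro sum.cong) (simp_all add: sum_distrib_left mult.assoc)
    also have "\<dots> = (\<Sum>b\<in>module_index (K * T). (\<Sum>e\<in>E. c e * u e b) * module_elem b x)"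
      unfolding sum_distrib_right by (rule sum.swap)
    also have "\<dots> = 0"
      using c(2) by simp
    finally show "meval x (\<Sum>e\<in>E. mconst (c e) * m e) = 0" .
  qed
  from alg_indepD[OF ind rel this] have "c e = 0" if "e \<in> E" for e
    using that monomial_functions_independent[OF I, of e T c] unfolding E_def by simp
  then show False
    using c(1) by blast
qed

end

section \<open>Linear sections of cones\<close>

definition hom_part :: "nat \<Rightarrow> ('v::finite, 'k::comm_ring_1) mpoly \<Rightarrow> ('v, 'k) mpoly" where
  "hom_part d p = (\<Sum>a\<in>{a\<in>Poly_Mapping.keys p. mdeg a = d}.
     Poly_Mapping.single a (Poly_Mapping.lookup p a))"

lemma deg_le_hom_part: "deg_le d (hom_part d p)"
proof -
  have "Poly_Mapping.keys (hom_part d p) \<subseteq> {a. mdeg a = d}"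
    unfolding hom_part_def
    by (auto simp: in_keys_iff lookup_sum lookup_single when_def split: if_splits
        elim!: sum.not_neutral_contains_not_neutral)
  then show ?thesis
    by (auto simp: deg_le_def)
qed

lemma mono_eval_scale: "mono_eval (s *s x) a = s ^ mdeg a * mono_eval x a"
  by (simp add: mono_eval_def mdeg_def power_mult_distrib prod.distrib power_sum)

text \<open>On a cone a relation holds at all multiples \<open>s *s x\<close>; this lets it be
  compared power by power in \<open>s\<close>, that is, degree by degree.\<close>

lemma meval_scale_poly:
  "\<exists>q. (\<forall>s. meval (s *s x) p = poly q s) \<and> (\<forall>d. coeff q d = meval x (hom_part d p))"
proof (intro exI[of _ "\<Sum>a\<in>Poly_Mapping.keys p. monom (Poly_Mapping.lookup p a * mono_eval x a) (mdeg a)"]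
    conjI allI)
  show "meval (s *s x) p =
      poly (\<Sum>a\<in>Poly_Mapping.keys p. monom (Poly_Mapping.lookup p a * mono_eval x a) (mdeg a)) s" for s
    by (simp add: meval_def poly_sum poly_monom mono_eval_scale mult_ac)
  show "coeff (\<Sum>a\<in>Poly_Mapping.keys p. monom (Poly_Mapping.lookup p a * mono_eval x a) (mdeg a)) d =
      meval x (hom_part d p)" for d
    by (simp add: coeff_sum hom_part_def meval_sum sum.If_cases Int_def)
qed

definition is_cone :: "('k::comm_ring_1 ^ 'v::finite) set \<Rightarrow> bool" where
  "is_cone X \<longleftrightarrow> (\<forall>x\<in>X. \<forall>s. s *s x \<in> X)"

definition linear_poly :: "('k::field ^ 'v::finite \<Rightarrow> 'k) \<Rightarrow> ('v, 'k) mpoly" where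
  "linear_poly l = (\<Sum>i\<in>UNIV. mconst (l (axis i 1)) * mvar i)"

lemma meval_linear_poly:
  assumes "\<And>x y. l (x + y) = l x + l y" "\<And>s x. l (s *s x) = s * l x"
  shows "meval x (linear_poly l) = l x"
proof -
  have "l 0 = 0"
    using assms(2)[of 0 0] by simp
  then have sum: "l (sum f S) = (\<Sum>i\<in>S. l (f i))" for f :: "'b \<Rightarrow> _" and S
    by (induction S rule: infinite_finite_induct) (simp_all add: assms)
  have "l x = l (\<Sum>i\<in>UNIV. x $ i *s axis i 1)"
    by (simp add: basis_expansion)
  also have "\<dots> = meval x (linear_poly l)"
    by (simp add: sum assms linear_poly_def meval_sum meval_mult mult.commute)
  finally show ?thesis by simp
qed

text \<open>The vectors that complete \<open>B\<close> to a basis index the functionals as well: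
  \<open>l c\<close> is the coordinate along \<open>c\<close>. The last clause allows a vector with
  prescribed coordinates to be written down.\<close>

lemma exists_complementary_functionals:
  fixes B :: "('k::field ^ 'v::finite) set"
  assumes B: "vec.independent B"
  shows "\<exists>C l. finite C \<and> card C + card B = CARD('v) \<and>
    (\<forall>c\<in>C. \<forall>x y. l c (x + y) = l c x + l c y) \<and> (\<forall>c\<in>C. \<forall>s x. l c (s *s x) = s * l c x) \<and>
    (\<forall>x. (\<forall>c\<in>C. l c x = 0) \<longleftrightarrow> x \<in> vec.span B) \<and>
    (\<forall>c\<in>C. \<forall>c'\<in>C. l c (c' :: 'k ^ 'v) = (if c = c' then 1 else 0))"
proof -
  define E where "E = vec.extend_basis B"
  have E: "vec.independent E" "vec.span E = UNIV" "B \<subseteq> E"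
    using vec.independent_extend_basis[OF B] vec.span_extend_basis[OF B]
      vec.extend_basis_superset[OF B] by (simp_all add: E_def)
  have fin: "finite E"
    by (rule vec.finiteI_independent[OF E(1)])
  have card: "card E = CARD('v)"
    using vec.dim_eq_card[of E UNIV] E(1,2) by (simp add: card_cart_basis)
  define l where "l c x = vec.representation E x c" for c x
  let ?C = "E - B"
  have "card ?C + card B = CARD('v)"
    using card E(3) fin card_mono[OF fin E(3)] by (simp add: card_Diff_subset finite_subset)
  moreover have "l c (x + y) = l c x + l c y" "l c (s *s x) = s * l c x" for c x y s
    using vec.representation_add[OF E(1)] vec.representation_scale[OF E(1)] by (simp_all add: l_def E)
  moreover have "x \<in> vec.span B" if "\<forall>c\<in>?C. l c x = 0" for x
  proof -
    have "x = (\<Sum>b | vec.representation E x b \<noteq> 0. vec.representation E x b *s b)"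
      using vec.sum_nonzero_representation_eq[OF E(1), of x] by (simp add: E)
    also have "\<dots> \<in> vec.span B"
    proof (intro vec.span_sum vec.span_scale)
      fix b assume "b \<in> {b. vec.representation E x b \<noteq> 0}"
      then have "vec.representation E x b \<noteq> 0" by simp
      then have "b \<in> E"
        by (rule vec.representation_ne_zero)
      then have "b \<in> B"
        using that \<open>vec.representation E x b \<noteq> 0\<close> by (auto simp: l_def)
      then show "b \<in> vec.span B"
        by (rule vec.span_base)
    qed
    finally show ?thesis .
  qed
  moreover have "l c x = 0" if "c \<in> ?C" "x \<in> vec.span B" for c x
  proof -
    have "vec.representation E x = vec.representation B x"
      by (rule vec.representation_extend[OF E(1) that(2) E(3)])
    then show ?thesis
      using vec.representation_ne_zero[of B x c] that(1) by (auto simp: l_def)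
  qed
  moreover have "l c c' = (if c = c' then 1 else 0)" if "c' \<in> ?C" for c c'
    using vec.representation_basis[OF E(1), of c'] that by (auto simp: l_def)
  ultimately show ?thesis
    using fin by (intro exI[of _ ?C] exI[of _ l]) auto
qed

text \<open>By the Nullstellensatz, powers of the coordinates lie in the ideal generated by the
  equations of the cone and of \<open>span B\<close>; taking homogeneous parts gives the degree bound that
  the counting argument needs.\<close>

theorem cone_section_card_le:
  fixes X :: "('k::{alg_closed_field, field_char_0} ^ 'v::finite) set"
  assumes X: "zariski_closed X" "is_cone X" and B: "vec.independent B" "vec.span B \<inter> X \<subseteq> {0}"
    and I: "finite I" "alg_indep I y (vanishing X)"
  shows "card I + card B \<le> CARD('v)"
proof -
  obtain C :: "('k ^ 'v) set" and l where C: "finite C" "card C + card B = CARD('v)"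
    and add: "\<forall>c\<in>C. \<forall>x y. l c (x + y) = l c x + l c y"
    and scale: "\<forall>c\<in>C. \<forall>s x. l c (s *s x) = s * l c x"
    and ker: "\<forall>x. (\<forall>c\<in>C. l c x = 0) \<longleftrightarrow> x \<in> vec.span B"
    using exists_complementary_functionals[OF B(1)] by (elim exE conjE)
  define L where "L c = linear_poly (l c)" for c
  have L: "meval x (L c) = l c x" if "c \<in> C" for x c
    unfolding L_def using add scale that by (intro meval_linear_poly) auto
  \<comment> \<open>The ideal of the equations of \<open>X\<close> and the forms \<open>L c\<close>.
    Its zeros lie in \<open>X\<close> and in \<open>vec.span B\<close>, so the origin is the only
    possible one.\<close>
  define K where "K = {p + (\<Sum>c\<in>C. h c * L c) | p h. p \<in> vanishing X}"
  note V = vanishing_ideal[of X]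
  have K: "ring_ideal K"
    unfolding ring_ideal_def
  proof (intro conjI ballI allI)
    show "0 \<in> K"
      unfolding K_def using ring_ideal_0[OF V]
      by (intro CollectI exI[of _ 0] exI[of _ "\<lambda>_. 0"]) simp
  next
    fix a b assume "a \<in> K" "b \<in> K"
    then obtain p h q h' where "a = p + (\<Sum>c\<in>C. h c * L c)" "b = q + (\<Sum>c\<in>C. h' c * L c)"
      "p \<in> vanishing X" "q \<in> vanishing X"
      unfolding K_def by blast
    then have "a + b = (p + q) + (\<Sum>c\<in>C. (h c + h' c) * L c)" "p + q \<in> vanishing X"
      using ring_ideal_add[OF V] by (auto simp: distrib_right sum.distrib)
    then show "a + b \<in> K"
      unfolding K_def by (intro CollectI exI conjI)
  next
    fix a r assume "a \<in> K"
    then obtain p h where "a = p + (\<Sum>c\<in>C. h c * L c)" "p \<in> vanishing X"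
      unfolding K_def by blast
    then have "r * a = r * p + (\<Sum>c\<in>C. (r * h c) * L c)" "r * p \<in> vanishing X"
      using ring_ideal_mult[OF V] by (auto simp: distrib_left sum_distrib_left mult.assoc)
    then show "r * a \<in> K"
      unfolding K_def by (intro CollectI exI conjI)
  qed
  have "vanishing X \<subseteq> K"
  proof
    fix p assume "p \<in> vanishing X"
    moreover have "p = p + (\<Sum>c\<in>C. 0 * L c)" by simp
    ultimately show "p \<in> K"
      unfolding K_def by (intro CollectI exI conjI)
  qed
  have LK: "L c \<in> K" if "c \<in> C" for c
  proof -
    have "L c = 0 + (\<Sum>c'\<in>C. (if c' = c then 1 else 0) * L c')"
      using that C(1) by (simp add: if_distrib[of "\<lambda>a. a * _"] cong: if_cong)
    then show ?thesis
      unfolding K_def using ring_ideal_0[OF V] by (intro CollectI exI conjI)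
  qed
  \<comment> \<open>Otherwise a prime over \<open>K\<close> avoids all powers of
    \<open>mvar i\<close>, and the Nullstellensatz gives a zero of \<open>K\<close> with nonzero
    coordinate \<open>i\<close>.\<close>
  have "\<exists>n. mvar i ^ n \<in> K" for i
  proof (rule ccontr)
    assume n: "\<nexists>n. mvar i ^ n \<in> K"
    define S where "S = range (\<lambda>n. mvar i ^ n :: ('v, 'k) mpoly)"
    have "1 \<in> S"
      unfolding S_def by (rule range_eqI[of _ _ 0]) simp
    moreover have "a * b \<in> S" if "a \<in> S" "b \<in> S" for a b
      using that unfolding S_def by (auto simp: power_add[symmetric])
    moreover have "K \<inter> S = {}"
      using n by (auto simp: S_def)
    ultimately obtain P where P: "prime_ring_ideal P" "K \<subseteq> P" "P \<inter> S = {}"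
      using exists_prime_avoiding[OF K] by metis
    have "mvar i \<in> S"
      unfolding S_def by (rule range_eqI[of _ _ 1]) simp
    then have "mvar i \<notin> P"
      using P(3) by blast
    from nullstellensatz_prime[OF P(1) this] obtain x where x: "x \<in> zero_locus P" "x $ i \<noteq> 0"
      by auto
    have "x \<in> zero_locus (vanishing X)"
      using x(1) P(2) \<open>vanishing X \<subseteq> K\<close> by (auto simp: zero_locus_def)
    then have "x \<in> X"
      using zero_locus_vanishing[OF X(1)] by simp
    moreover have "l c x = 0" if "c \<in> C" for c
      using x(1) P(2) LK[OF that] L[OF that, of x] by (auto simp: zero_locus_def)
    ultimately have "x = 0"
      using ker B(2) by blast
    then show False
      using x(2) by simp
  qed
  then obtain n where n: "\<And>i. mvar i ^ n i \<in> K"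
    by metis
  define N where "N = Suc (\<Sum>i\<in>UNIV. n i)"
  have "mvar i ^ N \<in> K" for i
  proof -
    have "n i \<le> N"
      unfolding N_def using member_le_sum[of i UNIV n] by simp
    then have "mvar i ^ N = mvar i ^ (N - n i) * (mvar i ^ n i :: ('v, 'k) mpoly)"
      by (simp add: power_add[symmetric])
    then show ?thesis
      using ring_ideal_mult[OF K n] by metis
  qed
  then have "\<forall>i. \<exists>h. \<exists>p\<in>vanishing X. mvar i ^ N = p + (\<Sum>c\<in>C. h c * L c)"
    unfolding K_def by blast
  from choice[OF this] obtain h where h: "\<forall>i. \<exists>p\<in>vanishing X. mvar i ^ N = p + (\<Sum>c\<in>C. h i c * L c)"
    by (elim exE)
  have pow: "(x $ i) ^ N = (\<Sum>c\<in>C. l c x * meval x (h i c))" if "x \<in> X" for x i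
  proof -
    obtain p where p: "p \<in> vanishing X" "mvar i ^ N = p + (\<Sum>c\<in>C. h i c * L c)"
      using h by blast
    have "(x $ i) ^ N = meval x (mvar i ^ N)"
      by (simp add: meval_power)
    also have "\<dots> = meval x p + (\<Sum>c\<in>C. l c x * meval x (h i c))"
      unfolding p(2) by (simp add: meval_add meval_sum meval_mult L mult.commute)
    finally show ?thesis
      using p(1) that by (simp add: vanishing_def)
  qed
  \<comment> \<open>Compare the coefficients of \<open>s ^ N\<close> in \<open>pow\<close> at
    \<open>s *s x\<close>: each \<open>l c\<close> contributes one factor \<open>s\<close>, so only
    the part of \<open>h i c\<close> of degree \<open>N - 1\<close> survives.\<close>
  have hom: "(x $ i) ^ N = (\<Sum>c\<in>C. l c x * meval x (hom_part (N - 1) (h i c)))" if x: "x \<in> X" for x i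
  proof -
    have "\<forall>c. \<exists>q. (\<forall>s. meval (s *s x) (h i c) = poly q s) \<and>
        (\<forall>d. coeff q d = meval x (hom_part d (h i c)))"
      using meval_scale_poly by blast
    from choice[OF this] obtain q where q: "\<And>c s. meval (s *s x) (h i c) = poly (q c) s"
        "\<And>c d. coeff (q c) d = meval x (hom_part d (h i c))"
      by blast
    have "poly (monom ((x $ i) ^ N) N) s = poly (\<Sum>c\<in>C. smult (l c x) (pCons 0 (q c))) s" for s
    proof -
      have "s *s x \<in> X"
        using X(2) x by (simp add: is_cone_def)
      from pow[OF this, of i] have "(s * x $ i) ^ N = (\<Sum>c\<in>C. l c (s *s x) * poly (q c) s)"
        by (simp add: q)
      also have "\<dots> = (\<Sum>c\<in>C. s * l c x * poly (q c) s)"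
        using scale by (intro sum.cong) auto
      finally show ?thesis
        by (simp add: poly_monom poly_sum power_mult_distrib mult_ac)
    qed
    then have "monom ((x $ i) ^ N) N = (\<Sum>c\<in>C. smult (l c x) (pCons 0 (q c)))"
      using poly_eq_poly_eq_iff by blast
    from arg_cong[OF this, of "\<lambda>p. coeff p N"] show ?thesis
      by (simp add: coeff_sum N_def q(2))
  qed
  have "card I \<le> card C"
    by (rule alg_indep_card_le[OF C(1) _ deg_le_hom_part hom I]) (simp add: N_def)
  then show ?thesis
    using C(2) by simp
qed

text \<open>Take \<open>B\<close> as large as possible. A relation on \<open>X\<close> between complementary coordinate functionals
  splits into homogeneous relations, so \<open>span B\<close> could be enlarged by a direction on which such a
  relation does not vanish.\<close>

lemma cone_exists_complementary_alg_indep: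
  fixes X :: "('k::{alg_closed_field, field_char_0} ^ 'v::finite) set"
  assumes X: "is_cone X" "0 \<in> X"
  shows "\<exists>B C y. vec.independent B \<and> vec.span B \<inter> X \<subseteq> {0} \<and> finite (C :: ('k ^ 'v) set) \<and>
    card C + card B = CARD('v) \<and> alg_indep C y (vanishing X)"
proof -
  define \<B> where "\<B> B \<longleftrightarrow> vec.independent B \<and> vec.span B \<inter> X \<subseteq> {0}" for B
  have "\<B> {}"
    by (simp add: \<B>_def vec.independent_empty)
  moreover have "card B \<le> CARD('v)" if "\<B> B" for B
    using vec.independent_card_le_dim[of B UNIV] that by (simp add: \<B>_def card_cart_basis)
  ultimately have "\<exists>B. \<B> B \<and> (\<forall>B'. \<B> B' \<longrightarrow> card B' \<le> card B)"
    by (intro ex_has_greatest_nat[of \<B> "{}" card "Suc CARD('v)"]) (auto simp: less_Suc_eq_le)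
  then obtain B where B: "\<B> B" and max: "\<And>B'. \<B> B' \<Longrightarrow> card B' \<le> card B"
    by blast
  have ind: "vec.independent B" and BX: "vec.span B \<inter> X \<subseteq> {0}"
    using B by (simp_all add: \<B>_def)
  obtain C :: "('k ^ 'v) set" and l where C: "finite C" "card C + card B = CARD('v)"
    and add: "\<forall>c\<in>C. \<forall>x y. l c (x + y) = l c x + l c y"
    and scale: "\<forall>c\<in>C. \<forall>s x. l c (s *s x) = s * l c x"
    and ker: "\<forall>x. (\<forall>c\<in>C. l c x = 0) \<longleftrightarrow> x \<in> vec.span B"
    and dual: "\<forall>c\<in>C. \<forall>c'\<in>C. l c c' = (if c = c' then 1 else 0)"
    using exists_complementary_functionals[OF ind] by (elim exE conjE)
  define y where "y c = linear_poly (l c)" for c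
  have y: "meval x (y c) = l c x" if "c \<in> C" for x c
    unfolding y_def using add scale that by (intro meval_linear_poly) auto
  have "alg_indep C y (vanishing X)"
    unfolding alg_indep_def
  proof (intro allI impI, rule ccontr)
    fix F r b assume F: "subst_rel C y F r" "r \<in> vanishing X" "F b \<noteq> 0"
    have FX: "F (\<lambda>c. l c x) = 0" if "x \<in> X" for x
    proof -
      have "F (\<lambda>c. l c x) = F (\<lambda>c. meval x (y c))"
        by (rule subst_rel_cong[OF F(1)]) (simp add: y)
      also have "\<dots> = 0"
        using F(2) that by (simp add: subst_rel_meval[OF F(1), symmetric] vanishing_def)
      finally show ?thesis .
    qed
    obtain \<Phi> where \<Phi>: "\<And>t. F (\<lambda>c. 0 + t * b c) = poly \<Phi> t"
      using subst_rel_line[OF F(1), of "\<lambda>_. 0" b] by (elim exE) simp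
    have "\<Phi> \<noteq> 0"
      using \<Phi>[of 1] F(3) by auto
    \<comment> \<open>The functionals take the values \<open>b c\<close> at this point, so
      \<open>F\<close> is nonzero there; \<open>q\<close> is the direction by which \<open>B\<close>
      will be enlarged.\<close>
    define q where "q = (\<Sum>c\<in>C. b c *s c)"
    have lq: "l c q = b c" if "c \<in> C" for c
    proof -
      have "l c 0 = 0"
        using scale[rule_format, OF that, of 0 0] by simp
      then have sum: "l c (sum f S) = (\<Sum>i\<in>S. l c (f i))" for f :: "'k ^ 'v \<Rightarrow> _" and S
        by (induction S rule: infinite_finite_induct) (simp_all add: add that)
      have "l c q = (\<Sum>c'\<in>C. b c' * (if c = c' then 1 else 0))"
        unfolding q_def sum using scale dual that by (intro sum.cong) auto
      also have "\<dots> = b c"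
        using C(1) that by (simp add: if_distrib[of "\<lambda>a. _ * a"] cong: if_cong)
      finally show ?thesis .
    qed
    have "q \<notin> vec.span B"
    proof
      assume "q \<in> vec.span B"
      then have "b c = 0" if "c \<in> C" for c
        using ker[rule_format, of q] lq[OF that] that by simp
      then have "F b = F (\<lambda>c. l c 0)"
        using scale by (intro subst_rel_cong[OF F(1)]) (metis mult_zero_left vec.scale_zero_left)
      then show False
        using FX[OF X(2)] F(3) by simp
    qed
    then have "vec.independent (insert q B)"
      using ind by (rule vec.independent_insertI)
    moreover have "x = 0" if x: "x \<in> vec.span (insert q B)" "x \<in> X" for x
    proof -
      obtain s where s: "x - s *s q \<in> vec.span B"
        using x(1) by (auto simp: vec.span_breakdown_eq)
      have lx: "l c x = s * b c" if "c \<in> C" for c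
      proof -
        have "l c ((x - s *s q) + s *s q) = l c (x - s *s q) + s * l c q"
          using add scale that by metis
        then show ?thesis
          using s ker[rule_format, of "x - s *s q"] that lq by simp
      qed
      \<comment> \<open>All multiples of \<open>x\<close> lie in \<open>X\<close>, so
        \<open>F\<close> vanishes at \<open>t * s\<close> times \<open>b\<close> for every
        \<open>t\<close>. As \<Phi> is not zero, this forces \<open>s = 0\<close>.\<close>
      have "poly (pcompose \<Phi> [:0, s:]) t = 0" for t
      proof -
        have "poly (pcompose \<Phi> [:0, s:]) t = F (\<lambda>c. 0 + (t * s) * b c)"
          unfolding \<Phi> by (simp add: poly_pcompose)
        also have "\<dots> = F (\<lambda>c. l c (t *s x))"
          using scale lx by (intro subst_rel_cong[OF F(1)]) auto
        also have "\<dots> = 0"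
          using X(1) x(2) by (intro FX) (auto simp: is_cone_def)
        finally show ?thesis .
      qed
      then have "pcompose \<Phi> [:0, s:] = 0"
        using poly_all_0_iff_0 by blast
      moreover obtain j where "coeff \<Phi> j \<noteq> 0"
        using \<open>\<Phi> \<noteq> 0\<close> by (auto simp: poly_eq_iff)
      ultimately have "s ^ j = 0"
        using coeff_pcompose_linear[of \<Phi> s j] by simp
      then have "s = 0"
        by simp
      then show ?thesis
        using s x(2) BX by auto
    qed
    ultimately have "\<B> (insert q B)"
      unfolding \<B>_def by blast
    then have "card (insert q B) \<le> card B"
      by (rule max)
    then show False
      using \<open>q \<notin> vec.span B\<close> vec.span_base vec.finiteI_independent[OF ind]
      by (metis card_insert_disjoint not_less_eq_eq order_refl)
  qed
  then show ?thesis
    using ind BX C by (intro exI conjI)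
qed

section \<open>Singular points of determinantal hypersurfaces\<close>

lemma mono_eval_split:
  "mono_eval x a = (x $ i) ^ Poly_Mapping.lookup a i * (\<Prod>j\<in>UNIV - {i}. (x $ j) ^ Poly_Mapping.lookup a j)"
  unfolding mono_eval_def by (rule prod.remove) auto

lemma meval_pdiff:
  "meval x (pdiff i p) = (\<Sum>a\<in>Poly_Mapping.keys p. Poly_Mapping.lookup p a *
    (of_nat (Poly_Mapping.lookup a i) * mono_eval x (a - Poly_Mapping.single i 1)))"
  unfolding pdiff_def meval_sum by (intro sum.cong) (auto simp: mult_ac)

text \<open>The chain rule for formal partial derivatives. It turns singularity into a double zero
  along every line, with no expansion of the partial derivatives of a determinant.\<close>

lemma meval_on_line:
  fixes p :: "('v::finite, 'k::field_char_0) mpoly"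
  shows "\<exists>q. (\<forall>t. meval (x + t *s v) p = poly q t) \<and>
    poly (pderiv q) 0 = (\<Sum>i\<in>UNIV. v $ i * meval x (pdiff i p))"
proof -
  define m where "m a = (\<Prod>i\<in>UNIV. [:x $ i, v $ i:] ^ Poly_Mapping.lookup a i)" for a :: "'v \<Rightarrow>\<^sub>0 nat"
  define q where "q = (\<Sum>a\<in>Poly_Mapping.keys p. smult (Poly_Mapping.lookup p a) (m a))"
  have m: "poly (pderiv (m a)) 0 = (\<Sum>i\<in>UNIV. v $ i *
      (of_nat (Poly_Mapping.lookup a i) * mono_eval x (a - Poly_Mapping.single i 1)))" for a
  proof -
    have "poly (prod (\<lambda>j. [:x $ j, v $ j:] ^ Poly_Mapping.lookup a j) (UNIV - {i}) *
        pderiv ([:x $ i, v $ i:] ^ Poly_Mapping.lookup a i)) 0 =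
        v $ i * (of_nat (Poly_Mapping.lookup a i) * mono_eval x (a - Poly_Mapping.single i 1))" for i
    proof -
      have "(\<Prod>j\<in>UNIV - {i}. (x $ j) ^ Poly_Mapping.lookup (a - Poly_Mapping.single i 1) j) =
          (\<Prod>j\<in>UNIV - {i}. (x $ j) ^ Poly_Mapping.lookup a j)"
        by (intro prod.cong) (auto simp: lookup_minus lookup_single when_def)
      then show ?thesis
        by (simp add: mono_eval_split[of x _ i] poly_prod pderiv_power pderiv_pCons lookup_minus mult_ac)
    qed
    then show ?thesis
      by (simp add: m_def pderiv_prod poly_sum)
  qed
  have "meval (x + t *s v) p = poly q t" for t
    by (simp add: q_def m_def poly_sum poly_prod meval_def mono_eval_def)
  moreover have "pderiv (\<Sum>a\<in>S. f a) = (\<Sum>a\<in>S. pderiv (f a))" for S and f :: "('v \<Rightarrow>\<^sub>0 nat) \<Rightarrow> 'k poly"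
    by (induction S rule: infinite_finite_induct) (auto simp: pderiv_add)
  then have "poly (pderiv q) 0 = (\<Sum>i\<in>UNIV. v $ i * meval x (pdiff i p))"
    by (simp add: q_def poly_sum pderiv_smult m meval_pdiff sum_distrib_left sum.swap[of _ UNIV] mult_ac)
  ultimately show ?thesis
    by blast
qed

lemma poly_double_zero_iff:
  fixes q :: "'k::field poly"
  shows "poly q 0 = 0 \<and> poly (pderiv q) 0 = 0 \<longleftrightarrow> (\<exists>r. q = [:0, 0, 1:] * r)"
proof
  assume q: "poly q 0 = 0 \<and> poly (pderiv q) 0 = 0"
  obtain c q' where q': "q = pCons c q'" by (cases q)
  then have "c = 0" "poly q' 0 = 0"
    using q by (simp_all add: pderiv_pCons)
  then obtain r where "q' = pCons 0 r"
    by (cases q') auto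
  then show "\<exists>r. q = [:0, 0, 1:] * r"
    using q' \<open>c = 0\<close> by (intro exI[of _ r]) simp
qed (auto simp: pderiv_mult pderiv_pCons)

text \<open>The determinant vanishes to order at least two at \<open>t = 0\<close> on the line
  through \<open>A\<close> in direction \<open>B\<close>. Divisibility by \<open>t ^ 2\<close> is
  the form that row operations deliver.\<close>

definition crit_dir :: "'k::field ^ 'm::finite ^ 'm \<Rightarrow> 'k ^ 'm ^ 'm \<Rightarrow> bool" where
  "crit_dir A B \<longleftrightarrow> (\<exists>r. \<forall>t. det (\<chi> i j. A $ i $ j + t * B $ i $ j) = t ^ 2 * poly r t)"

lemma det_affine_poly:
  fixes A B :: "'k::comm_ring_1 ^ 'm::finite ^ 'm"
  shows "\<exists>r. \<forall>t. det (\<chi> i j. A $ i $ j + t * B $ i $ j) = poly r t"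
  by (intro exI[of _ "det (\<chi> i j. [:A $ i $ j, B $ i $ j:])"])
    (simp add: det_def poly_sum poly_prod)

lemma linear_maps_line:
  assumes "L \<in> linear_maps"
  shows "L (x + t *s v) = (\<chi> i j. L x $ i $ j + t * L v $ i $ j)"
proof -
  interpret Vector_Spaces.linear "(*s)" matrix_scale L
    using assms by (simp add: linear_maps_def)
  show ?thesis
    by (simp add: add scale vec_eq_iff matrix_scale_def)
qed

lemma linear_maps_scale:
  assumes "L \<in> linear_maps"
  shows "L (s *s x) = (\<chi> i j. s * L x $ i $ j)"
proof -
  interpret Vector_Spaces.linear "(*s)" matrix_scale L
    using assms by (simp add: linear_maps_def)
  show ?thesis
    by (simp add: scale vec_eq_iff matrix_scale_def)
qed

lemma mem_Sing_iff: "x \<in> Sing f \<longleftrightarrow> meval x f = 0 \<and> (\<forall>i. meval x (pdiff i f) = 0)"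
  by (auto simp: Sing_def zero_locus_def)

text \<open>Only the directions \<open>L v\<close> are tested. For the generic determinant every
  direction is tested, so \<open>x\<close> is singular for \<open>det_poly L\<close> whenever
  \<open>L x\<close> is a singular point of the generic determinant.\<close>

lemma mem_Sing_det_poly_iff:
  fixes L :: "'k::field_char_0 ^ 'n::finite \<Rightarrow> 'k ^ 'm::finite ^ 'm"
  assumes L: "L \<in> linear_maps"
  shows "x \<in> Sing (det_poly L) \<longleftrightarrow> (\<forall>v. crit_dir (L x) (L v))"
proof -
  have line: "\<exists>q. (\<forall>t. det (\<chi> i j. L x $ i $ j + t * L v $ i $ j) = poly q t) \<and>
      poly (pderiv q) 0 = (\<Sum>i\<in>UNIV. v $ i * meval x (pdiff i (det_poly L)))" for v
    using meval_on_line[of x v "det_poly L"]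
    by (simp only: meval_det_poly[OF L] linear_maps_line[OF L])
  show ?thesis
  proof
    assume x: "x \<in> Sing (det_poly L)"
    show "\<forall>v. crit_dir (L x) (L v)"
    proof
      fix v
      obtain q where q: "\<forall>t. det (\<chi> i j. L x $ i $ j + t * L v $ i $ j) = poly q t"
        "poly (pderiv q) 0 = (\<Sum>i\<in>UNIV. v $ i * meval x (pdiff i (det_poly L)))"
        using line by blast
      have "poly q 0 = 0"
        using q(1)[rule_format, of 0] x by (simp add: mem_Sing_iff meval_det_poly[OF L])
      moreover have "poly (pderiv q) 0 = 0"
        using x by (simp add: q(2) mem_Sing_iff)
      ultimately obtain r where "q = [:0, 0, 1:] * r"
        using poly_double_zero_iff by blast
      then show "crit_dir (L x) (L v)"
        unfolding crit_dir_def using q(1) by (intro exI[of _ r]) (simp add: power2_eq_square mult_ac)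
    qed
  next
    assume v: "\<forall>v. crit_dir (L x) (L v)"
    have *: "det (L x) = 0 \<and> (\<Sum>i\<in>UNIV. v $ i * meval x (pdiff i (det_poly L))) = 0" for v
    proof -
      obtain q where q: "\<forall>t. det (\<chi> i j. L x $ i $ j + t * L v $ i $ j) = poly q t"
        "poly (pderiv q) 0 = (\<Sum>i\<in>UNIV. v $ i * meval x (pdiff i (det_poly L)))"
        using line by blast
      obtain r where "\<forall>t. det (\<chi> i j. L x $ i $ j + t * L v $ i $ j) = t ^ 2 * poly r t"
        using v unfolding crit_dir_def by blast
      then have "poly q = poly ([:0, 0, 1:] * r)"
        using q(1) by (intro ext) (simp add: power2_eq_square mult_ac)
      then have "q = [:0, 0, 1:] * r"
        by (simp only: poly_eq_poly_eq_iff)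
      then have "poly q 0 = 0 \<and> poly (pderiv q) 0 = 0"
        using poly_double_zero_iff by blast
      then show ?thesis
        using q(1)[rule_format, of 0] q(2) by simp
    qed
    have "meval x (pdiff l (det_poly L)) = 0" for l
    proof -
      have "(\<Sum>i\<in>UNIV. axis l 1 $ i * meval x (pdiff i (det_poly L))) =
          (\<Sum>i\<in>UNIV. if i = l then meval x (pdiff i (det_poly L)) else 0)"
        by (intro sum.cong) (auto simp: axis_def)
      then show ?thesis
        using *[of "axis l 1"] by simp
    qed
    then show "x \<in> Sing (det_poly L)"
      using * by (simp add: mem_Sing_iff meval_det_poly[OF L])
  qed
qed

section \<open>Matrices at which the determinant vanishes to second order\<close>

lemma det_scale:
  fixes A :: "'k::comm_ring_1 ^ 'm::finite ^ 'm"
  shows "det (\<chi> i j. s * A $ i $ j) = s ^ CARD('m) * det A"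
proof -
  have "(\<chi> i j. s * A $ i $ j) = (\<chi> i. s *s A $ i)"
    by (simp add: vec_eq_iff)
  then show ?thesis
    using det_rows_mul[of "\<lambda>_. s" "\<lambda>i. A $ i"] by simp
qed

text \<open>For nonzero \<open>s\<close> substitute \<open>t / s\<close>. At \<open>s = 0\<close>
  the determinant is \<open>t ^ CARD('m) * det B\<close>, divisible by \<open>t ^ 2\<close> for at
  least two rows.\<close>

lemma crit_dir_scale:
  fixes A B :: "'k::field ^ 'm::finite ^ 'm"
  assumes m: "CARD('m) \<ge> 2" and AB: "crit_dir A B"
  shows "crit_dir (\<chi> i j. s * A $ i $ j) B"
proof (cases "s = 0")
  case True
  have "t ^ CARD('m) = t ^ 2 * t ^ (CARD('m) - 2)" for t :: 'k
    by (simp only: power_add[symmetric] le_add_diff_inverse[OF m])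
  then have "t ^ CARD('m) * det B = t ^ 2 * poly (monom (det B) (CARD('m) - 2)) t" for t
    by (simp add: poly_monom mult_ac)
  then show ?thesis
    unfolding crit_dir_def using True
    by (intro exI[of _ "monom (det B) (CARD('m) - 2)"]) (simp add: det_scale)
next
  case False
  obtain r where r: "\<And>t. det (\<chi> i j. A $ i $ j + t * B $ i $ j) = t ^ 2 * poly r t"
    using AB unfolding crit_dir_def by blast
  have "det (\<chi> i j. (\<chi> i j. s * A $ i $ j) $ i $ j + t * B $ i $ j) =
      t ^ 2 * poly (smult (s ^ CARD('m) / s ^ 2) (pcompose r [:0, 1 / s:])) t" for t
  proof -
    have "(\<chi> i j. (\<chi> i j. s * A $ i $ j) $ i $ j + t * B $ i $ j) =
        (\<chi> i j. s * (\<chi> i j. A $ i $ j + (t / s) * B $ i $ j) $ i $ j)"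
      using False by (simp add: vec_eq_iff distrib_left)
    then show ?thesis
      by (simp only: det_scale r) (simp add: poly_pcompose power_divide)
  qed
  then show ?thesis
    unfolding crit_dir_def by blast
qed

lemma det_subtract_rows:
  fixes C :: "'k::field ^ 'm::finite ^ 'm"
  assumes "a \<notin> S"
  shows "det (\<chi> i. if i = a then C $ a - (\<Sum>s\<in>S. u s *s C $ s) else C $ i) = det C"
proof -
  have row: "row i C = C $ i" for i
    by (simp add: row_def vec_eq_iff)
  have "- (\<Sum>s\<in>S. u s *s C $ s) \<in> vec.span {row j C |j. j \<noteq> a}"
    using assms by (intro vec.span_neg vec.span_sum vec.span_scale vec.span_base) (auto simp: row)
  then show ?thesis
    using det_row_span[of "- (\<Sum>s\<in>S. u s *s C $ s)" C a]
    unfolding row diff_conv_add_uminus by simp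
qed

text \<open>Subtracting the given combinations of the rows in \<open>S\<close> from rows
  \<open>a\<close> and \<open>b\<close> of \<open>A + t B\<close> cancels the constant terms of
  these two rows, and each then contributes a factor \<open>t\<close>.\<close>

lemma crit_dir_dependent_rows:
  fixes A B :: "'k::field ^ 'm::finite ^ 'm"
  assumes ab: "a \<noteq> b" "a \<notin> S" "b \<notin> S"
    and a: "A $ a = (\<Sum>s\<in>S. u s *s A $ s)" and b: "A $ b = (\<Sum>s\<in>S. w s *s A $ s)"
  shows "crit_dir A B"
proof -
  define Ba where "Ba = B $ a - (\<Sum>s\<in>S. u s *s B $ s)"
  define Bb where "Bb = B $ b - (\<Sum>s\<in>S. w s *s B $ s)"
  \<comment> \<open>\<open>A' + t B'\<close> is what remains after \<open>t\<close> has been divided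
    out of rows \<open>a\<close> and \<open>b\<close>; these rows no longer depend on
    \<open>t\<close>.\<close>
  define A' where "A' = (\<chi> i. if i = a then Ba else if i = b then Bb else A $ i)"
  define B' where "B' = (\<chi> i. if i = a \<or> i = b then 0 else B $ i)"
  obtain r where r: "\<And>t. det (\<chi> i j. A' $ i $ j + t * B' $ i $ j) = poly r t"
    using det_affine_poly by blast
  have "det (\<chi> i j. A $ i $ j + t * B $ i $ j) = t ^ 2 * poly r t" for t
  proof -
    define C where "C = (\<chi> i j. A $ i $ j + t * B $ i $ j)"
    define C1 where "C1 = (\<chi> i. if i = a then C $ a - (\<Sum>s\<in>S. u s *s C $ s) else C $ i)"
    define C2 where "C2 = (\<chi> i. if i = b then C1 $ b - (\<Sum>s\<in>S. w s *s C1 $ s) else C1 $ i)"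
    have C: "C $ i = A $ i + t *s B $ i" for i
      by (simp add: C_def vec_eq_iff)
    have comb: "(\<Sum>s\<in>S. v s *s C $ s) = (\<Sum>s\<in>S. v s *s A $ s) + t *s (\<Sum>s\<in>S. v s *s B $ s)" for v
      by (simp add: C vec_eq_iff sum_component sum.distrib sum_distrib_left algebra_simps)
    have C1: "(\<Sum>s\<in>S. w s *s C1 $ s) = (\<Sum>s\<in>S. w s *s C $ s)"
      using ab by (intro sum.cong) (auto simp: C1_def)
    have "C2 $ a = C $ a - (\<Sum>s\<in>S. u s *s C $ s)" "C2 $ b = C $ b - (\<Sum>s\<in>S. w s *s C $ s)"
      using ab(1) by (simp_all add: C2_def C1) (simp_all add: C1_def)
    then have "C2 $ a = t *s Ba" "C2 $ b = t *s Bb"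
      unfolding comb by (simp_all add: C a b Ba_def Bb_def vec.scale_right_diff_distrib)
    then have "C2 $ i = (if i = a \<or> i = b then t else 1) *s (A' $ i + t *s B' $ i)" for i
      using ab(1) by (auto simp: A'_def B'_def) (auto simp: C2_def C1_def C)
    then have C2: "C2 = (\<chi> i. (if i = a \<or> i = b then t else 1) *s (A' $ i + t *s B' $ i))"
      unfolding vec_eq_iff[of C2] by simp
    have "det C = det C2"
      unfolding C2_def C1_def det_subtract_rows[OF ab(3)] det_subtract_rows[OF ab(2)] ..
    also have "\<dots> = (\<Prod>i\<in>UNIV. if i = a \<or> i = b then t else 1) * det (\<chi> i. A' $ i + t *s B' $ i)"
      unfolding C2 by (rule det_rows_mul)
    also have "(\<Prod>i\<in>UNIV. if i = a \<or> i = b then t else 1) = (\<Prod>i\<in>{a, b}. t)"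
      by (rule prod.mono_neutral_cong_right) auto
    also have "(\<chi> i. A' $ i + t *s B' $ i) = (\<chi> i j. A' $ i $ j + t * B' $ i $ j)"
      by (simp add: vec_eq_iff)
    finally show ?thesis
      using ab(1) by (simp add: C_def r power2_eq_square)
  qed
  then show ?thesis
    unfolding crit_dir_def by blast
qed

text \<open>The identity of matrix space, with matrices written as vectors indexed by pairs, so that
  the generic determinant is itself a \<open>det_poly\<close>.\<close>

definition generic_matrix :: "'k::field ^ ('m \<times> 'm) \<Rightarrow> 'k ^ 'm::finite ^ 'm" where
  "generic_matrix x = (\<chi> i j. x $ (i, j))"

lemma generic_matrix_linear: "generic_matrix \<in> linear_maps"
proof -
  have "Vector_Spaces.linear ((*s) :: 'k \<Rightarrow> 'k ^ ('m \<times> 'm) \<Rightarrow> _) matrix_scale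
      (generic_matrix :: 'k::field ^ ('m \<times> 'm) \<Rightarrow> 'k ^ 'm::finite ^ 'm)"
    unfolding Vector_Spaces.linear_iff
    by (auto simp: generic_matrix_def matrix_scale_def vec_eq_iff vector_space_matrix_scale
        intro: vec.vector_space_axioms)
  then show ?thesis
    by (simp add: linear_maps_def)
qed

lemma surj_generic_matrix: "\<exists>x. generic_matrix x = A"
  by (rule exI[of _ "\<chi> ij. A $ fst ij $ snd ij"]) (simp add: generic_matrix_def vec_eq_iff)

lemma Sing_det_poly_closed: "zariski_closed (Sing f)"
  by (simp add: Sing_def)

lemma Sing_det_poly_cone:
  fixes L :: "'k::field_char_0 ^ 'n::finite \<Rightarrow> 'k ^ 'm::finite ^ 'm"
  assumes "CARD('m) \<ge> 2" "L \<in> linear_maps"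
  shows "is_cone (Sing (det_poly L))"
  by (auto simp: is_cone_def mem_Sing_det_poly_iff[OF assms(2)] linear_maps_scale[OF assms(2)]
      intro: crit_dir_scale[OF assms(1)])

text \<open>Zero rows are empty combinations of others. Since the kernel of \<open>L\<close> is
  singular, \<open>L\<close> is injective on every linear space that meets the singular locus only
  in 0.\<close>

lemma zero_mem_Sing_det_poly:
  fixes L :: "'k::field_char_0 ^ 'n::finite \<Rightarrow> 'k ^ 'm::finite ^ 'm"
  assumes "CARD('m) \<ge> 2" "L \<in> linear_maps" "L x = 0"
  shows "x \<in> Sing (det_poly L)"
proof -
  obtain a b :: 'm where "a \<noteq> b"
    using assms(1) card_le_Suc0_iff_eq[of "UNIV :: 'm set"] by fastforce
  then have "crit_dir (L x) (L v)" for v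
    by (rule crit_dir_dependent_rows[of _ _ "{}"]) (simp_all add: assms(3))
  then show ?thesis
    by (simp add: mem_Sing_det_poly_iff[OF assms(2)])
qed

text \<open>A matrix whose upper left block is invertible can be modified in the lower right
  \<open>2 \<times> 2\<close> block so that its last two rows depend on the other ones.\<close>

lemma generic_Sing_alg_indep:
  fixes a b :: "'m::finite"
  assumes ab: "a \<noteq> b"
  shows "alg_indep (- ({a, b} \<times> {a, b})) mvar
    (vanishing (Sing (det_poly (generic_matrix :: 'k::field_char_0 ^ ('m \<times> 'm) \<Rightarrow> 'k ^ 'm ^ 'm))))"
  unfolding alg_indep_def
proof (intro allI impI, rule ccontr)
  fix F and r :: "('m \<times> 'm, 'k) mpoly" and b0
  assume F: "subst_rel (- ({a, b} \<times> {a, b})) mvar F r"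
    and r: "r \<in> vanishing (Sing (det_poly generic_matrix))" and b0: "F b0 \<noteq> 0"
  define S where "S = - {a, b}"
  define d :: "'m \<times> 'm \<Rightarrow> 'k" where "d = (\<lambda>(i, j). if i = j then 1 else 0)"
  \<comment> \<open>\<open>M + t N\<close> carries the \<open>S\<close> by \<open>S\<close> block of
    a point that moves from \<open>b0\<close> at \<open>t = 0\<close> to the identity matrix at
    \<open>t = 1\<close>, completed by an identity block. Some \<open>t\<close> keeps both
    \<open>F\<close> and the determinant nonzero.\<close>
  define M where "M = (\<chi> i j. if i \<in> S \<and> j \<in> S then b0 (i, j) else d (i, j))"
  define N where "N = (\<chi> i j. if i \<in> S \<and> j \<in> S then d (i, j) - b0 (i, j) else 0)"
  obtain p where p: "\<forall>t. F (\<lambda>ij. b0 ij + t * (d ij - b0 ij)) = poly p t"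
    using subst_rel_line[OF F, of b0 "\<lambda>ij. d ij - b0 ij"] by (elim exE)
  obtain q where q: "\<And>t. det (\<chi> i j. M $ i $ j + t * N $ i $ j) = poly q t"
    using det_affine_poly by blast
  have "(\<chi> i j. M $ i $ j + 1 * N $ i $ j) = mat 1"
    by (simp add: M_def N_def d_def mat_def vec_eq_iff)
  then have "poly q 1 = 1"
    using q[of 1] by (simp only: det_I)
  then have "q \<noteq> 0"
    by auto
  moreover have "p \<noteq> 0"
    using p[rule_format, of 0] b0 by auto
  ultimately have "p * q \<noteq> 0" by simp
  then obtain t where "poly (p * q) t \<noteq> 0"
    using poly_all_0_iff_0 by blast
  then have t: "poly p t \<noteq> 0" "poly q t \<noteq> 0"
    by auto
  define c where "c = (\<lambda>ij. b0 ij + t * (d ij - b0 ij))"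
  define P where "P = (\<chi> i j. M $ i $ j + t * N $ i $ j)"
  have Fc: "F c \<noteq> 0"
    using p t(1) by (simp add: c_def)
  have "invertible P"
    using q[of t] t(2) by (simp add: invertible_det_nz P_def)
  then obtain P' where P': "P' ** P = mat 1"
    unfolding invertible_def by blast
  have P: "P $ i $ j = (if i \<in> S then c (i, j) else 0)" if "j \<in> S" for i j
    using that by (auto simp: P_def M_def N_def c_def d_def)
  \<comment> \<open>The entries of \<open>u i\<close> in \<open>S\<close> express row
    \<open>i\<close> of \<open>c\<close>, restricted to the columns in \<open>S\<close>, through the
    rows of the invertible block.\<close>
  define u where "u i = (\<chi> j. c (i, j)) v* P'" for i
  have u: "(\<Sum>s\<in>S. u i $ s * c (s, j)) = c (i, j)" if "j \<in> S" for i j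
  proof -
    have "u i v* P = (\<chi> j. c (i, j))"
      unfolding u_def vector_matrix_mul_assoc P' by simp
    then have "c (i, j) = (u i v* P) $ j"
      by simp
    also have "\<dots> = (\<Sum>s\<in>UNIV. if s \<in> S then u i $ s * c (s, j) else 0)"
      unfolding vector_matrix_mult_def vec_lambda_beta P[OF that]
      by (rule sum.cong) auto
    also have "\<dots> = (\<Sum>s\<in>S. u i $ s * c (s, j))"
      by (simp add: sum.If_cases)
    finally show ?thesis by simp
  qed
  \<comment> \<open>Only the four entries with both indices in \<open>{a, b}\<close> can differ from
    \<open>c\<close>: in the other columns of rows \<open>a\<close> and \<open>b\<close> the
    combination reproduces \<open>c\<close>.\<close>
  define x :: "'k ^ ('m \<times> 'm)" where
    "x = (\<chi> ij. if fst ij \<in> S then c ij else \<Sum>s\<in>S. u (fst ij) $ s * c (s, snd ij))"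
  have x: "x $ (i, j) = c (i, j)" if "(i, j) \<in> - ({a, b} \<times> {a, b})" for i j
    using that u[of j i] by (auto simp: x_def S_def)
  have row: "generic_matrix x $ i = (\<Sum>s\<in>S. u i $ s *s generic_matrix x $ s)" if "i \<notin> S" for i
    using that by (simp add: vec_eq_iff generic_matrix_def x_def sum_component)
  have "crit_dir (generic_matrix x) B" for B
    by (rule crit_dir_dependent_rows[OF ab _ _ row row]) (simp_all add: S_def)
  then have "x \<in> Sing (det_poly generic_matrix)"
    by (simp add: mem_Sing_det_poly_iff[OF generic_matrix_linear])
  then have "meval x r = 0"
    using r by (simp add: vanishing_def)
  moreover have "meval x r = F c"
    unfolding subst_rel_meval[OF F] by (rule subst_rel_cong[OF F]) (use x in force)
  ultimately show False
    using Fc by simp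
qed

text \<open>\<open>M\<close> maps \<open>vec.span B\<close> injectively to a space that meets the
  generic singular locus \<open>?D\<close> only in 0. By \<open>cone_section_card_le\<close> its
  dimension is at most the number of entries outside \<open>I\<close>.\<close>

theorem Sing_section_card_le:
  fixes L :: "'k::{alg_closed_field, field_char_0} ^ 'n::finite \<Rightarrow> 'k ^ 'm::finite ^ 'm"
  assumes m: "CARD('m) \<ge> 2" and L: "L \<in> linear_maps"
    and B: "vec.independent B" "vec.span B \<inter> Sing (det_poly L) \<subseteq> {0}"
  shows "card B \<le> 4"
proof -
  let ?D = "Sing (det_poly (generic_matrix :: 'k ^ ('m \<times> 'm) \<Rightarrow> 'k ^ 'm ^ 'm))"
  obtain a b :: 'm where ab: "a \<noteq> b"
    using m card_le_Suc0_iff_eq[of "UNIV :: 'm set"] by fastforce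
  define I where "I = - ({a, b} \<times> {a, b})"
  define M :: "'k ^ 'n ^ ('m \<times> 'm)" where "M = (\<chi> ij l. L (axis l 1) $ fst ij $ snd ij)"
  have LM: "generic_matrix (M *v x) = L x" for x
    by (simp add: vec_eq_iff generic_matrix_def M_def matrix_vector_mult_def linear_maps_apply[OF L, of x])
  have inj: "inj_on ((*v) M) (vec.span B)"
  proof (rule inj_onI)
    fix x y assume xy: "x \<in> vec.span B" "y \<in> vec.span B" "M *v x = M *v y"
    then have "M *v (x - y) = 0"
      by (simp add: matrix_vector_mult_diff_distrib)
    then have "L (x - y) = 0"
      using LM[of "x - y"] by (simp add: generic_matrix_def vec_eq_iff)
    then have "x - y \<in> Sing (det_poly L)"
      by (rule zero_mem_Sing_det_poly[OF m L])
    then show "x = y"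
      using B(2) vec.span_diff[OF xy(1,2)] by auto
  qed
  have B': "vec.independent ((*v) M ` B)"
    by (rule vec.linear_independent_injective_image[OF matrix_vector_mul_linear_gen B(1) inj])
  have "vec.span ((*v) M ` B) = (*v) M ` vec.span B"
    by (rule vec.linear_span_image[OF matrix_vector_mul_linear_gen])
  moreover have "M *v x = 0" if x: "x \<in> vec.span B" "M *v x \<in> ?D" for x
  proof -
    have "\<forall>v. crit_dir (L x) (generic_matrix v)"
      using x(2) by (simp add: mem_Sing_det_poly_iff[OF generic_matrix_linear] LM)
    then have "x \<in> Sing (det_poly L)"
      unfolding mem_Sing_det_poly_iff[OF L] using surj_generic_matrix by metis
    then show ?thesis
      using x(1) B(2) by auto
  qed
  ultimately have sec: "vec.span ((*v) M ` B) \<inter> ?D \<subseteq> {0}"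
    by auto
  have ind: "alg_indep I mvar (vanishing ?D)"
    unfolding I_def by (rule generic_Sing_alg_indep[OF ab])
  have "card I + card ((*v) M ` B) \<le> CARD('m \<times> 'm)"
    by (rule cone_section_card_le[OF Sing_det_poly_closed Sing_det_poly_cone[OF m generic_matrix_linear]
      B' sec _ ind]) simp
  moreover have "card ((*v) M ` B) = card B"
    using inj by (intro card_image) (meson inj_on_subset vec.span_superset)
  moreover have "CARD('m \<times> 'm) = card I + 4"
  proof -
    have "card (UNIV - {a, b} \<times> {a, b}) = CARD('m \<times> 'm) - card ({a, b} \<times> {a, b})"
      by (intro card_Diff_subset) auto
    moreover have "card ({a, b} \<times> {a, b}) = 4"
      using ab by (simp add: card_cartesian_product)
    moreover have "card ({a, b} \<times> {a, b}) \<le> CARD('m \<times> 'm)"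
      by (intro card_mono) auto
    ultimately show ?thesis
      by (simp add: I_def Compl_eq_Diff_UNIV)
  qed
  ultimately show ?thesis
    by simp
qed

theorem zariski_dim_Sing_ge:
  fixes L :: "'k::{alg_closed_field, field_char_0} ^ 'n::finite \<Rightarrow> 'k ^ 'm::finite ^ 'm"
  assumes m: "CARD('m) \<ge> 2" and L: "L \<in> linear_maps"
  shows "ereal (real (CARD('n) - min 4 CARD('n))) \<le> zariski_dim (Sing (det_poly L))"
proof -
  have "L 0 = 0"
    using linear_maps_scale[OF L, of 0 0] by (simp add: vec_eq_iff)
  then have "0 \<in> Sing (det_poly L)"
    by (rule zero_mem_Sing_det_poly[OF m L])
  from cone_exists_complementary_alg_indep[OF Sing_det_poly_cone[OF m L] this]
  obtain B C y where B: "vec.independent B" "vec.span B \<inter> Sing (det_poly L) \<subseteq> {0}"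
    and C: "finite (C :: ('k ^ 'n) set)" "card C + card B = CARD('n)"
    and ind: "alg_indep C y (vanishing (Sing (det_poly L)))"
    by (elim exE conjE)
  have "CARD('n) - min 4 CARD('n) \<le> card C"
    using Sing_section_card_le[OF m L B] C(2) by linarith
  then have "ereal (real (CARD('n) - min 4 CARD('n))) \<le> ereal (real (card C))"
    by simp
  also have "\<dots> \<le> zariski_dim (Sing (det_poly L))"
    by (rule zariski_dim_ge[OF C(1) Sing_det_poly_closed ind])
  finally show ?thesis .
qed

text \<open>Otherwise the standard basis would span a space of dimension above 4 that meets the
  singular locus only in 0.\<close>

theorem Sing_nonzero:
  fixes L :: "'k::{alg_closed_field, field_char_0} ^ 'n::finite \<Rightarrow> 'k ^ 'm::finite ^ 'm"
  assumes m: "CARD('m) \<ge> 2" and L: "L \<in> linear_maps" and n: "CARD('n) > 4"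
  shows "\<exists>x\<in>Sing (det_poly L). x \<noteq> 0"
  using Sing_section_card_le[OF m L vec.independent_Basis] n by (auto simp: card_cart_basis)

section \<open>General linear maps\<close>

definition map_of_coords :: "'k::field ^ ('m \<times> 'm \<times> 'n) \<Rightarrow> 'k ^ 'n::finite \<Rightarrow> 'k ^ 'm::finite ^ 'm"
  where "map_of_coords z = (\<lambda>x. \<chi> i j. \<Sum>l\<in>UNIV. z $ (i, j, l) * x $ l)"

lemma map_of_coords_linear: "map_of_coords z \<in> linear_maps"
proof -
  have "Vector_Spaces.linear (*s) matrix_scale (map_of_coords z)"
    unfolding Vector_Spaces.linear_iff
    by (auto simp: map_of_coords_def matrix_scale_def vec_eq_iff vector_space_matrix_scale
        sum.distrib sum_distrib_left algebra_simps intro: vec.vector_space_axioms)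
  then show ?thesis
    by (simp add: linear_maps_def)
qed

lemma map_coords_map_of_coords: "map_coords (map_of_coords z) = z"
proof -
  have "(\<Sum>l\<in>UNIV. z $ (i, j, l) * axis l' 1 $ l) = (\<Sum>l\<in>UNIV. if l = l' then z $ (i, j, l) else 0)" for i j l'
    by (rule sum.cong) (auto simp: axis_def)
  then show ?thesis
    by (simp add: map_coords_def map_of_coords_def vec_eq_iff)
qed

lemma for_general_linear_mapI:
  fixes P :: "('k::field ^ 'n::finite \<Rightarrow> 'k ^ 'm::finite ^ 'm) \<Rightarrow> bool"
  assumes z0: "meval z0 F \<noteq> 0"
    and P: "\<And>L. L \<in> linear_maps \<Longrightarrow> meval (map_coords L) F \<noteq> 0 \<Longrightarrow> P L"
  shows "for_general_linear_map P"
proof -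
  define U where "U = {L :: 'k ^ 'n \<Rightarrow> 'k ^ 'm ^ 'm. L \<in> linear_maps \<and> meval (map_coords L) F \<noteq> 0}"
  have "map_coords ` U = - zero_locus {F}"
  proof (intro equalityI subsetI)
    fix z assume "z \<in> - zero_locus {F}"
    then have "map_of_coords z \<in> U"
      by (simp add: U_def map_of_coords_linear map_coords_map_of_coords zero_locus_def)
    then show "z \<in> map_coords ` U"
      using map_coords_map_of_coords[of z] by (metis imageI)
  qed (auto simp: U_def zero_locus_def)
  then have "zariski_open (map_coords ` U)"
    by (simp add: zariski_open_def)
  moreover have "map_of_coords z0 \<in> U"
    using z0 by (simp add: U_def map_of_coords_linear map_coords_map_of_coords)
  ultimately show ?thesis
    unfolding for_general_linear_map_def using P by (intro exI[of _ U]) (auto simp: U_def)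
qed

section \<open>Forms whose coefficients depend polynomially on parameters\<close>

definition monomials :: "nat \<Rightarrow> ('v::finite \<Rightarrow>\<^sub>0 nat) set" where
  "monomials d = {a. mdeg a = d}"

lemma lookup_le_mdeg: "Poly_Mapping.lookup a i \<le> mdeg a"
  unfolding mdeg_def by (rule member_le_sum) auto

lemma finite_monomials: "finite (monomials d :: ('v::finite \<Rightarrow>\<^sub>0 nat) set)"
proof (rule finite_subset)
  show "monomials d \<subseteq> Abs_poly_mapping ` PiE (UNIV :: 'v set) (\<lambda>_. {..d})"
  proof
    fix a :: "'v \<Rightarrow>\<^sub>0 nat" assume "a \<in> monomials d"
    then have "Poly_Mapping.lookup a \<in> PiE UNIV (\<lambda>_. {..d})"
      using lookup_le_mdeg[of a] by (auto simp: monomials_def)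
    then show "a \<in> Abs_poly_mapping ` PiE UNIV (\<lambda>_. {..d})"
      by (intro image_eqI[of _ _ "Poly_Mapping.lookup a"]) auto
  qed
  show "finite (Abs_poly_mapping ` PiE (UNIV :: 'v set) (\<lambda>_. {..d}))"
    by (intro finite_imageI finite_PiE) auto
qed

text \<open>Forms of degree \<open>d\<close> with coefficients polynomial in the parameter
  \<open>z\<close>. This records that a condition on the coefficients of \<open>det_poly L\<close>
  is a polynomial condition on the coordinates of \<open>L\<close>.\<close>

definition form_family :: "nat \<Rightarrow> ('k::comm_ring_1 ^ 'z::finite \<Rightarrow> ('v::finite, 'k) mpoly) \<Rightarrow> bool" where
  "form_family d p \<longleftrightarrow> (\<exists>c. \<forall>z. p z = (\<Sum>a\<in>monomials d. Poly_Mapping.single a (meval z (c a))))"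

lemma single_sum: "Poly_Mapping.single a (\<Sum>i\<in>S. f i) = (\<Sum>i\<in>S. Poly_Mapping.single a (f i))"
  by (induction S rule: infinite_finite_induct) (simp_all add: single_add)

lemma form_family_mult:
  assumes "form_family d p" "form_family e q"
  shows "form_family (d + e) (\<lambda>z. p z * q z)"
proof -
  obtain c where c: "\<And>z. p z = (\<Sum>a\<in>monomials d. Poly_Mapping.single a (meval z (c a)))"
    using assms(1) unfolding form_family_def by blast
  obtain c' where c': "\<And>z. q z = (\<Sum>a\<in>monomials e. Poly_Mapping.single a (meval z (c' a)))"
    using assms(2) unfolding form_family_def by blast
  let ?D = "monomials d \<times> monomials e"
  have fin: "finite ?D"
    by (simp add: finite_monomials)
  have "p z * q z = (\<Sum>ab\<in>monomials (d + e). Poly_Mapping.single ab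
      (meval z (\<Sum>(a, b)\<in>{(a, b) \<in> ?D. a + b = ab}. c a * c' b)))" for z
  proof -
    have "p z * q z = (\<Sum>(a, b)\<in>?D. Poly_Mapping.single (a + b) (meval z (c a * c' b)))"
      by (simp add: c c' sum_product mult_single meval_mult sum.cartesian_product)
    also have "\<dots> = (\<Sum>ab\<in>monomials (d + e). \<Sum>(a, b)\<in>{x \<in> ?D. fst x + snd x = ab}.
        Poly_Mapping.single (a + b) (meval z (c a * c' b)))"
      by (rule sum.group[symmetric, OF fin finite_monomials]) (auto simp: monomials_def)
    also have "\<dots> = (\<Sum>ab\<in>monomials (d + e). \<Sum>(a, b)\<in>{(a, b) \<in> ?D. a + b = ab}.
        Poly_Mapping.single ab (meval z (c a * c' b)))"
      by (intro sum.cong) auto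
    finally show ?thesis
      by (simp add: meval_sum single_sum case_prod_unfold)
  qed
  then show ?thesis
    unfolding form_family_def
    by (intro exI[of _ "\<lambda>ab. \<Sum>(a, b)\<in>{(a, b) \<in> ?D. a + b = ab}. c a * c' b"]) blast
qed

lemma form_family_sum:
  assumes "\<And>i. i \<in> S \<Longrightarrow> form_family d (p i)"
  shows "form_family d (\<lambda>z. \<Sum>i\<in>S. p i z)"
proof -
  have "\<forall>i\<in>S. \<exists>c. \<forall>z. p i z = (\<Sum>a\<in>monomials d. Poly_Mapping.single a (meval z (c a)))"
    using assms unfolding form_family_def by simp
  from bchoice[OF this] obtain c where
    c: "\<forall>i\<in>S. \<forall>z. p i z = (\<Sum>a\<in>monomials d. Poly_Mapping.single a (meval z (c i a)))"
    by (elim exE)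
  have "(\<Sum>i\<in>S. p i z) =
      (\<Sum>a\<in>monomials d. Poly_Mapping.single a (meval z (\<Sum>i\<in>S. c i a)))" for z
  proof -
    have "(\<Sum>i\<in>S. p i z) = (\<Sum>i\<in>S. \<Sum>a\<in>monomials d. Poly_Mapping.single a (meval z (c i a)))"
      using c by (intro sum.cong) auto
    also have "\<dots> = (\<Sum>a\<in>monomials d. \<Sum>i\<in>S. Poly_Mapping.single a (meval z (c i a)))"
      by (rule sum.swap)
    finally show ?thesis
      by (simp add: meval_sum single_sum)
  qed
  then show ?thesis
    unfolding form_family_def by (intro exI[of _ "\<lambda>a. \<Sum>i\<in>S. c i a"]) blast
qed

lemma form_family_monomial:
  "form_family (mdeg a) (\<lambda>z. Poly_Mapping.single a (meval z c))"
  unfolding form_family_def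
proof (intro exI allI)
  fix z
  have mem: "a \<in> monomials (mdeg a)"
    by (simp add: monomials_def)
  have "(\<Sum>b\<in>monomials (mdeg a). Poly_Mapping.single b (meval z (if b = a then c else 0))) =
      (\<Sum>b\<in>monomials (mdeg a). if b = a then Poly_Mapping.single b (meval z c) else 0)"
    by (intro sum.cong) auto
  also have "\<dots> = Poly_Mapping.single a (meval z c)"
    using mem by (simp add: finite_monomials)
  finally show "Poly_Mapping.single a (meval z c) =
      (\<Sum>b\<in>monomials (mdeg a). Poly_Mapping.single b (meval z (if b = a then c else 0)))" ..
qed

lemma form_family_const: "form_family 0 (\<lambda>z. mconst c)"
  using form_family_monomial[of 0 "mconst c"] by (simp add: mconst_def)

lemma form_family_prod:
  "(\<And>i. i \<in> S \<Longrightarrow> form_family (d i) (p i)) \<Longrightarrow> form_family (\<Sum>i\<in>S. d i) (\<lambda>z. \<Prod>i\<in>S. p i z)"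
proof (induction S rule: infinite_finite_induct)
  case (insert i S)
  then show ?case
    using form_family_mult[of "d i" "p i" "\<Sum>i\<in>S. d i" "\<lambda>z. \<Prod>i\<in>S. p i z"] by simp
qed (use form_family_const[of 1] in \<open>simp_all add: mconst_1\<close>)

lemma mconst_of_int: "mconst (of_int n) = of_int n"
proof -
  have nat: "mconst (of_nat n) = of_nat n" for n
    by (induction n) (simp_all add: mconst_0 mconst_1 mconst_add)
  show ?thesis
    by (cases n rule: int_cases2) (simp_all add: nat mconst_uminus)
qed

lemma det_poly_form_family:
  "\<exists>c. \<forall>L :: 'k::field ^ 'n::finite \<Rightarrow> 'k ^ 'm::finite ^ 'm. det_poly L =
    (\<Sum>a\<in>monomials CARD('m). Poly_Mapping.single a (meval (map_coords L) (c a)))"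
proof -
  let ?A = "\<lambda>(z :: 'k ^ ('m \<times> 'm \<times> 'n)) i j. \<Sum>l\<in>UNIV. mconst (z $ (i, j, l)) * mvar l"
  have entry: "form_family 1 (\<lambda>z. ?A z i j)" for i j
  proof (rule form_family_sum)
    fix l :: 'n
    have "form_family 1 (\<lambda>z :: 'k ^ ('m \<times> 'm \<times> 'n).
        Poly_Mapping.single (Poly_Mapping.single l 1) (z $ (i, j, l)))"
      using form_family_monomial[of "Poly_Mapping.single l 1" "mvar (i, j, l)"] by simp
    then show "form_family 1 (\<lambda>z :: 'k ^ ('m \<times> 'm \<times> 'n). mconst (z $ (i, j, l)) * mvar l)"
      by (simp add: mconst_def mvar_def mult_single)
  qed
  have "form_family CARD('m) (\<lambda>z. det (\<chi> i j. ?A z i j))"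
    unfolding det_def
  proof (rule form_family_sum)
    fix p :: "'m \<Rightarrow> 'm"
    have "form_family (\<Sum>i\<in>(UNIV :: 'm set). 1) (\<lambda>z. \<Prod>i\<in>UNIV. ?A z i (p i))"
      by (rule form_family_prod) (rule entry)
    from form_family_mult[OF form_family_const[of "of_int (sign p)"] this]
    show "form_family CARD('m) (\<lambda>z. of_int (sign p) * (\<Prod>i\<in>UNIV. (\<chi> i j. ?A z i j) $ i $ p i))"
      by (simp add: mconst_of_int)
  qed
  then obtain c where c: "\<And>z. det (\<chi> i j. ?A z i j) =
      (\<Sum>a\<in>monomials CARD('m). Poly_Mapping.single a (meval z (c a)))"
    unfolding form_family_def by blast
  have "det_poly L = det (\<chi> i j. ?A (map_coords L) i j)" for L :: "'k ^ 'n \<Rightarrow> 'k ^ 'm ^ 'm"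
    by (simp add: det_poly_def map_coords_def)
  then show ?thesis
    using c by (intro exI[of _ c]) simp
qed

lemma meval_pdiff_sum_single:
  assumes "finite S"
  shows "meval x (pdiff i (\<Sum>a\<in>S. Poly_Mapping.single a (u a))) =
    (\<Sum>a\<in>S. u a * (of_nat (Poly_Mapping.lookup a i) * mono_eval x (a - Poly_Mapping.single i 1)))"
proof -
  let ?p = "\<Sum>a\<in>S. Poly_Mapping.single a (u a)"
  have l: "Poly_Mapping.lookup ?p a = (if a \<in> S then u a else 0)" for a
    using assms by (simp add: lookup_sum lookup_single when_def)
  then have "Poly_Mapping.keys ?p \<subseteq> S"
    by (auto simp: in_keys_iff split: if_splits)
  then have "meval x (pdiff i ?p) = (\<Sum>a\<in>S. Poly_Mapping.lookup ?p a *
      (of_nat (Poly_Mapping.lookup a i) * mono_eval x (a - Poly_Mapping.single i 1)))"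
    unfolding meval_pdiff using assms by (intro sum.mono_neutral_left) (auto simp: in_keys_iff)
  also have "\<dots> = (\<Sum>a\<in>S. u a * (of_nat (Poly_Mapping.lookup a i) * mono_eval x (a - Poly_Mapping.single i 1)))"
    by (intro sum.cong) (simp_all add: l)
  finally show ?thesis .
qed

text \<open>\<open>F\<close> is the product of the pivots of Gaussian elimination. It plays the role of the
  determinant, which the library only has for matrices indexed by a finite type.\<close>

lemma generic_left_inverse:
  fixes A :: "'e \<Rightarrow> 'e \<Rightarrow> ('z::finite, 'k::field) mpoly"
  assumes "finite S" "\<And>i. i \<in> S \<Longrightarrow> meval z0 (A i i) \<noteq> 0"
    "\<And>i j. i \<in> S \<Longrightarrow> j \<in> S \<Longrightarrow> i \<noteq> j \<Longrightarrow> meval z0 (A i j) = 0"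
  shows "\<exists>F. meval z0 F \<noteq> 0 \<and> (\<forall>z. meval z F \<noteq> 0 \<longrightarrow> (\<forall>a\<in>S. \<exists>w. \<forall>v :: 'e \<Rightarrow> 'k.
    v a = (\<Sum>i\<in>S. w i * (\<Sum>j\<in>S. meval z (A i j) * v j))))"
  using assms
proof (induction S arbitrary: A rule: finite_induct)
  case empty
  then show ?case by (intro exI[of _ 1]) simp
next
  case (insert s S)
  \<comment> \<open>The Schur complement of the pivot \<open>A s s\<close>, multiplied by the pivot
    so that its entries stay polynomial. At \<open>z0\<close> it is again diagonal with nonzero
    diagonal.\<close>
  define B where "B i j = A s s * A i j - A i s * A s j" for i j
  have "meval z0 (B i i) \<noteq> 0" if "i \<in> S" for i
  proof -
    have "i \<noteq> s"
      using that insert.hyps(2) by blast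
    then show ?thesis
      using insert.prems(1)[of s] insert.prems(1)[of i] insert.prems(2)[of i s] that
      by (simp add: B_def meval_diff meval_mult)
  qed
  moreover have "meval z0 (B i j) = 0" if "i \<in> S" "j \<in> S" "i \<noteq> j" for i j
  proof -
    have "i \<noteq> s"
      using that insert.hyps(2) by blast
    then show ?thesis
      using insert.prems(2)[of i j] insert.prems(2)[of i s] that
      by (simp add: B_def meval_diff meval_mult)
  qed
  ultimately obtain F where F: "meval z0 F \<noteq> 0" and inv: "\<And>z a. meval z F \<noteq> 0 \<Longrightarrow> a \<in> S \<Longrightarrow>
      \<exists>w. \<forall>v :: 'e \<Rightarrow> 'k. v a = (\<Sum>i\<in>S. w i * (\<Sum>j\<in>S. meval z (B i j) * v j))"
    using insert.IH[of B] by blast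
  show ?case
  proof (intro exI[of _ "A s s * F"] conjI allI impI ballI)
    show "meval z0 (A s s * F) \<noteq> 0"
      using F insert.prems(1) by (simp add: meval_mult)
    fix z a
    assume z: "meval z (A s s * F) \<noteq> 0" and a: "a \<in> insert s S"
    define \<alpha> where "\<alpha> i j = meval z (A i j)" for i j
    have nz: "\<alpha> s s \<noteq> 0" "meval z F \<noteq> 0"
      using z by (auto simp: meval_mult \<alpha>_def)
    define R where "R v i = (\<Sum>j\<in>insert s S. \<alpha> i j * v j)" for v i
    have R: "R v i = \<alpha> i s * v s + (\<Sum>j\<in>S. \<alpha> i j * v j)" for v i
      using insert.hyps by (simp add: R_def)
    have BR: "(\<Sum>j\<in>S. meval z (B i j) * v j) = \<alpha> s s * R v i - \<alpha> i s * R v s" for i v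
      by (simp add: R B_def meval_diff meval_mult \<alpha>_def[symmetric] sum_subtractf sum_distrib_left
          algebra_simps)
    \<comment> \<open>\<open>lin f\<close> says that \<open>f v\<close> is a fixed combination of
      the row values \<open>R v i\<close>. By \<open>BR\<close> each \<open>v b\<close> with
      \<open>b\<close> in \<open>S\<close> is of this kind, and back substitution in row
      \<open>s\<close> yields \<open>v s\<close>.\<close>
    define lin where "lin f \<longleftrightarrow> (\<exists>w. \<forall>v. f v = (\<Sum>i\<in>insert s S. w i * R v i))" for f
    have lin_R: "lin (\<lambda>v. R v i)" if "i \<in> insert s S" for i
      unfolding lin_def using that insert.hyps(1)
      by (intro exI[of _ "\<lambda>l. if l = i then 1 else 0"])
        (simp add: if_distrib[of "\<lambda>a. a * _"] cong: if_cong)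
    have lin_scale: "lin (\<lambda>v. c * f v)" if f: "lin f" for c f
    proof -
      obtain w where "\<forall>v. f v = (\<Sum>i\<in>insert s S. w i * R v i)"
        using f unfolding lin_def by blast
      then show ?thesis
        unfolding lin_def by (intro exI[of _ "\<lambda>i. c * w i"]) (simp only: sum_distrib_left mult.assoc simp_thms)
    qed
    have lin_diff: "lin (\<lambda>v. f v - g v)" if f: "lin f" and g: "lin g" for f g
    proof -
      obtain w where w: "\<forall>v. f v = (\<Sum>i\<in>insert s S. w i * R v i)"
        using f unfolding lin_def by blast
      obtain w' where "\<forall>v. g v = (\<Sum>i\<in>insert s S. w' i * R v i)"
        using g unfolding lin_def by blast
      then show ?thesis
        unfolding lin_def using w
        by (intro exI[of _ "\<lambda>i. w i - w' i"]) (simp only: left_diff_distrib sum_subtractf simp_thms)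
    qed
    have lin_0: "lin (\<lambda>v. 0)"
      unfolding lin_def by (rule exI[of _ "\<lambda>_. 0"]) simp
    have lin_sum: "lin (\<lambda>v. \<Sum>i\<in>T. f i v)" if "\<And>i. i \<in> T \<Longrightarrow> lin (f i)" for T :: "'e set" and f
      using that
    proof (induction T rule: infinite_finite_induct)
      case (insert i T)
      then have "lin (\<lambda>v. f i v - (-1) * (\<Sum>i\<in>T. f i v))"
        by (intro lin_diff lin_scale) auto
      then show ?case
        using insert by simp
    qed (simp_all add: lin_0)
    have lin_S: "lin (\<lambda>v. v b)" if b: "b \<in> S" for b
    proof -
      obtain w where w: "\<forall>v. v b = (\<Sum>i\<in>S. w i * (\<alpha> s s * R v i - \<alpha> i s * R v s))"
        using inv[OF nz(2) b] unfolding BR by (elim exE)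
      have "lin (\<lambda>v. \<Sum>i\<in>S. w i * (\<alpha> s s * R v i - \<alpha> i s * R v s))"
        by (intro lin_sum lin_scale lin_diff lin_R) auto
      then show ?thesis
        using w by simp
    qed
    have "lin (\<lambda>v. inverse (\<alpha> s s) * (R v s - (\<Sum>j\<in>S. \<alpha> s j * v j)))"
      by (intro lin_scale lin_diff lin_R lin_sum lin_S) auto
    then have "lin (\<lambda>v. v s)"
      using nz(1) by (simp add: R mult.assoc[symmetric])
    then have "lin (\<lambda>v. v a)"
      using lin_S a by blast
    then show "\<exists>w. \<forall>v. v a = (\<Sum>i\<in>insert s S. w i * (\<Sum>j\<in>insert s S. meval z (A i j) * v j))"
      by (simp only: lin_def R_def \<alpha>_def)
  qed
qed

section \<open>The Fermat form as a determinant, and the reduction of powers\<close>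

lemma exists_cyclic_permutation:
  assumes "CARD('m::finite) \<ge> 2"
  shows "\<exists>\<sigma> :: 'm \<Rightarrow> 'm. \<sigma> permutes UNIV \<and> (\<forall>i. \<sigma> i \<noteq> i) \<and>
    (\<forall>T. T \<noteq> {} \<longrightarrow> (\<forall>i\<in>T. \<sigma> i \<in> T) \<longrightarrow> T = UNIV)"
proof -
  define n where "n = CARD('m)"
  obtain e :: "nat \<Rightarrow> 'm" where e: "bij_betw e {0..<n} UNIV"
    using ex_bij_betw_nat_finite[of "UNIV :: 'm set"] by (auto simp: n_def)
  define d where "d = the_inv_into {0..<n} e"
  have d: "e (d i) = i" "d i < n" for i
    using f_the_inv_into_f_bij_betw[OF e, of i] the_inv_into_into[of e "{0..<n}" i "{0..<n}"] e
    by (auto simp: d_def bij_betw_def)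
  have de: "d (e k) = k" if "k < n" for k
    unfolding d_def using e that by (intro the_inv_into_f_f) (auto simp: bij_betw_def)
  have n: "n \<ge> 2"
    using assms by (simp add: n_def)
  \<comment> \<open>The successor modulo \<open>n\<close> on the numbering \<open>e\<close>;
    iterating it leads from any point to any other, which excludes proper nonempty invariant
    sets.\<close>
  define \<sigma> where "\<sigma> i = e (Suc (d i) mod n)" for i
  have d\<sigma>: "d (\<sigma> i) = Suc (d i) mod n" for i
    unfolding \<sigma>_def using n by (intro de) simp
  have cyc: "T = UNIV" if "T \<noteq> {}" "\<forall>i\<in>T. \<sigma> i \<in> T" for T
  proof -
    obtain i where i: "i \<in> T"
      using \<open>T \<noteq> {}\<close> by blast
    have it: "(\<sigma> ^^ k) i \<in> T \<and> d ((\<sigma> ^^ k) i) = (d i + k) mod n" for k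
      using i that(2) d(2)[of i] by (induction k) (auto simp: d\<sigma> mod_Suc_eq)
    have "j \<in> T" for j
    proof -
      \<comment> \<open>\<open>n - d i\<close> steps lead from \<open>i\<close> to number 0, and
        \<open>d j\<close> further steps to \<open>j\<close>.\<close>
      have "d ((\<sigma> ^^ (n - d i + d j)) i) = (n + d j) mod n"
        using it[of "n - d i + d j"] d(2)[of i] by simp
      also have "\<dots> = d j"
        using d(2)[of j] by simp
      finally have "(\<sigma> ^^ (n - d i + d j)) i = j"
        using d(1) by metis
      then show ?thesis
        using it by metis
    qed
    then show ?thesis by blast
  qed
  have ne: "\<sigma> i \<noteq> i" for i
  proof
    assume "\<sigma> i = i"
    then have "{i} = (UNIV :: 'm set)"
      by (intro cyc) auto
    then have "CARD('m) = card {i}"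
      by (rule arg_cong[OF sym])
    then show False
      using assms by simp
  qed
  have "surj \<sigma>"
    by (rule cyc) auto
  then have "\<sigma> permutes UNIV"
    by (intro bij_imp_permutes) (auto simp: bij_def finite_UNIV_surj_inj)
  then show ?thesis
    using ne by (intro exI[of _ \<sigma>] conjI allI impI cyc)
qed

text \<open>A permutation contributes only if each \<open>p i\<close> is \<open>i\<close> or
  \<open>\<sigma> i\<close>. By injectivity \<open>p i = \<sigma> i\<close> forces the same at
  \<open>\<sigma> i\<close>, so the set \<open>T\<close> where this holds is invariant. As \<sigma>
  is a single cycle, \<open>T\<close> is empty or everything, and \<open>p\<close> is the identity
  or \<sigma>.\<close>

lemma det_cyclic_bidiagonal:
  fixes u w :: "'m::finite \<Rightarrow> 'k::comm_ring_1"
  assumes \<sigma>: "\<sigma> permutes UNIV" "\<And>i. \<sigma> i \<noteq> i"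
    and cyc: "\<And>T. T \<noteq> {} \<Longrightarrow> (\<And>i. i \<in> T \<Longrightarrow> \<sigma> i \<in> T) \<Longrightarrow> T = UNIV"
  shows "det (\<chi> i j. if j = i then u i else if j = \<sigma> i then w i else 0) =
    (\<Prod>i\<in>UNIV. u i) + of_int (sign \<sigma>) * (\<Prod>i\<in>UNIV. w i)"
proof -
  let ?A = "\<lambda>i j. if j = i then u i else if j = \<sigma> i then w i else 0"
  have zero: "(\<Prod>i\<in>UNIV. ?A i (p i)) = 0" if p: "p permutes UNIV" "p \<noteq> id" "p \<noteq> \<sigma>" for p
  proof (rule ccontr)
    assume nz: "(\<Prod>i\<in>UNIV. ?A i (p i)) \<noteq> 0"
    have pi: "p i = i \<or> p i = \<sigma> i" for i
    proof (rule ccontr)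
      assume "\<not> (p i = i \<or> p i = \<sigma> i)"
      then have "?A i (p i) = 0"
        by simp
      then have "(\<Prod>i\<in>UNIV. ?A i (p i)) = 0"
        by (intro prod_zero bexI[of _ i]) auto
      then show False
        using nz by contradiction
    qed
    define T where "T = {i. p i = \<sigma> i}"
    have "\<sigma> i \<in> T" if "i \<in> T" for i
    proof (rule ccontr)
      assume "\<sigma> i \<notin> T"
      then have "p (\<sigma> i) = p i"
        using pi[of "\<sigma> i"] that by (auto simp: T_def)
      then show False
        using permutes_inj[OF p(1)] \<sigma>(2)[of i] by (auto dest: injD)
    qed
    moreover have "T \<noteq> UNIV"
      using p(3) by (auto simp: T_def)
    ultimately have "T = {}"
      using cyc by blast
    then have "p = id"
      using pi by (auto simp: T_def)
    then show False
      using p(2) by simp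
  qed
  have "det (\<chi> i j. ?A i j) = (\<Sum>p\<in>{p. p permutes UNIV}. of_int (sign p) * (\<Prod>i\<in>UNIV. ?A i (p i)))"
    by (simp add: det_def)
  also have "\<dots> = (\<Sum>p\<in>{id, \<sigma>}. of_int (sign p) * (\<Prod>i\<in>UNIV. ?A i (p i)))"
    using \<sigma>(1) zero by (intro sum.mono_neutral_right) (auto simp: finite_permutations permutes_id)
  also have "\<dots> = (\<Prod>i\<in>UNIV. u i) + of_int (sign \<sigma>) * (\<Prod>i\<in>UNIV. w i)"
  proof -
    have "id \<noteq> \<sigma>"
      using \<sigma>(2) by (metis id_apply)
    then show ?thesis
      using \<sigma>(2) by (simp add: sign_id)
  qed
  finally show ?thesis .
qed

text \<open>The factorization of \<open>x ^ m - 1\<close>, homogenized. The roots are indexed by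
  \<open>'m\<close> so that each row of a matrix can carry one factor.\<close>

lemma exists_binary_form_roots:
  "\<exists>\<zeta> :: 'm::finite \<Rightarrow> 'k::alg_closed_field. \<forall>x y.
    (\<Prod>i\<in>UNIV. x - \<zeta> i * y) = x ^ CARD('m) - y ^ CARD('m)"
proof -
  define n where "n = CARD('m)"
  have n: "n > 0"
    by (simp add: n_def)
  define p :: "'k poly" where "p = monom 1 n - 1"
  have cn: "coeff p n = 1"
    using n by (simp add: p_def coeff_1)
  have "degree p \<le> n"
    unfolding p_def by (intro degree_diff_le) (auto simp: degree_monom_le)
  then have deg: "degree p = n"
    using le_degree[of p n] cn by simp
  then have "p \<noteq> 0" "lead_coeff p = 1"
    using cn by auto
  then obtain A where A: "size A = n" "p = (\<Prod>x\<in>#A. [:- x, 1:])"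
    using alg_closed_imp_factorization[of p] deg by auto
  obtain xs where xs: "mset xs = A"
    using ex_mset by blast
  have len: "length xs = n"
    using A(1) xs by auto
  obtain e :: "'m \<Rightarrow> nat" where e: "bij_betw e UNIV {0..<n}"
    using ex_bij_betw_finite_nat[of "UNIV :: 'm set"] by (auto simp: n_def)
  define \<zeta> where "\<zeta> i = xs ! e i" for i
  have p_eq: "poly p x = (\<Prod>i\<in>UNIV. x - \<zeta> i)" for x
  proof -
    have "poly p x = (\<Prod>a\<leftarrow>xs. x - a)"
      unfolding A(2) xs[symmetric] by (induction xs) (simp_all add: algebra_simps)
    also have "\<dots> = (\<Prod>k\<in>{0..<n}. x - xs ! k)"
      by (simp add: prod.list_conv_set_nth len)
    also have "\<dots> = (\<Prod>i\<in>UNIV. x - \<zeta> i)"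
      unfolding \<zeta>_def by (rule prod.reindex_bij_betw[OF e, symmetric])
    finally show ?thesis .
  qed
  have "(\<Prod>i\<in>UNIV. x - \<zeta> i * y) = x ^ n - y ^ n" for x y
  proof (cases "y = 0")
    case True
    then show ?thesis
      using n by (simp add: n_def)
  next
    case False
    have "(\<Prod>i\<in>UNIV. x - \<zeta> i * y) = (\<Prod>i\<in>UNIV. y * (x / y - \<zeta> i))"
      using False by (intro prod.cong) (auto simp: field_simps)
    also have "\<dots> = y ^ n * poly p (x / y)"
      by (simp add: p_eq prod.distrib n_def)
    also have "\<dots> = x ^ n - y ^ n"
      using False by (simp add: p_def poly_monom power_divide field_simps)
    finally show ?thesis .
  qed
  then show ?thesis
    unfolding n_def by blast
qed

text \<open>A cyclic bidiagonal matrix with diagonal entries \<open>Y\<^sub>0 - \<zeta>\<^sub>i Y\<^sub>1\<close> and off-diagonal entries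
  \<open>Y\<^sub>2 - \<zeta>\<^sub>i Y\<^sub>3\<close>, where the \<open>\<zeta>\<^sub>i\<close> are the roots of unity of order \<open>m\<close>, has determinant
  \<open>Y\<^sub>0\<^sup>m - Y\<^sub>1\<^sup>m \<plusminus> (Y\<^sub>2\<^sup>m - Y\<^sub>3\<^sup>m)\<close>.\<close>

lemma exists_fermat_coords:
  fixes Q :: "'n::finite set"
  assumes m: "CARD('m::finite) \<ge> 2" and Q: "card Q \<le> 4"
  shows "\<exists>(z0 :: 'k::{alg_closed_field, field_char_0} ^ ('m \<times> 'm \<times> 'n)) \<epsilon>. (\<forall>i\<in>Q. \<epsilon> i \<noteq> 0) \<and>
    det_poly (map_of_coords z0) = (\<Sum>i\<in>Q. Poly_Mapping.single (Poly_Mapping.single i CARD('m)) (\<epsilon> i))"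
proof -
  obtain \<sigma> :: "'m \<Rightarrow> 'm" where \<sigma>: "\<sigma> permutes UNIV" "\<forall>i. \<sigma> i \<noteq> i"
    and cyc: "\<forall>T. T \<noteq> {} \<longrightarrow> (\<forall>i\<in>T. \<sigma> i \<in> T) \<longrightarrow> T = UNIV"
    using exists_cyclic_permutation[OF m] by (elim exE conjE)
  obtain \<zeta> :: "'m \<Rightarrow> 'k" where
    \<zeta>: "\<forall>x y. (\<Prod>i\<in>UNIV. x - \<zeta> i * y) = x ^ CARD('m) - y ^ CARD('m)"
    using exists_binary_form_roots by (elim exE)
  obtain \<kappa> :: "'n \<Rightarrow> nat" where "bij_betw \<kappa> Q {0..<card Q}"
    using ex_bij_betw_finite_nat[of Q] by auto
  then have inj: "inj_on \<kappa> Q" and img: "\<kappa> ` Q = {0..<card Q}"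
    by (auto simp: bij_betw_def)
  have less: "\<kappa> l < 4" if "l \<in> Q" for l
  proof -
    have "\<kappa> l \<in> {0..<card Q}"
      using img that by blast
    then show ?thesis
      using Q by simp
  qed
  define s :: 'k where "s = of_int (sign \<sigma>)"
  have s: "s \<noteq> 0"
    by (simp add: s_def sign_def)
  \<comment> \<open>\<open>e t\<close> selects the variable numbered \<open>t\<close> and is zero if
    \<open>Q\<close> has at most \<open>t\<close> elements, so \<open>Y x t\<close> is that variable
    or 0 and one matrix serves for every size of \<open>Q\<close>.\<close>
  define e where "e t l = (if l \<in> Q \<and> \<kappa> l = t then 1 else 0 :: 'k)" for t l
  define z0 :: "'k ^ ('m \<times> 'm \<times> 'n)" where "z0 = (\<chi> t. case t of (i, j, l) \<Rightarrow>
    if j = i then e 0 l - \<zeta> i * e 1 l else if j = \<sigma> i then e 2 l - \<zeta> i * e 3 l else 0)"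
  \<comment> \<open>The signs of the four powers in the two binary forms, times the sign
    \<open>s\<close> of the permutation for the second form.\<close>
  define \<epsilon> where "\<epsilon> l = (if \<kappa> l = 0 then 1 else if \<kappa> l = 1 then - 1 else if \<kappa> l = 2 then s else - s)" for l
  define Y where "Y x t = (\<Sum>l\<in>UNIV. e t l * x $ l)" for x :: "'k ^ 'n" and t
  have Y: "Y x t ^ CARD('m) = (\<Sum>l\<in>Q. if \<kappa> l = t then (x $ l) ^ CARD('m) else 0)" for x t
  proof (cases "\<exists>l\<in>Q. \<kappa> l = t")
    case True
    then obtain l0 where l0: "l0 \<in> Q" "\<kappa> l0 = t" by blast
    have eq: "\<kappa> l = t \<longleftrightarrow> l = l0" if "l \<in> Q" for l
      using inj l0 that by (auto dest: inj_onD)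
    have "Y x t = (\<Sum>l\<in>UNIV. if l = l0 then x $ l else 0)"
      unfolding Y_def e_def using eq l0 by (intro sum.cong) auto
    moreover have "(\<Sum>l\<in>Q. if \<kappa> l = t then (x $ l) ^ CARD('m) else 0) =
        (\<Sum>l\<in>Q. if l = l0 then (x $ l) ^ CARD('m) else 0)"
      using eq by (intro sum.cong) auto
    ultimately show ?thesis
      using l0(1) by simp
  next
    case False
    then have "Y x t = 0"
      unfolding Y_def e_def by (intro sum.neutral) auto
    moreover have "(\<Sum>l\<in>Q. if \<kappa> l = t then (x $ l) ^ CARD('m) else 0) = 0"
      using False by (intro sum.neutral) auto
    ultimately show ?thesis
      by simp
  qed
  have "map_of_coords z0 x = (\<chi> i j. if j = i then Y x 0 - \<zeta> i * Y x 1
      else if j = \<sigma> i then Y x 2 - \<zeta> i * Y x 3 else 0)" for x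
    by (simp add: map_of_coords_def z0_def Y_def vec_eq_iff left_diff_distrib sum_subtractf
        sum_distrib_left mult.assoc)
  then have "det (map_of_coords z0 x) = (\<Prod>i\<in>UNIV. Y x 0 - \<zeta> i * Y x 1) +
      of_int (sign \<sigma>) * (\<Prod>i\<in>UNIV. Y x 2 - \<zeta> i * Y x 3)" for x
    using det_cyclic_bidiagonal[OF \<sigma>(1), of "\<lambda>i. Y x 0 - \<zeta> i * Y x 1" "\<lambda>i. Y x 2 - \<zeta> i * Y x 3"]
      \<sigma>(2) cyc by simp
  then have det: "det (map_of_coords z0 x) = Y x 0 ^ CARD('m) - Y x 1 ^ CARD('m) +
      s * (Y x 2 ^ CARD('m) - Y x 3 ^ CARD('m))" for x
    by (simp add: \<zeta> s_def)
  have "det (map_of_coords z0 x) = (\<Sum>i\<in>Q. \<epsilon> i * (x $ i) ^ CARD('m))" for x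
  proof -
    have "det (map_of_coords z0 x) = (\<Sum>l\<in>Q.
        (if \<kappa> l = 0 then (x $ l) ^ CARD('m) else 0) - (if \<kappa> l = 1 then (x $ l) ^ CARD('m) else 0) +
        s * ((if \<kappa> l = 2 then (x $ l) ^ CARD('m) else 0) - (if \<kappa> l = 3 then (x $ l) ^ CARD('m) else 0)))"
      unfolding det Y by (simp add: sum.distrib sum_subtractf sum_distrib_left[symmetric])
    also have "\<dots> = (\<Sum>i\<in>Q. \<epsilon> i * (x $ i) ^ CARD('m))"
    proof (rule sum.cong[OF refl])
      fix l assume "l \<in> Q"
      then have "\<kappa> l = 0 \<or> \<kappa> l = 1 \<or> \<kappa> l = 2 \<or> \<kappa> l = 3"
        using less[of l] by linarith
      then show "(if \<kappa> l = 0 then (x $ l) ^ CARD('m) else 0) - (if \<kappa> l = 1 then (x $ l) ^ CARD('m) else 0) +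
          s * ((if \<kappa> l = 2 then (x $ l) ^ CARD('m) else 0) - (if \<kappa> l = 3 then (x $ l) ^ CARD('m) else 0)) =
          \<epsilon> l * (x $ l) ^ CARD('m)"
        by (auto simp: \<epsilon>_def)
    qed
    finally show ?thesis .
  qed
  then have "meval x (det_poly (map_of_coords z0)) =
      meval x (\<Sum>i\<in>Q. Poly_Mapping.single (Poly_Mapping.single i CARD('m)) (\<epsilon> i))" for x
    by (simp add: meval_det_poly[OF map_of_coords_linear] meval_sum mono_eval_single_power)
  then have "det_poly (map_of_coords z0) = (\<Sum>i\<in>Q. Poly_Mapping.single (Poly_Mapping.single i CARD('m)) (\<epsilon> i))"
    by (rule meval_inject)
  moreover have "\<forall>i\<in>Q. \<epsilon> i \<noteq> 0"
    using s by (simp add: \<epsilon>_def)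
  ultimately show ?thesis
    by blast
qed

text \<open>On \<open>X\<close> the function lies in the ideal of the variables in \<open>J\<close>,
  with the degree bound on the cofactors that \<open>alg_indep_card_le\<close> requires when the
  \<open>l j\<close> are these variables.\<close>

definition reducible_on :: "('k::comm_ring_1 ^ 'v::finite) set \<Rightarrow> 'v set \<Rightarrow> nat \<Rightarrow> ('k ^ 'v \<Rightarrow> 'k) \<Rightarrow> bool"
  where "reducible_on X J N f \<longleftrightarrow> (\<exists>g. (\<forall>j\<in>J. deg_le (N - 1) (g j)) \<and>
    (\<forall>x\<in>X. f x = (\<Sum>j\<in>J. x $ j * meval x (g j))))"

lemma deg_le_mconst: "deg_le 0 (mconst c)"
  by (simp add: deg_le_def mconst_def)

lemma deg_le_sum: "(\<And>i. i \<in> S \<Longrightarrow> deg_le d (p i)) \<Longrightarrow> deg_le d (\<Sum>i\<in>S. p i)"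
  unfolding deg_le_def using keys_sum[of p S] by blast

lemma reducible_on_sum_scale:
  assumes "\<And>i. i \<in> S \<Longrightarrow> reducible_on X J N (f i)"
  shows "reducible_on X J N (\<lambda>x. \<Sum>i\<in>S. c i * f i x)"
proof -
  have "\<forall>i\<in>S. \<exists>g. (\<forall>j\<in>J. deg_le (N - 1) (g j)) \<and> (\<forall>x\<in>X. f i x = (\<Sum>j\<in>J. x $ j * meval x (g j)))"
    using assms by (simp add: reducible_on_def)
  from bchoice[OF this] obtain g where g: "\<forall>i\<in>S. (\<forall>j\<in>J. deg_le (N - 1) (g i j)) \<and>
      (\<forall>x\<in>X. f i x = (\<Sum>j\<in>J. x $ j * meval x (g i j)))"
    by (elim exE)
  have "deg_le (N - 1) (\<Sum>i\<in>S. mconst (c i) * g i j)" if "j \<in> J" for j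
  proof (rule deg_le_sum)
    fix i assume "i \<in> S"
    from deg_le_mult[OF deg_le_mconst, of "N - 1" "g i j" "c i"] show "deg_le (N - 1) (mconst (c i) * g i j)"
      using g \<open>i \<in> S\<close> that by simp
  qed
  moreover have "(\<Sum>i\<in>S. c i * f i x) = (\<Sum>j\<in>J. x $ j * meval x (\<Sum>i\<in>S. mconst (c i) * g i j))"
    if x: "x \<in> X" for x
  proof -
    have "(\<Sum>i\<in>S. c i * f i x) = (\<Sum>i\<in>S. \<Sum>j\<in>J. x $ j * (c i * meval x (g i j)))"
      using g x by (intro sum.cong) (auto simp: sum_distrib_left mult_ac)
    also have "\<dots> = (\<Sum>j\<in>J. \<Sum>i\<in>S. x $ j * (c i * meval x (g i j)))"
      by (rule sum.swap)
    finally show ?thesis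
      by (simp add: meval_sum meval_mult sum_distrib_left)
  qed
  ultimately show ?thesis
    unfolding reducible_on_def by (intro exI[of _ "\<lambda>j. \<Sum>i\<in>S. mconst (c i) * g i j"]) simp
qed

lemma reducible_on_monomial:
  assumes a: "mdeg a = N" and j: "j \<in> J" "Poly_Mapping.lookup a j \<noteq> 0" and J: "finite J"
  shows "reducible_on X J N (\<lambda>x. mono_eval x a)"
proof -
  let ?b = "a - Poly_Mapping.single j 1"
  have a_eq: "a = Poly_Mapping.single j 1 + ?b"
    using j(2) by (intro poly_mapping_eqI) (auto simp: lookup_add lookup_minus lookup_single when_def)
  then have "mdeg ?b = N - 1"
    using a by (metis add_diff_cancel_left' mdeg_add mdeg_single)
  moreover have "mono_eval x a = (\<Sum>i\<in>J. x $ i * meval x (if i = j then Poly_Mapping.single ?b 1 else 0))" for x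
  proof -
    have "mono_eval x a = x $ j * mono_eval x ?b"
      by (subst a_eq) (simp add: mono_eval_add mono_eval_single_power)
    also have "\<dots> = (\<Sum>i\<in>J. if i = j then x $ i * mono_eval x ?b else 0)"
      using j(1) J by simp
    also have "\<dots> = (\<Sum>i\<in>J. x $ i * meval x (if i = j then Poly_Mapping.single ?b 1 else 0))"
      by (intro sum.cong) auto
    finally show ?thesis .
  qed
  ultimately show ?thesis
    unfolding reducible_on_def
    by (intro exI[of _ "\<lambda>i. if i = j then Poly_Mapping.single ?b 1 else 0"]) (auto simp: deg_le_def)
qed

text \<open>The matrix that expresses, modulo the variables outside \<open>Q\<close>, suitable monomial multiples of
  the partial derivatives through the monomials of degree \<open>N\<close> in the variables in \<open>Q\<close>. Its
  entries are polynomials in the coordinates of \<open>L\<close>, and at the Fermat form it is diagonal.\<close>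

theorem exists_general_reduction:
  fixes Q :: "'n::finite set"
  assumes m: "CARD('m::finite) \<ge> 2" and Q: "card Q \<le> 4"
  shows "\<exists>(F :: ('m \<times> 'm \<times> 'n, 'k::{alg_closed_field, field_char_0}) mpoly) z0 N. meval z0 F \<noteq> 0 \<and> N \<ge> 1 \<and>
    (\<forall>(L :: 'k ^ 'n \<Rightarrow> 'k ^ 'm ^ 'm) i. meval (map_coords L) F \<noteq> 0 \<longrightarrow>
      reducible_on (Sing (det_poly L)) (- Q) N (\<lambda>x. (x $ i) ^ N))"
proof -
  let ?m = "CARD('m)"
  obtain c :: "('n \<Rightarrow>\<^sub>0 nat) \<Rightarrow> ('m \<times> 'm \<times> 'n, 'k) mpoly" where
    c: "\<forall>L :: 'k ^ 'n \<Rightarrow> 'k ^ 'm ^ 'm. det_poly L =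
      (\<Sum>a\<in>monomials ?m. Poly_Mapping.single a (meval (map_coords L) (c a)))"
    using det_poly_form_family by (elim exE)
  obtain z0 :: "'k ^ ('m \<times> 'm \<times> 'n)" and \<epsilon> where \<epsilon>: "\<forall>i\<in>Q. \<epsilon> i \<noteq> 0"
    and fermat: "det_poly (map_of_coords z0) = (\<Sum>i\<in>Q. Poly_Mapping.single (Poly_Mapping.single i ?m) (\<epsilon> i))"
    using exists_fermat_coords[OF m Q] by (elim exE conjE)
  have c0: "meval z0 (c a) = (\<Sum>i\<in>Q. if Poly_Mapping.single i ?m = a then \<epsilon> i else 0)"
    if "a \<in> monomials ?m" for a
  proof -
    have "meval z0 (c a) = Poly_Mapping.lookup (det_poly (map_of_coords z0)) a"
      using that by (simp add: c map_coords_map_of_coords finite_monomials lookup_sum lookup_single when_def)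
    then show ?thesis
      by (simp add: fermat lookup_sum lookup_single when_def)
  qed
  \<comment> \<open>By the pigeonhole principle a monomial of this degree in the variables of
    \<open>Q\<close> has an exponent of at least \<open>?m - 1\<close>, the degree of a partial
    derivative.\<close>
  define N where "N = Suc (card Q * (?m - 2))"
  define E where "E = {b \<in> monomials N. \<forall>i. i \<notin> Q \<longrightarrow> Poly_Mapping.lookup b i = 0}"
  have finE: "finite E"
    by (rule finite_subset[OF _ finite_monomials[of N]]) (auto simp: E_def)
  have "\<exists>i\<in>Q. ?m - 1 \<le> Poly_Mapping.lookup b i" if "b \<in> E" for b
  proof (rule ccontr)
    assume "\<not> (\<exists>i\<in>Q. ?m - 1 \<le> Poly_Mapping.lookup b i)"
    then have "Poly_Mapping.lookup b i \<le> ?m - 2" if "i \<in> Q" for i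
      using that by (auto simp: not_le)
    then have "(\<Sum>i\<in>Q. Poly_Mapping.lookup b i) \<le> card Q * (?m - 2)"
      using sum_bounded_above[of Q "Poly_Mapping.lookup b" "?m - 2"] by simp
    moreover have "mdeg b = (\<Sum>i\<in>Q. Poly_Mapping.lookup b i)"
      unfolding mdeg_def using that by (intro sum.mono_neutral_right) (auto simp: E_def)
    ultimately show False
      using that by (simp add: E_def monomials_def N_def)
  qed
  then obtain \<iota> where \<iota>: "\<And>b. b \<in> E \<Longrightarrow> \<iota> b \<in> Q" "\<And>b. b \<in> E \<Longrightarrow> ?m - 1 \<le> Poly_Mapping.lookup b (\<iota> b)"
    by metis
  define W where "W b = {a \<in> monomials ?m. Poly_Mapping.lookup a (\<iota> b) \<noteq> 0}" for b
  have finW: "finite (W b)" for b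
    by (rule finite_subset[OF _ finite_monomials[of ?m]]) (auto simp: W_def)
  \<comment> \<open>Row \<open>b\<close> of the matrix comes from the partial derivative in
    direction \<open>\<iota> b\<close>, multiplied by the monomial \<open>\<beta> b\<close>; this
    carries the term \<open>a\<close> of the form to the exponent \<open>\<tau> b a\<close>.\<close>
  define \<beta> where "\<beta> b = b - Poly_Mapping.single (\<iota> b) (?m - 1)" for b
  define \<tau> where "\<tau> b a = \<beta> b + (a - Poly_Mapping.single (\<iota> b) 1)" for b a
  have \<beta>: "b = Poly_Mapping.single (\<iota> b) (?m - 1) + \<beta> b" if "b \<in> E" for b
    using \<iota>(2)[OF that] by (intro poly_mapping_eqI)
      (auto simp: \<beta>_def lookup_add lookup_minus lookup_single when_def)
  have mdeg_\<tau>: "mdeg (\<tau> b a) = N" if "b \<in> E" "a \<in> W b" for a b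
  proof -
    have "a = Poly_Mapping.single (\<iota> b) 1 + (a - Poly_Mapping.single (\<iota> b) 1)"
      using that(2) by (intro poly_mapping_eqI)
        (auto simp: W_def lookup_add lookup_minus lookup_single when_def)
    then have "mdeg a = 1 + mdeg (a - Poly_Mapping.single (\<iota> b) 1)"
      by (metis mdeg_add mdeg_single)
    moreover have "mdeg b = (?m - 1) + mdeg (\<beta> b)"
      using arg_cong[OF \<beta>[OF that(1)], of mdeg] by simp
    moreover have "mdeg a = ?m" "mdeg b = N"
      using that by (simp_all add: E_def W_def monomials_def)
    ultimately show ?thesis
      unfolding \<tau>_def mdeg_add by linarith
  qed
  define A where "A b b' = (\<Sum>a\<in>{a \<in> W b. \<tau> b a = b'}.
      mconst (of_nat (Poly_Mapping.lookup a (\<iota> b))) * c a)" for b b'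
  have A: "meval z (A b b') = (\<Sum>a\<in>{a \<in> W b. \<tau> b a = b'}.
      of_nat (Poly_Mapping.lookup a (\<iota> b)) * meval z (c a))" for z b b'
    by (simp add: A_def meval_sum meval_mult)
  have pivot: "Poly_Mapping.single (\<iota> b) ?m \<in> W b" "\<tau> b (Poly_Mapping.single (\<iota> b) ?m) = b" if "b \<in> E" for b
  proof -
    show "Poly_Mapping.single (\<iota> b) ?m \<in> W b"
      using m by (simp add: W_def monomials_def)
    have "Poly_Mapping.single (\<iota> b) ?m - Poly_Mapping.single (\<iota> b) 1 = Poly_Mapping.single (\<iota> b) (?m - 1)"
      by (rule poly_mapping_eqI) (auto simp: lookup_minus lookup_single when_def)
    then show "\<tau> b (Poly_Mapping.single (\<iota> b) ?m) = b"
      using \<beta>[OF that] by (simp add: \<tau>_def add.commute)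
  qed
  \<comment> \<open>The Fermat form contains only pure powers, and among these only that of the
    variable \<open>\<iota> b\<close> has a nonzero derivative in this direction.\<close>
  have off: "meval z0 (c a) = 0" if "a \<in> W b" "a \<noteq> Poly_Mapping.single (\<iota> b) ?m" for a b
  proof -
    have "(if Poly_Mapping.single i ?m = a then \<epsilon> i else 0) = 0" for i
      using that by (auto simp: W_def lookup_single when_def split: if_splits)
    then show ?thesis
      using that(1) c0[of a] by (simp add: W_def)
  qed
  have c0_pivot: "meval z0 (c (Poly_Mapping.single (\<iota> b) ?m)) = \<epsilon> (\<iota> b)" if "b \<in> E" for b
  proof -
    have inj: "Poly_Mapping.single i ?m = Poly_Mapping.single (\<iota> b) ?m \<longleftrightarrow> i = \<iota> b" for i
      using m by (metis lookup_single_eq lookup_single_not_eq not_numeral_le_zero)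
    show ?thesis
      using c0[of "Poly_Mapping.single (\<iota> b) ?m"] pivot(1)[OF that] \<iota>(1)[OF that] by (simp add: inj W_def)
  qed
  \<comment> \<open>The diagonal entry is \<open>?m * \<epsilon> (\<iota> b)\<close>, nonzero in
    characteristic 0.\<close>
  have diag: "meval z0 (A b b) \<noteq> 0" if b: "b \<in> E" for b
  proof -
    have "meval z0 (A b b) = (\<Sum>a\<in>{Poly_Mapping.single (\<iota> b) ?m}.
        of_nat (Poly_Mapping.lookup a (\<iota> b)) * meval z0 (c a))"
      unfolding A using pivot[OF b] off finW by (intro sum.mono_neutral_right) auto
    then show ?thesis
      using \<iota>(1)[OF b] \<epsilon> by (simp add: c0_pivot[OF b])
  qed
  have off_diag: "meval z0 (A b b') = 0" if "b \<in> E" "b' \<in> E" "b \<noteq> b'" for b b'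
    unfolding A
  proof (intro sum.neutral ballI)
    fix a assume a: "a \<in> {a \<in> W b. \<tau> b a = b'}"
    then have "a \<noteq> Poly_Mapping.single (\<iota> b) ?m"
      using pivot(2)[OF that(1)] that(3) by auto
    then show "of_nat (Poly_Mapping.lookup a (\<iota> b)) * meval z0 (c a) = 0"
      using off[of a b] a by simp
  qed
  have "\<exists>F. meval z0 F \<noteq> 0 \<and> (\<forall>z. meval z F \<noteq> 0 \<longrightarrow> (\<forall>b\<in>E.
      \<exists>w. \<forall>v. v b = (\<Sum>i\<in>E. w i * (\<Sum>j\<in>E. meval z (A i j) * v j))))"
    using diag off_diag by (rule generic_left_inverse[OF finE])
  then obtain F where F: "meval z0 F \<noteq> 0" and inv: "\<forall>z. meval z F \<noteq> 0 \<longrightarrow> (\<forall>b\<in>E.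
      \<exists>w. \<forall>v. v b = (\<Sum>i\<in>E. w i * (\<Sum>j\<in>E. meval z (A i j) * v j)))"
    by (elim exE conjE)
  have red: "reducible_on (Sing (det_poly L)) (- Q) N (\<lambda>x. (x $ i) ^ N)"
    if L: "meval (map_coords L) F \<noteq> 0" for L :: "'k ^ 'n \<Rightarrow> 'k ^ 'm ^ 'm" and i
  proof (cases "i \<in> Q")
    case False
    then have "reducible_on (Sing (det_poly L)) (- Q) N (\<lambda>x. mono_eval x (Poly_Mapping.single i N))"
      by (intro reducible_on_monomial[of _ _ i]) (simp_all add: N_def)
    then show ?thesis
      by (simp add: mono_eval_single_power)
  next
    case True
    let ?z = "map_coords L" and ?X = "Sing (det_poly L)"
    have "Poly_Mapping.single i N \<in> E"
      using True by (auto simp: E_def monomials_def lookup_single when_def)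
    from inv[rule_format, OF L this] obtain w where w: "\<forall>v. v (Poly_Mapping.single i N) =
        (\<Sum>b\<in>E. w b * (\<Sum>b'\<in>E. meval ?z (A b b') * v b'))"
      by (elim exE)
    \<comment> \<open>Minus the terms whose monomial is not in \<open>E\<close>; being of degree
      \<open>N\<close>, such a monomial contains a variable outside \<open>Q\<close>.\<close>
    define rest where "rest b x = (\<Sum>a\<in>{a \<in> W b. \<tau> b a \<notin> E}.
        (- of_nat (Poly_Mapping.lookup a (\<iota> b)) * meval ?z (c a)) * mono_eval x (\<tau> b a))" for b x
    have row: "(\<Sum>b'\<in>E. meval ?z (A b b') * mono_eval x b') = rest b x" if b: "b \<in> E" and x: "x \<in> ?X" for b x
    proof -
      define t where "t a = of_nat (Poly_Mapping.lookup a (\<iota> b)) * meval ?z (c a) * mono_eval x (\<tau> b a)" for a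
      have "0 = mono_eval x (\<beta> b) * meval x (pdiff (\<iota> b) (det_poly L))"
        using x by (simp add: mem_Sing_iff)
      also have "\<dots> = (\<Sum>a\<in>monomials ?m. t a)"
        unfolding c[rule_format, of L] meval_pdiff_sum_single[OF finite_monomials] sum_distrib_left
        by (intro sum.cong) (simp_all add: t_def \<tau>_def mono_eval_add mult_ac)
      also have "\<dots> = (\<Sum>a\<in>W b. t a)"
        by (intro sum.mono_neutral_right finite_monomials) (auto simp: W_def t_def)
      also have "\<dots> = (\<Sum>a\<in>{a \<in> W b. \<tau> b a \<in> E}. t a) + (\<Sum>a\<in>{a \<in> W b. \<tau> b a \<notin> E}. t a)"
        using finW by (subst sum.union_disjoint[symmetric]) (auto intro: sum.cong)
      also have "(\<Sum>a\<in>{a \<in> W b. \<tau> b a \<notin> E}. t a) = - rest b x"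
        by (simp add: rest_def t_def sum_negf)
      also have "(\<Sum>a\<in>{a \<in> W b. \<tau> b a \<in> E}. t a) =
          (\<Sum>b'\<in>E. \<Sum>a\<in>{a \<in> {a \<in> W b. \<tau> b a \<in> E}. \<tau> b a = b'}. t a)"
        using finW by (intro sum.group[symmetric] finE) auto
      also have "\<dots> = (\<Sum>b'\<in>E. meval ?z (A b b') * mono_eval x b')"
        unfolding A sum_distrib_right by (intro sum.cong) (auto simp: t_def)
      finally show ?thesis
        by simp
    qed
    have "reducible_on ?X (- Q) N (rest b)" if b: "b \<in> E" for b
      unfolding rest_def
    proof (rule reducible_on_sum_scale)
      fix a assume a: "a \<in> {a \<in> W b. \<tau> b a \<notin> E}"
      then have "mdeg (\<tau> b a) = N"
        using mdeg_\<tau>[OF b] by blast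
      moreover obtain j where "j \<in> - Q" "Poly_Mapping.lookup (\<tau> b a) j \<noteq> 0"
        using a \<open>mdeg (\<tau> b a) = N\<close> by (auto simp: E_def monomials_def)
      ultimately show "reducible_on ?X (- Q) N (\<lambda>x. mono_eval x (\<tau> b a))"
        by (intro reducible_on_monomial) auto
    qed
    then have "reducible_on ?X (- Q) N (\<lambda>x. \<Sum>b\<in>E. w b * rest b x)"
      by (rule reducible_on_sum_scale)
    moreover have "(x $ i) ^ N = (\<Sum>b\<in>E. w b * rest b x)" if x: "x \<in> ?X" for x
    proof -
      have "(x $ i) ^ N = mono_eval x (Poly_Mapping.single i N)"
        by (simp add: mono_eval_single_power)
      also have "\<dots> = (\<Sum>b\<in>E. w b * (\<Sum>b'\<in>E. meval ?z (A b b') * mono_eval x b'))"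
        by (rule w[rule_format])
      also have "\<dots> = (\<Sum>b\<in>E. w b * rest b x)"
        using row x by (intro sum.cong) auto
      finally show ?thesis .
    qed
    ultimately show ?thesis
      unfolding reducible_on_def by simp
  qed
  show ?thesis
    using F red by (intro exI[of _ F] exI[of _ z0] exI[of _ N]) (simp add: N_def)
qed

theorem theorem1p7:
  assumes m: "CARD('m::finite) \<ge> 2"
  shows
    "(\<forall>L \<in> (linear_maps :: ('k::{alg_closed_field, field_char_0} ^ 'n::finite \<Rightarrow> 'k ^ 'm ^ 'm) set).
        codim (Sing (det_poly L)) \<le> ereal (real (min 4 CARD('n)))) \<and>
     for_general_linear_map (\<lambda>L :: 'k ^ 'n \<Rightarrow> 'k ^ 'm ^ 'm.
        codim (Sing (det_poly L)) = ereal (real (min 4 CARD('n)))) \<and>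
     (CARD('n) \<le> 4 \<longrightarrow>
        for_general_linear_map (\<lambda>L :: 'k ^ 'n \<Rightarrow> 'k ^ 'm ^ 'm. proj_nonsingular (det_poly L))) \<and>
     (CARD('n) > 4 \<longrightarrow>
        (\<forall>L \<in> (linear_maps :: ('k ^ 'n \<Rightarrow> 'k ^ 'm ^ 'm) set). \<not> proj_nonsingular (det_poly L)))"
proof -
  let ?r = "min 4 CARD('n)"
  have diff: "real (CARD('n) - ?r) = real CARD('n) - real ?r"
    by (simp add: of_nat_diff)
  have upper: "codim (Sing (det_poly L)) \<le> ereal (real ?r)" if "L \<in> linear_maps"
    for L :: "'k ^ 'n \<Rightarrow> 'k ^ 'm ^ 'm"
  proof -
    have "codim (Sing (det_poly L)) \<le> ereal (real CARD('n)) - ereal (real (CARD('n) - ?r))"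
      unfolding codim_def by (intro ereal_minus_mono order_refl zariski_dim_Sing_ge[OF m that])
    then show ?thesis
      by (simp add: diff)
  qed
  obtain Q :: "'n set" where Q: "card Q = ?r"
    using obtain_subset_with_card_n[of ?r "UNIV :: 'n set"] by auto
  then have "card Q \<le> 4"
    by simp
  from exists_general_reduction[OF m this]
  obtain F :: "('m \<times> 'm \<times> 'n, 'k) mpoly" and z0 N where F: "meval z0 F \<noteq> 0" and N: "N \<ge> 1"
    and red: "\<forall>(L :: 'k ^ 'n \<Rightarrow> 'k ^ 'm ^ 'm) i. meval (map_coords L) F \<noteq> 0 \<longrightarrow>
      reducible_on (Sing (det_poly L)) (- Q) N (\<lambda>x. (x $ i) ^ N)"
    by (elim exE conjE)
  have rel: "\<exists>g. \<forall>i. (\<forall>j\<in>- Q. deg_le (N - 1) (g i j)) \<and>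
      (\<forall>x\<in>Sing (det_poly L). (x $ i) ^ N = (\<Sum>j\<in>- Q. x $ j * meval x (g i j)))"
    if L: "meval (map_coords L) F \<noteq> 0" for L :: "'k ^ 'n \<Rightarrow> 'k ^ 'm ^ 'm"
    using red L unfolding reducible_on_def by (intro choice) simp
  have card: "card (- Q) = CARD('n) - ?r"
    using Q by (simp add: Compl_eq_Diff_UNIV card_Diff_subset)
  have general: "codim (Sing (det_poly L)) = ereal (real ?r)"
    if L: "L \<in> linear_maps" "meval (map_coords L) F \<noteq> 0" for L :: "'k ^ 'n \<Rightarrow> 'k ^ 'm ^ 'm"
  proof -
    obtain g where g: "\<forall>i. (\<forall>j\<in>- Q. deg_le (N - 1) (g i j)) \<and>
        (\<forall>x\<in>Sing (det_poly L). (x $ i) ^ N = (\<Sum>j\<in>- Q. x $ j * meval x (g i j)))"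
      using rel[OF L(2)] by (elim exE)
    have "zariski_dim (Sing (det_poly L)) \<le> ereal (real (CARD('n) - ?r))"
    proof (rule zariski_dim_le)
      fix d and y :: "nat \<Rightarrow> ('n, 'k) mpoly"
      assume "alg_indep {..<d} y (vanishing (Sing (det_poly L)))"
      then have "card {..<d} \<le> card (- Q)"
        using g by (intro alg_indep_card_le[of "- Q" N g _ "\<lambda>j x. x $ j", OF _ N]) auto
      then show "d \<le> CARD('n) - ?r"
        by (simp add: card)
    qed
    then have "zariski_dim (Sing (det_poly L)) = ereal (real (CARD('n) - ?r))"
      using zariski_dim_Sing_ge[OF m L(1)] by (rule antisym)
    then show ?thesis
      by (simp add: codim_def diff)
  qed
  have "for_general_linear_map (\<lambda>L :: 'k ^ 'n \<Rightarrow> 'k ^ 'm ^ 'm.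
      codim (Sing (det_poly L)) = ereal (real ?r))"
    using F general by (rule for_general_linear_mapI)
  moreover have "for_general_linear_map (\<lambda>L :: 'k ^ 'n \<Rightarrow> 'k ^ 'm ^ 'm. proj_nonsingular (det_poly L))"
    if n: "CARD('n) \<le> 4"
  proof (rule for_general_linear_mapI[OF F])
    fix L :: "'k ^ 'n \<Rightarrow> 'k ^ 'm ^ 'm" assume L: "meval (map_coords L) F \<noteq> 0"
    \<comment> \<open>Every variable belongs to \<open>Q\<close>, so the sums in \<open>rel\<close>
      are empty and force \<open>x $ i ^ N = 0\<close>.\<close>
    have "- Q = {}"
      using card n by simp
    then have "x $ i ^ N = 0" if "x \<in> Sing (det_poly L)" for x i
      using rel[OF L] that by auto
    then have zero: "x = 0" if "x \<in> Sing (det_poly L)" for x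
      using that by (simp add: vec_eq_iff)
    have "P \<notin> proj_Sing (det_poly L)" for P
    proof
      assume P: "P \<in> proj_Sing (det_poly L)"
      then obtain x where x: "P = vec.span {x}" "x \<noteq> 0"
        by (auto simp: proj_Sing_def proj_space_def)
      then have "x \<in> P - {0}"
        by (simp add: vec.span_base)
      then have "x \<in> Sing (det_poly L)"
        using P by (simp add: proj_Sing_def mem_Sing_iff)
      then show False
        using zero x(2) by blast
    qed
    then show "proj_nonsingular (det_poly L)"
      by (auto simp: proj_nonsingular_def)
  qed
  moreover have "\<not> proj_nonsingular (det_poly L)" if n: "CARD('n) > 4" and L: "L \<in> linear_maps"
    for L :: "'k ^ 'n \<Rightarrow> 'k ^ 'm ^ 'm"
  proof -
    obtain x where x: "x \<in> Sing (det_poly L)" "x \<noteq> 0"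
      using Sing_nonzero[OF m L n] by blast
    have "y \<in> Sing (det_poly L)" if "y \<in> vec.span {x}" for y
      using Sing_det_poly_cone[OF m L] x(1) that by (auto simp: vec.span_singleton is_cone_def)
    then have "vec.span {x} \<in> proj_Sing (det_poly L)"
      using x(2) by (auto simp: proj_Sing_def proj_space_def mem_Sing_iff)
    then show ?thesis
      by (auto simp: proj_nonsingular_def)
  qed
  ultimately show ?thesis
    using upper by blast
qed

end
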